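(* Let $F$ be a finite field of characteristic $2$, and let $G\cong M_2(n+1,m+1)\mathbin{\mathsf Y} D_8^{\mathsf Y (k-1)}$, where $n\ge m\ge 1$ and $k\ge 1$. Let $G'=\langle c\rangle$ (a group of order $2$). Then: (i) $|\Omega_1(G)|=|\Omega_c(G)|=2^{2k}$. (ii) $|V_*(FG)|=2|F|^{\frac{|G|+|\Omega_1(G)|}{2}-1}$ if $n=1$ and $k\ge 2$, and $|V_*(FG)|=4|F|^{\frac{|G|+|\Omega_1(G)|}{2}-1}$ otherwise.
   Context: $V(FG)=\{\sum_{g}\alpha_g g\in FG:\sum_g\alpha_g=1\}$ is the group of normalized units; $(\sum_g\alpha_g g)^*=\sum_g\alpha_g g^{-1}$; $V_*(FG)=\{x\in V(FG):x^*=x^{-1}\}$. $\Omega_1(G)=\{g\in G:g^2=1\}$ and $\Omega_c(G)=\{g\in G: g^2=c\}$. $D_8$ is the dihedral group of order $8$. For $u\ge 2$, $v\ge 1$, $M_2(u,v)=\langle a,b\mid a^{2^u}=b^{2^v}=1,\ a^b=a^{1+2^{u-1}}\rangle$ (order $2^{u+v}$). $H\mathbin{\mathsf Y}K$ denotes the central product (a group $HK$ with $[H,K]=1$); here all the factors have derived subgroup of order $2$, and the central product is formed by identifying these derived subgroups with one common subgroup $\langle c\rangle$ of order $2$, so that factors intersect exactly in $\langle c\rangle$. $H^{\mathsf Y k}$ is the central product of $k$ copies of $H$, and $D_8^{\mathsf Y 0}$ means the factor is omitted. *)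

theory Defs
  imports "HOL-Algebra.Generated_Groups" "HOL-Algebra.Ring"
begin

section \<open>Groups given by generators and relations\<close>

text \<open>A letter is a generator together with a sign: \<open>(x, True)\<close> stands for \<open>x\<close> and
  \<open>(x, False)\<close> for its formal inverse.  A relation \<open>(u, v)\<close> reads \<open>u = v\<close>.\<close>

type_synonym 'x word = "('x \<times> bool) list"

inductive pres_eq :: "('x word \<times> 'x word) set \<Rightarrow> 'x word \<Rightarrow> 'x word \<Rightarrow> bool"
  for R :: "('x word \<times> 'x word) set"
where
  refl: "pres_eq R u u"
| sym: "pres_eq R u v \<Longrightarrow> pres_eq R v u"
| trans: "pres_eq R u v \<Longrightarrow> pres_eq R v w \<Longrightarrow> pres_eq R u w"
| append: "pres_eq R u u' \<Longrightarrow> pres_eq R v v' \<Longrightarrow> pres_eq R (u @ v) (u' @ v')"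
| cancel: "pres_eq R [(x, e), (x, \<not> e)] []"
| rel: "(u, v) \<in> R \<Longrightarrow> pres_eq R u v"

definition pres_class :: "('x word \<times> 'x word) set \<Rightarrow> 'x word \<Rightarrow> 'x word set" where
  "pres_class R u = {v. pres_eq R u v}"

definition presented_group :: "('x word \<times> 'x word) set \<Rightarrow> 'x word set monoid" where
  "presented_group R =
     \<lparr>carrier = range (pres_class R),
      mult = (\<lambda>U W. \<Union>u\<in>U. \<Union>w\<in>W. pres_class R (u @ w)),
      one = pres_class R []\<rparr>"

datatype gen = A | B

definition wpow :: "'x \<Rightarrow> nat \<Rightarrow> 'x word" where
  "wpow x i = replicate i (x, True)"

text \<open>The conjugate \<open>a\<^sup>b\<close> is \<open>b\<^sup>-\<^sup>1 a b\<close>.\<close>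

definition M2 :: "nat \<Rightarrow> nat \<Rightarrow> gen word set monoid" where
  "M2 u v = presented_group
     {(wpow A (2 ^ u), []),
      (wpow B (2 ^ v), []),
      ([(B, False), (A, True), (B, True)], wpow A (1 + 2 ^ (u - 1)))}"

definition D8 :: "gen word set monoid" where
  "D8 = presented_group
     {(wpow A 4, []),
      (wpow B 2, []),
      ([(B, False), (A, True), (B, True)], [(A, False)])}"


section \<open>Central products with amalgamated derived subgroups\<close>

text \<open>\<open>G\<close> is the (internal) central product of groups isomorphic to the members of \<open>Hs\<close>, all of
  which have derived subgroup of order 2; these derived subgroups are identified with one
  subgroup \<open>{\<one>, c}\<close>, in which each factor meets the product of the remaining ones.  For at least
  two factors the last inclusion is an equality, because every factor contains \<open>c\<close>;
  for a single factor the product of the remaining ones is trivial and the condition is void.\<close>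

definition is_central_product :: "('g, 'x) monoid_scheme \<Rightarrow> ('h, 'y) monoid_scheme list \<Rightarrow> bool" where
  "is_central_product G Hs \<longleftrightarrow>
     (\<exists>K c. c \<in> carrier G \<and> c \<noteq> \<one>\<^bsub>G\<^esub> \<and>
        (\<forall>i<length Hs. subgroup (K i) G \<and> G\<lparr>carrier := K i\<rparr> \<cong> Hs ! i \<and>
           derived G (K i) = {\<one>\<^bsub>G\<^esub>, c}) \<and>
        carrier G = generate G (\<Union>i<length Hs. K i) \<and>
        (\<forall>i<length Hs. \<forall>j<length Hs. i \<noteq> j \<longrightarrow>
           (\<forall>x\<in>K i. \<forall>y\<in>K j. x \<otimes>\<^bsub>G\<^esub> y = y \<otimes>\<^bsub>G\<^esub> x)) \<and>
        (\<forall>i<length Hs. K i \<inter> generate G (\<Union>j\<in>{..<length Hs} - {i}. K j) \<subseteq> {\<one>\<^bsub>G\<^esub>, c}))"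

text \<open>The set of square roots of \<open>c\<close>; it need not be a subgroup, not even for \<open>c = \<one>\<close>.\<close>

definition Omega :: "('g, 'x) monoid_scheme \<Rightarrow> 'g \<Rightarrow> 'g set" where
  "Omega G c = {g \<in> carrier G. g [^]\<^bsub>G\<^esub> (2::nat) = c}"

definition Omega1 :: "('g, 'x) monoid_scheme \<Rightarrow> 'g set" where
  "Omega1 G = Omega G \<one>\<^bsub>G\<^esub>"


section \<open>Group algebras and unitary units\<close>

text \<open>An element \<open>\<Sum>\<^sub>g \<alpha>\<^sub>g g\<close> is represented by its coefficient function, which vanishes outside
  \<open>carrier G\<close> and has finite support.\<close>

definition group_algebra :: "('g, 'x) monoid_scheme \<Rightarrow> ('g \<Rightarrow> 'f::field) ring" where
  "group_algebra G =
     \<lparr>carrier = {x. finite {g. x g \<noteq> 0} \<and> {g. x g \<noteq> 0} \<subseteq> carrier G},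
      mult = (\<lambda>x y g. if g \<in> carrier G
                then \<Sum>h | x h \<noteq> 0. x h * y (inv\<^bsub>G\<^esub> h \<otimes>\<^bsub>G\<^esub> g) else 0),
      one = (\<lambda>g. if g = \<one>\<^bsub>G\<^esub> then 1 else 0),
      zero = (\<lambda>g. 0),
      add = (\<lambda>x y g. x g + y g)\<rparr>"

definition augmentation :: "('g \<Rightarrow> 'f::field) \<Rightarrow> 'f" where
  "augmentation x = (\<Sum>g | x g \<noteq> 0. x g)"

definition star :: "('g, 'x) monoid_scheme \<Rightarrow> ('g \<Rightarrow> 'f::field) \<Rightarrow> ('g \<Rightarrow> 'f)" where
  "star G x = (\<lambda>g. if g \<in> carrier G then x (inv\<^bsub>G\<^esub> g) else 0)"

text \<open>All elements of augmentation 1.  These are units when \<open>G\<close> is a finite \<open>p\<close>-group and the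
  coefficient field has characteristic \<open>p\<close>.\<close>

definition V :: "('g, 'x) monoid_scheme \<Rightarrow> ('g \<Rightarrow> 'f::field) set" where
  "V G = {x \<in> carrier (group_algebra G). augmentation x = 1}"

text \<open>The condition \<open>x \<in> Units\<close> only guards against the unspecified value of \<open>inv\<close> at non-units.\<close>

definition V_star :: "('g, 'x) monoid_scheme \<Rightarrow> ('g \<Rightarrow> 'f::field) set" where
  "V_star G = {x \<in> V G. x \<in> Units (group_algebra G) \<and> star G x = inv\<^bsub>group_algebra G\<^esub> x}"

end

theory Submission
  imports Defs "HOL-Algebra.Elementary_Groups" "HOL-Algebra.Multiplicative_Group"
    "HOL-Computational_Algebra.Primes"
begin

text \<open>
  Let \<open>p : G \<rightarrow> A\<close> be surjective with kernel \<open>{\<one>, c}\<close> of order 2, where \<open>A\<close> is abelian, and let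
  \<open>T = p (\<Omega>\<^sub>c)\<close>.  For a unitary \<open>y \<in> FA\<close> and any lift \<open>x \<in> FG\<close>, the coefficients of \<open>x x\<^sup>*\<close> at the
  roots of \<open>c\<close> depend only on \<open>y\<close>; they define a homomorphism \<open>lam\<close> from \<open>V\<^sub>*(FA)\<close> to the
  additive group \<open>F\<^sup>T\<close>.  The image of \<open>V\<^sub>*(FG)\<close> in \<open>V\<^sub>*(FA)\<close> is the kernel of \<open>lam\<close>, and all
  fibres have \<open>|F|\<close> to the power \<open>(|A| + |\<Omega>\<^sub>1(A)|) / 2\<close> elements.  So \<open>|V\<^sub>*(FG)|\<close> follows from
  \<open>|V\<^sub>*(FA)|\<close> and the size of the image of \<open>lam\<close>, which is either \<open>F\<^sup>T\<close> or the subgroup of index 2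
  on which the sum of the coordinates has the form \<open>a\<^sup>2 + a\<close>.

  This determines \<open>|V\<^sub>*|\<close> first for products of cyclic 2-groups, by repeatedly dividing out an
  involution, and then for \<open>G\<close> with \<open>A = G / G'\<close>, a direct product of cyclic groups of orders
  \<open>2\<^sup>n\<close>, \<open>2\<^bsup>m+1\<^esup>\<close> and \<open>2k - 2\<close> factors of order 2.
\<close>

section \<open>Unitary units of finite groups\<close>

text \<open>Only the roots of \<open>c\<close> obstruct lifting a unitary \<open>y\<close>. Changing
  a lift by a \<open>c\<close>-invariant summand changes \<open>x x^*\<close> by the pullback of
  some \<open>v + v^*\<close>, and these give every symmetric element of \<open>FA\<close> that
  vanishes where \<open>u^2 = 1\<close>. Such a \<open>u\<close>, if nontrivial, lifts to
  involutions, where the coefficient is 0 anyway, or to roots of \<open>c\<close>, where it is given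
  by \<open>lam y\<close>.

  Write \<open>|V_*| = theta |F|^(s-1)\<close>, with \<open>s\<close> half of the order plus the
  number of roots of 1. Counting roots gives \<open>2 s(A) = s(G) + |T|\<close>, so
  \<open>theta(G)\<close> is \<open>theta(A)\<close> times the index of the image of
  \<open>lam\<close>. A cyclic factor of order 2 contributes 1 and a larger one 2, so
  \<open>theta(G/G')\<close> is 4 for \<open>n >= 2\<close> and 2 for \<open>n = 1\<close>. The root
  \<open>a^(2^(n-1))\<close> of \<open>c\<close> is a square for \<open>n >= 2\<close>, which makes
  the index 1. For \<open>n = 1\<close> a noncommuting pair in a \<open>D_8\<close> also gives index
  1; only without such a factor is the index 2.

  The count \<open>2^(2k)\<close> arises because \<open>G/G'\<close> has
  \<open>2 * 2 * 2^(2k-2)\<close> roots of 1, over which lie equally many roots of 1 and of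
  \<open>c\<close>.\<close>

definition supp_in :: "('g, 'x) monoid_scheme \<Rightarrow> ('g \<Rightarrow> 'f::zero) \<Rightarrow> bool" where
  "supp_in G x \<longleftrightarrow> (\<forall>g. g \<notin> carrier G \<longrightarrow> x g = 0)"

text \<open>The product of the group algebra with the sum taken over the whole finite carrier, so
  that no supports have to be tracked.\<close>

definition conv :: "('g, 'x) monoid_scheme \<Rightarrow> ('g \<Rightarrow> 'f::field) \<Rightarrow> ('g \<Rightarrow> 'f) \<Rightarrow> 'g \<Rightarrow> 'f" where
  "conv G x y = (\<lambda>g. if g \<in> carrier G
     then \<Sum>h\<in>carrier G. x h * y (inv\<^bsub>G\<^esub> h \<otimes>\<^bsub>G\<^esub> g) else 0)"

definition delta :: "'g \<Rightarrow> 'g \<Rightarrow> 'f::zero_neq_one" where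
  "delta h = (\<lambda>g. if g = h then 1 else 0)"

text \<open>The coefficient of \<open>x y^*\<close> at the inverse of \<open>g\<close>: the bilinear
  form whose diagonal is \<open>corr\<close>, needed because lifts are changed by adding
  summands.\<close>

definition cross :: "('g, 'x) monoid_scheme \<Rightarrow> ('g \<Rightarrow> 'f::field) \<Rightarrow> ('g \<Rightarrow> 'f) \<Rightarrow> 'g \<Rightarrow> 'f" where
  "cross G x y g = (\<Sum>h\<in>carrier G. x h * y (g \<otimes>\<^bsub>G\<^esub> h))"

text \<open>The coefficient of \<open>x x\<^sup>*\<close> at \<open>g\<inverse>\<close>, which is also the one at \<open>g\<close>.\<close>

abbreviation corr :: "('g, 'x) monoid_scheme \<Rightarrow> ('g \<Rightarrow> 'f::field) \<Rightarrow> 'g \<Rightarrow> 'f" where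
  "corr G x \<equiv> cross G x x"

text \<open>The equation \<open>x x^* = 1\<close> coefficient by coefficient. At \<one> it follows
  from the augmentation, whose square is that coefficient.\<close>

definition US :: "('g, 'x) monoid_scheme \<Rightarrow> ('g \<Rightarrow> 'f::field) set" where
  "US G = {x. supp_in G x \<and> (\<Sum>h\<in>carrier G. x h) = 1 \<and>
     (\<forall>g\<in>carrier G. g \<noteq> \<one>\<^bsub>G\<^esub> \<longrightarrow> corr G x g = 0)}"

locale fin_group = group G for G (structure) +
  assumes fin: "finite (carrier G)"
begin

section \<open>Convolution, star and correlation on a finite group\<close>

lemma sum_translate:
  fixes f :: "_ \<Rightarrow> 'f::field"
  assumes "g \<in> carrier G"
  shows "(\<Sum>h\<in>carrier G. f (g \<otimes> h)) = (\<Sum>h\<in>carrier G. f h)"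
  by (rule sum.reindex_bij_witness[where i = "\<lambda>h. inv g \<otimes> h" and j = "\<lambda>h. g \<otimes> h"])
    (use assms in \<open>auto simp: m_assoc[symmetric]\<close>)

lemma sum_inv:
  fixes f :: "_ \<Rightarrow> 'f::field"
  shows "(\<Sum>h\<in>carrier G. f (inv h)) = (\<Sum>h\<in>carrier G. f h)"
  by (rule sum.reindex_bij_witness[where i = "\<lambda>h. inv h" and j = "\<lambda>h. inv h"]) auto

lemma supp_conv: "supp_in G (conv G x y)"
  by (simp add: supp_in_def conv_def)

lemma supp_star: "supp_in G (star G x)"
  by (simp add: supp_in_def star_def)

lemma supp_delta: "h \<in> carrier G \<Longrightarrow> supp_in G (delta h)"
  by (auto simp: supp_in_def delta_def)

lemma conv_assoc: "conv G (conv G x y) z = conv G x (conv G y z)"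
proof
  fix g
  show "conv G (conv G x y) z g = conv G x (conv G y z) g"
  proof (cases "g \<in> carrier G")
    case g: True
    have "conv G (conv G x y) z g
        = (\<Sum>h\<in>carrier G. \<Sum>k\<in>carrier G. x k * y (inv k \<otimes> h) * z (inv h \<otimes> g))"
      using g by (simp add: conv_def sum_distrib_right)
    also have "\<dots> = (\<Sum>k\<in>carrier G. \<Sum>h\<in>carrier G. x k * y (inv k \<otimes> h) * z (inv h \<otimes> g))"
      by (rule sum.swap)
    also have "\<dots> = (\<Sum>k\<in>carrier G. \<Sum>l\<in>carrier G. x k * y l * z (inv l \<otimes> (inv k \<otimes> g)))"
    proof (rule sum.cong[OF HOL.refl])
      fix k assume k: "k \<in> carrier G"
      have "(\<Sum>h\<in>carrier G. x k * y (inv k \<otimes> h) * z (inv h \<otimes> g))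
          = (\<Sum>l\<in>carrier G. x k * y (inv k \<otimes> (k \<otimes> l)) * z (inv (k \<otimes> l) \<otimes> g))"
        using sum_translate[OF k, of "\<lambda>h. x k * y (inv k \<otimes> h) * z (inv h \<otimes> g)"] by simp
      also have "\<dots> = (\<Sum>l\<in>carrier G. x k * y l * z (inv l \<otimes> (inv k \<otimes> g)))"
        by (rule sum.cong[OF HOL.refl])
          (use k g in \<open>simp add: m_assoc[symmetric] inv_mult_group\<close>)
      finally show "(\<Sum>h\<in>carrier G. x k * y (inv k \<otimes> h) * z (inv h \<otimes> g))
          = (\<Sum>l\<in>carrier G. x k * y l * z (inv l \<otimes> (inv k \<otimes> g)))" .
    qed
    also have "\<dots> = conv G x (conv G y z) g"
      using g by (simp add: conv_def sum_distrib_left mult.assoc)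
    finally show ?thesis .
  qed (simp add: conv_def)
qed

lemma conv_delta_left:
  assumes "supp_in G x" "k \<in> carrier G"
  shows "conv G (delta k) x = (\<lambda>g. if g \<in> carrier G then x (inv k \<otimes> g) else 0)"
  using fin assms by (auto simp: conv_def delta_def supp_in_def if_distrib[of "\<lambda>a. a * _"] fun_eq_iff
      cong: if_cong)

lemma conv_one_left: "supp_in G x \<Longrightarrow> conv G (delta \<one>) x = x"
  by (auto simp: conv_delta_left fun_eq_iff supp_in_def)

lemma conv_one_right: 
  assumes "supp_in G x"
  shows "conv G x (delta \<one>) = x"
proof
  fix g
  have *: "inv h \<otimes> g = \<one> \<longleftrightarrow> h = g" if "h \<in> carrier G" "g \<in> carrier G" for h
    using that by (metis inv_equality inv_inv inv_closed l_inv)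
  show "conv G x (delta \<one>) g = x g"
    using fin assms by (simp add: conv_def delta_def supp_in_def if_distrib[of "\<lambda>a. _ * a"] *
      cong: if_cong sum.cong)
qed

lemma sum_conv:
  "(\<Sum>g\<in>carrier G. conv G x y g) = (\<Sum>g\<in>carrier G. x g) * (\<Sum>g\<in>carrier G. y g)"
proof -
  have "(\<Sum>g\<in>carrier G. conv G x y g)
      = (\<Sum>h\<in>carrier G. \<Sum>g\<in>carrier G. x h * y (inv h \<otimes> g))"
    unfolding conv_def by (simp cong: sum.cong) (rule sum.swap)
  also have "\<dots> = (\<Sum>h\<in>carrier G. \<Sum>g\<in>carrier G. x h * y g)"
    by (rule sum.cong[OF HOL.refl], rule sum_translate) simp
  finally show ?thesis
    by (simp add: sum_product)
qed

lemma star_conv: "star G (conv G x y) = conv G (star G y) (star G x)"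
proof
  fix g
  show "star G (conv G x y) g = conv G (star G y) (star G x) g"
  proof (cases "g \<in> carrier G")
    case g: True
    have "star G (conv G x y) g = (\<Sum>h\<in>carrier G. x h * y (inv h \<otimes> inv g))"
      using g by (simp add: star_def conv_def)
    also have "\<dots> = (\<Sum>h\<in>carrier G. x (inv g \<otimes> h) * y (inv (inv g \<otimes> h) \<otimes> inv g))"
      using sum_translate[of "inv g" "\<lambda>h. x h * y (inv h \<otimes> inv g)"] g by simp
    also have "\<dots> = (\<Sum>h\<in>carrier G. y (inv h) * x (inv g \<otimes> h))"
      by (rule sum.cong[OF HOL.refl]) (use g in \<open>simp add: inv_mult_group m_assoc mult.commute\<close>)
    also have "\<dots> = conv G (star G y) (star G x) g"
      using g by (auto simp: conv_def star_def inv_mult_group intro!: sum.cong)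
    finally show ?thesis .
  qed (simp add: star_def conv_def)
qed

lemma conv_add_left: "conv G (\<lambda>g. x g + y g) z = (\<lambda>g. conv G x z g + conv G y z g)"
  by (auto simp: conv_def sum.distrib distrib_right)

lemma conv_add_right: "conv G z (\<lambda>g. x g + y g) = (\<lambda>g. conv G z x g + conv G z y g)"
  by (auto simp: conv_def sum.distrib distrib_left)

text \<open>\<open>y x^*\<close> is the star of \<open>x y^*\<close>, so inverting the group element
  swaps the two arguments.\<close>

lemma cross_inv:
  assumes "g \<in> carrier G"
  shows "cross G x y (inv g) = cross G y x g"
proof -
  have "cross G x y (inv g) = (\<Sum>h\<in>carrier G. x (g \<otimes> h) * y (inv g \<otimes> (g \<otimes> h)))"
    unfolding cross_def using sum_translate[OF assms, of "\<lambda>h. x h * y (inv g \<otimes> h)"] by simp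
  also have "\<dots> = cross G y x g"
    unfolding cross_def
    by (rule sum.cong[OF HOL.refl]) (use assms in \<open>simp add: m_assoc[symmetric] mult.commute\<close>)
  finally show ?thesis .
qed

lemma conv_star: "g \<in> carrier G \<Longrightarrow> conv G x (star G x) g = corr G x g"
  unfolding cross_inv[of g x x, symmetric]
  by (auto simp: conv_def star_def cross_def inv_mult_group intro!: sum.cong)

lemma cross_add_left: "cross G (\<lambda>g. x g + y g) z g = cross G x z g + cross G y z g"
  by (simp add: cross_def sum.distrib distrib_right)

lemma cross_add_right: "cross G z (\<lambda>g. x g + y g) g = cross G z x g + cross G z y g"
  by (simp add: cross_def sum.distrib distrib_left)

lemma cross_delta:
  assumes "h \<in> carrier G"
  shows "cross G (\<lambda>k. a * delta h k) y g = a * y (g \<otimes> h)"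
proof -
  have "cross G (\<lambda>k. a * delta h k) y g = (\<Sum>k\<in>carrier G. if k = h then a * y (g \<otimes> k) else 0)"
    unfolding cross_def by (rule sum.cong) (auto simp: delta_def)
  then show ?thesis
    using fin assms by simp
qed

end

section \<open>Finite fields of characteristic 2\<close>

locale char2 =
  fixes F :: "'f::{field, finite} itself"
  assumes char2: "CHAR('f) = 2"
begin

lemma add_self [simp]: "(a :: 'f) + a = 0"
proof -
  have "(2 :: 'f) = 0"
    using of_nat_CHAR[where 'a='f] char2 by simp
  then show ?thesis
    by (metis mult_2 mult_zero_left)
qed

lemma add_self_left [simp]: "(a :: 'f) + (a + b) = b"
  by (simp add: add.assoc[symmetric])

lemma minus_eq [simp]: "- (a :: 'f) = a"
  by (rule minus_unique[OF add_self])

lemma diff_eq [simp]: "(a :: 'f) - b = a + b"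
  by (metis diff_conv_add_uminus minus_eq)

lemma add_eq_0 [simp]: "(a :: 'f) + b = 0 \<longleftrightarrow> a = b"
  by (metis add_self add_self_left add.right_neutral)

text \<open>Used with the values of two functions on a pair \<open>h\<close>, \<open>c h\<close>: if
  the sums over the pair agree, the difference of the functions is constant on the pair.\<close>

lemma add_swap:
  assumes "(a :: 'f) + b = x + y"
  shows "a + x = b + y"
proof -
  have "(a + x) + (b + y) = (a + b) + (x + y)" by (simp only: ac_simps)
  then show ?thesis using assms by simp
qed

lemma square_add: "((a :: 'f) + b)^2 = a^2 + b^2"
proof -
  have "(a + b)^2 = a^2 + (a * b + a * b) + b^2"
    by (simp only: power2_eq_square distrib_left distrib_right ac_simps)
  then show ?thesis by simp
qed

lemma sum_square: "(\<Sum>i\<in>I. f i :: 'f)^2 = (\<Sum>i\<in>I. (f i)^2)"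
  by (induction I rule: infinite_finite_induct) (auto simp: square_add)

lemma inj_square: "inj (\<lambda>a :: 'f. a^2)"
proof (rule injI)
  fix a b :: 'f assume "a^2 = b^2"
  then have "(a + b)^2 = 0" by (simp add: square_add)
  then show "a = b" by simp
qed

text \<open>Frobenius is injective, hence onto, the field being finite.\<close>

lemma square_root: "\<exists>b :: 'f. b^2 = a"
  using finite_UNIV_inj_surj[OF finite_UNIV inj_square] by (metis surjD)

text \<open>In characteristic 2, the terms off the fixed points of an involution cancel in pairs.\<close>

lemma sum_involution:
  fixes f :: "'a \<Rightarrow> 'f"
  assumes "finite S" "\<And>s. s \<in> S \<Longrightarrow> i s \<in> S" "\<And>s. s \<in> S \<Longrightarrow> i (i s) = s"
    "\<And>s. s \<in> S \<Longrightarrow> f (i s) = f s"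
  shows "sum f S = sum f {s \<in> S. i s = s}"
  using assms
proof (induction "card S" arbitrary: S rule: less_induct)
  case less
  show ?case
  proof (cases "\<exists>s\<in>S. i s \<noteq> s")
    case True
    then obtain s where s: "s \<in> S" "i s \<noteq> s" by blast
    define S' where "S' = S - {s, i s}"
    have S: "S = insert s (insert (i s) S')" and ns: "s \<notin> insert (i s) S'" "i s \<notin> S'"
      using s less.prems by (auto simp: S'_def)
    have fS': "finite S'"
      using less.prems by (simp add: S'_def)
    have "sum f S' = sum f {s \<in> S'. i s = s}"
    proof (rule less.hyps)
      show "card S' < card S"
        using less.prems(1) s by (intro psubset_card_mono) (auto simp: S'_def)
      fix r assume r: "r \<in> S'"
      then show "i r \<in> S'"
        using less.prems s unfolding S'_def by (metis Diff_iff insertCI insertE singletonD)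
    qed (use less.prems in \<open>auto simp: S'_def\<close>)
    moreover have "sum f S = f s + (f (i s) + sum f S')"
      using fS' ns by (subst S) simp
    moreover have "{r \<in> S. i r = r} = {r \<in> S'. i r = r}"
      using s less.prems by (auto simp: S'_def)
    ultimately show ?thesis
      using less.prems s by simp
  next
    case False
    then have "{s \<in> S. i s = s} = S" by auto
    then show ?thesis by simp
  qed
qed

end

section \<open>Unitary elements in characteristic 2\<close>

locale fin_group2 = fin_group G + char2 F
  for G (structure) and F :: "'f::{field, finite} itself"
begin

lemma corr_one: "corr G x \<one> = (\<Sum>h\<in>carrier G. x h :: 'f)^2"
  unfolding sum_square by (simp add: cross_def power2_eq_square cong: sum.cong)

text \<open>The terms at \<open>h\<close> and \<open>g h\<close> coincide, and \<open>g h\<close> is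
  never \<open>h\<close>, so they cancel in pairs. Hence involutions of the group impose no
  condition on a unitary element.\<close>

lemma corr_involution:
  fixes x :: "_ \<Rightarrow> 'f"
  assumes "g \<in> carrier G" "g \<noteq> \<one>" "g \<otimes> g = \<one>"
  shows "corr G x g = 0"
proof -
  have "corr G x g = sum (\<lambda>h. x h * x (g \<otimes> h)) {h \<in> carrier G. g \<otimes> h = h}"
    unfolding cross_def using assms fin
    by (intro sum_involution) (auto simp: m_assoc[symmetric] mult.commute)
  also have "{h \<in> carrier G. g \<otimes> h = h} = {}"
    using assms by auto
  finally show ?thesis by simp
qed

lemma US_iff:
  fixes x :: "_ \<Rightarrow> 'f"
  shows "x \<in> US G \<longleftrightarrow> supp_in G x \<and> (\<Sum>h\<in>carrier G. x h) = 1 \<and> conv G x (star G x) = delta \<one>"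
    (is "_ \<longleftrightarrow> ?R")
proof -
  have "conv G x (star G x) = delta \<one> \<longleftrightarrow> (\<forall>g\<in>carrier G. g \<noteq> \<one> \<longrightarrow> corr G x g = 0)"
    if s: "(\<Sum>h\<in>carrier G. x h) = 1"
  proof -
    have "corr G x \<one> = 1"
      by (simp add: corr_one s)
    moreover have "conv G x (star G x) g = 0" "delta \<one> g = (0 :: 'f)" if "g \<notin> carrier G" for g
      using that by (auto simp: conv_def delta_def)
    ultimately show ?thesis
      unfolding fun_eq_iff by (metis conv_star delta_def)
  qed
  then show ?thesis
    by (auto simp: US_def)
qed

lemma finite_supp: "finite {x :: _ \<Rightarrow> 'f. supp_in G x}"
proof (rule finite_subset)
  show "{x :: _ \<Rightarrow> 'f. supp_in G x} \<subseteq> {x. \<forall>g. (g \<in> carrier G \<longrightarrow> x g \<in> UNIV) \<and> (g \<notin> carrier G \<longrightarrow> x g = 0)}"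
    by (auto simp: supp_in_def)
qed (rule finite_set_of_finite_funs[OF fin finite_UNIV])

lemma finite_US: "finite (US G :: (_ \<Rightarrow> 'f) set)"
  by (rule finite_subset[OF _ finite_supp]) (auto simp: US_def)

text \<open>Right multiplication by \<open>x\<close> is injective because \<open>y\<close> undoes
  it. On the finite set of functions supported on the carrier it is then onto, which yields a left
  inverse, and that must be \<open>y\<close>.\<close>

lemma right_inverse_imp_left:
  fixes x y :: "_ \<Rightarrow> 'f"
  assumes "supp_in G x" "supp_in G y" "conv G x y = delta \<one>"
  shows "conv G y x = delta \<one>"
proof -
  let ?S = "{x :: _ \<Rightarrow> 'f. supp_in G x}"
  have "inj_on (\<lambda>z. conv G z x) ?S"
    by (rule inj_onI) (metis (no_types) assms(3) conv_assoc conv_one_right mem_Collect_eq)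
  then have "(\<lambda>z. conv G z x) ` ?S = ?S"
    by (intro endo_inj_surj finite_supp) (auto simp: supp_conv)
  moreover have "delta \<one> \<in> ?S"
    by (simp add: supp_delta)
  ultimately obtain z where z: "supp_in G z" "conv G z x = delta \<one>"
    by (smt (verit) imageE mem_Collect_eq)
  have "z = y"
    by (metis assms z conv_assoc conv_one_right conv_one_left)
  with z show ?thesis by simp
qed

lemma US_conv_inv:
  fixes x :: "_ \<Rightarrow> 'f"
  assumes "x \<in> US G"
  shows "conv G (star G x) x = delta \<one>"
  using assms right_inverse_imp_left supp_star by (auto simp: US_iff)

lemma US_conv:
  fixes x y :: "_ \<Rightarrow> 'f"
  assumes "x \<in> US G" "y \<in> US G"
  shows "conv G x y \<in> US G"
proof -
  have "conv G (conv G x y) (star G (conv G x y)) = conv G x (conv G (conv G y (star G y)) (star G x))"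
    by (simp add: star_conv conv_assoc)
  then show ?thesis
    using assms by (simp add: US_iff supp_conv sum_conv conv_one_left supp_star)
qed

lemma star_star: "supp_in G x \<Longrightarrow> star G (star G x) = x"
  by (auto simp: star_def supp_in_def)

lemma US_star:
  fixes x :: "_ \<Rightarrow> 'f"
  assumes "x \<in> US G"
  shows "star G x \<in> US G"
proof -
  have "(\<Sum>h\<in>carrier G. star G x h) = (\<Sum>h\<in>carrier G. x (inv h))"
    by (rule sum.cong) (auto simp: star_def)
  then have "(\<Sum>h\<in>carrier G. star G x h) = (\<Sum>h\<in>carrier G. x h)"
    by (simp add: sum_inv)
  then show ?thesis
    using assms US_conv_inv[OF assms] by (simp add: US_iff supp_star star_star)
qed

text \<open>Over a finite group, being a unit with inverse \<open>x^*\<close> is the single equation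
  \<open>x x^* = 1\<close>, as a one-sided inverse is two-sided.\<close>

lemma V_star_eq_US: "(V_star G :: (_ \<Rightarrow> 'f) set) = US G"
proof -
  let ?A = "group_algebra G :: (_ \<Rightarrow> 'f) ring"
  have carr: "carrier ?A = {x. supp_in G x}"
    by (auto simp: group_algebra_def supp_in_def intro: finite_subset[OF _ fin])
  have mult: "x \<otimes>\<^bsub>?A\<^esub> y = conv G x y" if "supp_in G x" for x y
  proof -
    have "(\<Sum>h | x h \<noteq> 0. x h * y (inv h \<otimes> g)) = (\<Sum>h\<in>carrier G. x h * y (inv h \<otimes> g))" for g
      using that fin by (intro sum.mono_neutral_left) (auto simp: supp_in_def)
    then show ?thesis
      by (auto simp: group_algebra_def conv_def fun_eq_iff)
  qed
  have one: "\<one>\<^bsub>?A\<^esub> = delta \<one>"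
    by (simp add: group_algebra_def delta_def)
  have mon: "Group.monoid ?A"
    by (rule monoidI)
      (auto simp: carr mult one supp_conv supp_delta conv_assoc conv_one_left conv_one_right)
  have aug: "augmentation x = (\<Sum>h\<in>carrier G. x h)" if "supp_in G x" for x :: "_ \<Rightarrow> 'f"
    unfolding augmentation_def
    using that fin by (intro sum.mono_neutral_left) (auto simp: supp_in_def)
  have unit: "x \<in> Units ?A \<and> star G x = inv\<^bsub>?A\<^esub> x \<longleftrightarrow> conv G x (star G x) = delta \<one>"
    if x: "supp_in G x" for x
  proof
    assume "x \<in> Units ?A \<and> star G x = inv\<^bsub>?A\<^esub> x"
    then show "conv G x (star G x) = delta \<one>"
      using Group.monoid.Units_r_inv[OF mon, of x] by (simp add: mult[OF x] one)
  next
    assume e: "conv G x (star G x) = delta \<one>"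
    have e': "conv G (star G x) x = delta \<one>"
      using right_inverse_imp_left[OF x supp_star e] .
    have u: "x \<in> Units ?A"
      using x e e' by (auto simp: Units_def carr one mult supp_star intro!: exI[of _ "star G x"])
    moreover have "star G x = inv\<^bsub>?A\<^esub> x"
      using Group.monoid.inv_unique'[OF mon, of x "star G x"] x e e'
      by (simp add: carr one mult supp_star)
    ultimately show "x \<in> Units ?A \<and> star G x = inv\<^bsub>?A\<^esub> x" ..
  qed
  have "x \<in> V_star G \<longleftrightarrow> x \<in> US G" for x :: "_ \<Rightarrow> 'f"
  proof (cases "supp_in G x")
    case True
    then show ?thesis
      using unit[OF True] by (auto simp: V_star_def V_def US_iff carr aug)
  next
    case False
    then show ?thesis
      by (simp add: V_star_def V_def US_iff carr)
  qed
  then show ?thesis by blast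
qed

end

section \<open>Central extensions of abelian groups by a group of order 2\<close>

context fin_group2
begin

text \<open>\<open>R\<close> takes one element from each pair of mutually inverse elements, the one
  with the smaller number in an enumeration of the group.\<close>

lemma card_half_involution:
  obtains R where "R \<subseteq> carrier G" "\<And>u. u \<in> carrier G \<Longrightarrow> u \<in> R \<or> inv u \<in> R"
    "\<And>u. u \<in> R \<Longrightarrow> inv u \<in> R \<Longrightarrow> u \<otimes> u = \<one>"
    "2 * card R = card (carrier G) + card {u \<in> carrier G. u \<otimes> u = \<one>}"
proof -
  obtain f :: "_ \<Rightarrow> nat" where f: "inj_on f (carrier G)"
    using finite_imp_inj_to_nat_seg[OF fin] by blast
  define R where "R = {u \<in> carrier G. f u \<le> f (inv u)}"
  have R: "R \<subseteq> carrier G" by (auto simp: R_def)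
  then have finR: "finite R" using fin finite_subset by blast
  have sq: "u \<otimes> u = \<one> \<longleftrightarrow> u = inv u" if "u \<in> carrier G" for u
    using that by (metis inv_equality l_inv)
  have or: "u \<in> R \<or> inv u \<in> R" if "u \<in> carrier G" for u
    using that by (auto simp: R_def)
  have both: "u \<otimes> u = \<one>" if "u \<in> R" "inv u \<in> R" for u
    using that sq inj_onD[OF f, of u "inv u"] by (auto simp: R_def)
  have im: "(\<lambda>u. inv u) ` R \<subseteq> carrier G" using R by auto
  have "carrier G = R \<union> (\<lambda>u. inv u) ` R"
  proof (intro equalityI subsetI)
    fix u assume u: "u \<in> carrier G"
    then have "inv (inv u) = u" by simp
    then show "u \<in> R \<union> (\<lambda>u. inv u) ` R"
      using or[OF u] by (metis UnI1 UnI2 image_eqI)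
  qed (use im R in auto)
  moreover have "R \<inter> (\<lambda>u. inv u) ` R = {u \<in> carrier G. u \<otimes> u = \<one>}"
  proof (intro equalityI subsetI)
    fix u assume "u \<in> R \<inter> (\<lambda>u. inv u) ` R"
    then obtain v where v: "u \<in> R" "v \<in> R" "u = inv v" by blast
    then have "inv u = v" "u \<in> carrier G" using R by auto
    then show "u \<in> {u \<in> carrier G. u \<otimes> u = \<one>}"
      using both v by simp
  next
    fix u assume "u \<in> {u \<in> carrier G. u \<otimes> u = \<one>}"
    then have u: "u \<in> carrier G" "inv u = u" using sq by auto
    then have "u \<in> R" using or[of u] by simp
    then show "u \<in> R \<inter> (\<lambda>u. inv u) ` R" using u by (metis IntI image_eqI)
  qed
  moreover have "card ((\<lambda>u. inv u) ` R) = card R"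
    using R by (intro card_image inj_on_subset[OF inj_on_inverseI[of "carrier G"]]) (auto intro: inv_inv)
  ultimately have "2 * card R = card (carrier G) + card {u \<in> carrier G. u \<otimes> u = \<one>}"
    using card_Un_Int[OF finR, of "(\<lambda>u. inv u) ` R"] finR by simp
  with that[OF R or both] show ?thesis by blast
qed

text \<open>The number of classes under inversion, that is, the dimension of the space of all
  \<open>v\<close> with \<open>v = v^*\<close>. It is the exponent of the theorem before 1 is
  subtracted.\<close>

definition sdim :: nat where
  "sdim = (card (carrier G) + card {u \<in> carrier G. u \<otimes> u = \<one>}) div 2"

lemma sdim: "2 * sdim = card (carrier G) + card {u \<in> carrier G. u \<otimes> u = \<one>}"
  unfolding sdim_def by (rule card_half_involution) (metis dvd_triv_left dvd_mult_div_cancel)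

text \<open>The values on a set \<open>R\<close> of representatives modulo inversion are free and
  determine the others. At a \<open>u\<close> with \<open>u^2 = 1\<close> the equation reads
  \<open>0 = r u\<close>, so \<open>v u\<close> is free there too.\<close>

lemma card_skew_solutions:
  fixes r :: "_ \<Rightarrow> 'f"
  assumes r: "\<And>u. u \<in> carrier G \<Longrightarrow> r (inv u) = r u"
    "\<And>u. u \<in> carrier G \<Longrightarrow> u \<otimes> u = \<one> \<Longrightarrow> r u = 0"
  shows "card {v. supp_in G v \<and> (\<forall>u\<in>carrier G. v u + v (inv u) = r u)} = card (UNIV :: 'f set) ^ sdim"
    (is "card ?S = _")
proof -
  obtain R where R: "R \<subseteq> carrier G" "\<And>u. u \<in> carrier G \<Longrightarrow> u \<in> R \<or> inv u \<in> R"
    "\<And>u. u \<in> R \<Longrightarrow> inv u \<in> R \<Longrightarrow> u \<otimes> u = \<one>"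
    and cR: "2 * card R = card (carrier G) + card {u \<in> carrier G. u \<otimes> u = \<one>}"
    using card_half_involution by blast
  have finR: "finite R" using R(1) fin finite_subset by blast
  define ext where "ext f = (\<lambda>u. if u \<in> R then f u else if u \<in> carrier G then r u + f (inv u) else 0)"
    for f :: "_ \<Rightarrow> 'f"
  have inv_eq: "inv u = u" if "u \<in> carrier G" "u \<otimes> u = \<one>" for u
    using that by (metis inv_equality)
  have ext_in: "ext f \<in> ?S" for f
  proof -
    have "ext f u + ext f (inv u) = r u" if u: "u \<in> carrier G" for u
    proof (cases "u \<in> R \<and> inv u \<in> R")
      case True
      then have "u \<otimes> u = \<one>" using R(3) by blast
      then show ?thesis using inv_eq[OF u] r(2)[OF u] by simp
    next
      case False
      then consider "u \<in> R" "inv u \<notin> R" | "u \<notin> R" "inv u \<in> R" using R(2)[OF u] by blast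
      then show ?thesis
        by cases (use u r in \<open>auto simp: ext_def add.commute add.left_commute\<close>)
    qed
    then show ?thesis using R(1) by (auto simp: ext_def supp_in_def)
  qed
  have "bij_betw (\<lambda>v. restrict v R) ?S (R \<rightarrow>\<^sub>E UNIV)"
  proof (rule bij_betw_byWitness[where f' = ext])
    show "\<forall>v\<in>?S. ext (restrict v R) = v"
    proof (intro ballI ext)
      fix v u assume v: "v \<in> ?S"
      have "r u + v (inv u) = v u" if "u \<in> carrier G" for u
      proof -
        have "v u + v (inv u) = r u" using that v by blast
        then show ?thesis by (metis add.commute add_self_left)
      qed
      then show "ext (restrict v R) u = v u"
        using v R by (auto simp: ext_def supp_in_def)
    qed
    show "\<forall>f\<in>R \<rightarrow>\<^sub>E UNIV. restrict (ext f) R = f"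
      by (auto simp: ext_def PiE_def extensional_def restrict_def)
  qed (use ext_in in auto)
  then have "card ?S = card (R \<rightarrow>\<^sub>E (UNIV :: 'f set))"
    by (rule bij_betw_same_card)
  also have "\<dots> = card (UNIV :: 'f set) ^ card R"
    using finR by (simp add: card_PiE)
  also have "card R = sdim"
    using cR sdim by simp
  finally show ?thesis .
qed

end

lemma (in comm_group) conv_comm: "conv G x y = conv G y x"
proof
  fix g
  show "conv G x y g = conv G y x g"
  proof (cases "g \<in> carrier G")
    case g: True
    show ?thesis unfolding conv_def
      using g by (simp, intro sum.reindex_bij_witness[where i = "\<lambda>h. inv h \<otimes> g" and j = "\<lambda>h. inv h \<otimes> g"])
       (auto simp: inv_mult m_assoc m_comm m_lcomm mult.commute)
  qed (simp add: conv_def)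
qed

section \<open>A central extension and the induced map of group algebras\<close>

locale central_ext = fin_group2 G F + A: comm_group A
  for G :: "('g, 'x) monoid_scheme" (structure) and F :: "'f::{field, finite} itself"
    and A :: "('h, 'y) monoid_scheme" +
  fixes p :: "'g \<Rightarrow> 'h" and c :: 'g
  assumes hom: "p \<in> hom G A" and surj: "p ` carrier G = carrier A"
    and c: "c \<in> carrier G" "c \<noteq> \<one>"
    and ker: "\<And>g. g \<in> carrier G \<Longrightarrow> p g = \<one>\<^bsub>A\<^esub> \<longleftrightarrow> g = \<one> \<or> g = c"
begin

sublocale A: fin_group2 A F
  by unfold_locales (metis fin surj finite_imageI)

sublocale p: group_hom G A p
  by unfold_locales (rule hom)

lemma p_surj:
  assumes "u \<in> carrier A"
  obtains g where "g \<in> carrier G" "p g = u"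
  using assms surj by (metis imageE)

lemma p_c [simp]: "p c = \<one>\<^bsub>A\<^esub>"
  using ker c by blast

lemma c_sq: "c \<otimes> c = \<one>"
  using ker[of "c \<otimes> c"] c by auto

lemma p_eq: "g \<in> carrier G \<Longrightarrow> h \<in> carrier G \<Longrightarrow> p h = p g \<longleftrightarrow> h = g \<or> h = c \<otimes> g"
proof -
  assume gh: "g \<in> carrier G" "h \<in> carrier G"
  have "p h = p g \<longleftrightarrow> p (h \<otimes> inv g) = \<one>\<^bsub>A\<^esub>"
    using gh by (metis A.inv_closed A.inv_equality A.r_inv A.inv_inv p.hom_closed p.hom_inv p.hom_mult inv_closed)
  also have "\<dots> \<longleftrightarrow> h \<otimes> inv g = \<one> \<or> h \<otimes> inv g = c"
    using gh ker[of "h \<otimes> inv g"] by simp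
  also have "\<dots> \<longleftrightarrow> h = g \<or> h = c \<otimes> g"
    using gh c by (metis inv_solve_right' l_one one_closed)
  finally show ?thesis .
qed

lemma c_neq: "g \<in> carrier G \<Longrightarrow> c \<otimes> g \<noteq> g" "g \<in> carrier G \<Longrightarrow> g \<noteq> c \<otimes> g"
  using c by auto

text \<open>\<open>g c\<close> and \<open>g\<close> lie over the same element, whose fibre consists
  of \<open>g\<close> and \<open>c g\<close>.\<close>

lemma c_comm: "g \<in> carrier G \<Longrightarrow> g \<otimes> c = c \<otimes> g"
  using p_eq[of g "g \<otimes> c"] c by auto

lemma c_c [simp]: "g \<in> carrier G \<Longrightarrow> c \<otimes> (c \<otimes> g) = g"
  using c c_sq by (simp add: m_assoc[symmetric])

text \<open>The homomorphism of group algebras induced by \<open>p\<close>. Among functions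
  supported on the carrier its kernel consists of the \<open>c\<close>-invariant ones.\<close>

definition push :: "('g \<Rightarrow> 'f) \<Rightarrow> 'h \<Rightarrow> 'f" where
  "push x = (\<lambda>u. \<Sum>g | g \<in> carrier G \<and> p g = u. x g)"

lemma push_p: "g \<in> carrier G \<Longrightarrow> push x (p g) = x g + x (c \<otimes> g)"
proof -
  assume g: "g \<in> carrier G"
  then have "{h \<in> carrier G. p h = p g} = {g, c \<otimes> g}"
    using p_eq c by auto
  then show ?thesis using c_neq[OF g] by (simp add: push_def)
qed

lemma supp_push: "supp_in A (push x)"
  by (auto simp: supp_in_def push_def intro!: sum.neutral)

lemma sum_push_mult: "(\<Sum>u\<in>carrier A. push x u * f u) = (\<Sum>g\<in>carrier G. x g * f (p g))"
proof -
  have "(\<Sum>u\<in>carrier A. push x u * f u) = (\<Sum>u\<in>carrier A. \<Sum>g | g \<in> carrier G \<and> p g = u. x g * f (p g))"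
    unfolding push_def sum_distrib_right by (intro sum.cong) auto
  also have "\<dots> = (\<Sum>g\<in>carrier G. x g * f (p g))"
    by (rule sum.group[OF fin A.fin]) auto
  finally show ?thesis .
qed

lemma sum_push: "(\<Sum>u\<in>carrier A. push x u) = (\<Sum>g\<in>carrier G. x g)"
  using sum_push_mult[of x "\<lambda>_. 1"] by simp

lemma cross_push:
  assumes g: "g \<in> carrier G"
  shows "cross A (push x) (push y) (p g) = cross G x y g + cross G x y (c \<otimes> g)"
proof -
  have "cross A (push x) (push y) (p g) = (\<Sum>h\<in>carrier G. x h * push y (p g \<otimes>\<^bsub>A\<^esub> p h))"
    unfolding cross_def by (rule sum_push_mult)
  also have "\<dots> = (\<Sum>h\<in>carrier G. x h * (y (g \<otimes> h) + y (c \<otimes> g \<otimes> h)))"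
    by (rule sum.cong[OF HOL.refl])
      (use g c in \<open>simp add: push_p m_assoc flip: p.hom_mult\<close>)
  finally show ?thesis by (simp add: cross_def distrib_left sum.distrib)
qed

text \<open>A function that factors through \<open>p\<close> is \<open>1 + c\<close> times a lift of
  \<open>w\<close>, so only the image of \<open>x\<close> in \<open>FA\<close> matters.\<close>

lemma cross_push_comp:
  assumes g: "g \<in> carrier G"
  shows "cross G x (\<lambda>h. w (p h)) g = cross A (push x) w (p g)"
  unfolding cross_def sum_push_mult using g by (intro sum.cong) simp_all

lemma push_conv: "push (conv G x y) = conv A (push x) (push y)"
proof
  fix u
  show "push (conv G x y) u = conv A (push x) (push y) u"
  proof (cases "u \<in> carrier A")
    case True
    then obtain g where g: "g \<in> carrier G" "u = p g"
      using p_surj by metis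
    have "conv A (push x) (push y) u = (\<Sum>h\<in>carrier G. x h * push y (inv\<^bsub>A\<^esub> (p h) \<otimes>\<^bsub>A\<^esub> u))"
      using True unfolding conv_def by (simp add: sum_push_mult)
    also have "\<dots> = (\<Sum>h\<in>carrier G. x h * (y (inv h \<otimes> g) + y (inv h \<otimes> (c \<otimes> g))))"
    proof (rule sum.cong[OF HOL.refl])
      fix h assume h: "h \<in> carrier G"
      have "inv h \<otimes> (c \<otimes> g) = c \<otimes> (inv h \<otimes> g)"
        using h g c c_comm[of "inv h"] by (metis inv_closed m_assoc)
      moreover have "push y (inv\<^bsub>A\<^esub> (p h) \<otimes>\<^bsub>A\<^esub> u) = push y (p (inv h \<otimes> g))"
        using g h by simp
      ultimately show "x h * push y (inv\<^bsub>A\<^esub> (p h) \<otimes>\<^bsub>A\<^esub> u) = x h * (y (inv h \<otimes> g) + y (inv h \<otimes> (c \<otimes> g)))"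
        using h g by (simp add: push_p del: p.hom_mult)
    qed
    also have "\<dots> = push (conv G x y) u"
      using g c by (simp add: push_p conv_def distrib_left sum.distrib)
    finally show ?thesis ..
  next
    case False
    then show ?thesis
      using supp_push A.supp_conv by (metis supp_in_def)
  qed
qed

definition sec :: "'h \<Rightarrow> 'g" where
  "sec u = (SOME g. g \<in> carrier G \<and> p g = u)"

lemma sec: "u \<in> carrier A \<Longrightarrow> sec u \<in> carrier G" "u \<in> carrier A \<Longrightarrow> p (sec u) = u"
  using someI_ex[of "\<lambda>g. g \<in> carrier G \<and> p g = u"] p_surj unfolding sec_def by blast+

text \<open>Not a homomorphism: all coefficients are put on chosen representatives, so what is
  defined through it has to be shown independent of the choice.\<close>

definition lift :: "('h \<Rightarrow> 'f) \<Rightarrow> 'g \<Rightarrow> 'f" where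
  "lift y = (\<lambda>g. if g \<in> carrier G \<and> g = sec (p g) then y (p g) else 0)"

lemma supp_lift: "supp_in G (lift y)"
  by (simp add: lift_def supp_in_def)

lemma push_lift:
  assumes "supp_in A y"
  shows "push (lift y) = y"
proof
  fix u
  show "push (lift y) u = y u"
  proof (cases "u \<in> carrier A")
    case True
    have "push (lift y) (p (sec u)) = lift y (sec u) + lift y (c \<otimes> sec u)"
      using True by (intro push_p) (simp add: sec)
    also have "\<dots> = y u"
      using True c c_neq[of "sec u"] by (simp add: sec lift_def)
    finally have "push (lift y) (p (sec u)) = y u" .
    then show ?thesis using True by (simp add: sec)
  next
    case False
    then show ?thesis using assms supp_push by (simp add: supp_in_def)
  qed
qed

section \<open>The obstruction at the square roots of \<open>c\<close>\<close>

definition T :: "'h set" where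
  "T = p ` {g \<in> carrier G. g \<otimes> g = c}"

lemma sq_c: "g \<in> carrier G \<Longrightarrow> (c \<otimes> g) \<otimes> (c \<otimes> g) = g \<otimes> g"
  using c c_comm by (metis c_c m_assoc m_closed)

lemma p_in_T: "g \<in> carrier G \<Longrightarrow> p g \<in> T \<longleftrightarrow> g \<otimes> g = c"
  unfolding T_def using p_eq sq_c by (auto simp: image_iff)

lemma T_carrier: "T \<subseteq> carrier A"
  by (auto simp: T_def)

lemma T_cases:
  assumes "t \<in> T"
  obtains g where "g \<in> carrier G" "g \<otimes> g = c" "t = p g"
  using assms by (auto simp: T_def)

lemma T_sq: "t \<in> T \<Longrightarrow> t \<otimes>\<^bsub>A\<^esub> t = \<one>\<^bsub>A\<^esub>"
  by (metis T_cases p.hom_mult p_c)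

lemma one_notin_T: "\<one>\<^bsub>A\<^esub> \<notin> T"
  using p_in_T[of \<one>] c by auto

lemma root_c_inv: "g \<in> carrier G \<Longrightarrow> g \<otimes> g = c \<Longrightarrow> inv g = c \<otimes> g"
  using c_sq c by (metis inv_equality m_assoc m_closed)

definition lam :: "('h \<Rightarrow> 'f) \<Rightarrow> 'h \<Rightarrow> 'f" where
  "lam y = (\<lambda>t. if t \<in> T then corr G (lift y) (sec t) else 0)"

text \<open>A \<open>c\<close>-invariant \<open>D\<close> is a multiple of \<open>1 + c\<close>, and
  \<open>(1 + c)^2 = 0\<close>; in the sum the terms at \<open>h\<close> and \<open>c h\<close>
  cancel.\<close>

lemma corr_invariant:
  assumes "g \<in> carrier G" "\<And>h. h \<in> carrier G \<Longrightarrow> D (c \<otimes> h) = (D h :: 'f)"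
  shows "corr G D g = 0"
proof -
  have "corr G D g = sum (\<lambda>h. D h * D (g \<otimes> h)) {h \<in> carrier G. c \<otimes> h = h}"
    unfolding cross_def
  proof (rule sum_involution)
    fix h assume h: "h \<in> carrier G"
    have "g \<otimes> (c \<otimes> h) = c \<otimes> (g \<otimes> h)"
      using assms(1) c h c_comm by (metis m_assoc)
    then show "D (c \<otimes> h) * D (g \<otimes> (c \<otimes> h)) = D h * D (g \<otimes> h)"
      using assms h by simp
  qed (use fin c in auto)
  then show ?thesis using c_neq by (simp cong: conj_cong)
qed

text \<open>Two lifts of the same element differ by a \<open>c\<close>-invariant \<open>D\<close>.
  Then \<open>D D^*\<close> vanishes, and since the inverse of \<open>g\<close> is
  \<open>c g\<close>, the coefficients of \<open>x D^*\<close> and \<open>D x^*\<close> at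
  \<open>g\<close> are equal and cancel.\<close>

lemma lam_push:
  assumes g: "g \<in> carrier G" "g \<otimes> g = c"
  shows "lam (push x) (p g) = corr G x g"
proof -
  let ?y = "lift (push x)"
  define D where "D h = x h + ?y h" for h
  have Dc: "D (c \<otimes> h) = D h" if h: "h \<in> carrier G" for h
  proof -
    have "push x (p h) = push ?y (p h)"
      by (simp add: push_lift supp_push)
    then have "x h + x (c \<otimes> h) = ?y h + ?y (c \<otimes> h)"
      using h by (simp add: push_p)
    from add_swap[OF this] show ?thesis unfolding D_def by simp
  qed
  have gc: "cross G D x g = cross G x D g"
  proof -
    have "cross G D x g = cross G x D (c \<otimes> g)"
      using cross_inv[of g x D] g by (simp add: root_c_inv)
    also have "\<dots> = cross G x D g"
      unfolding cross_def using g c Dc by (intro sum.cong) (auto simp: m_assoc)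
    finally show ?thesis .
  qed
  have y: "?y = (\<lambda>h. x h + D h)" by (auto simp: D_def)
  have "corr G ?y g = corr G x g + corr G D g + (cross G D x g + cross G x D g)"
    unfolding y cross_add_left cross_add_right by (simp add: ac_simps)
  then have *: "corr G ?y g = corr G x g"
    using corr_invariant[of g D] g Dc gc by simp
  \<comment> \<open>The chosen representative may be the other root \<open>c g\<close>, which is the
    inverse of \<open>g\<close>; \<open>corr\<close> is unaffected by inversion.\<close>
  have "sec (p g) = g \<or> sec (p g) = inv g"
    using p_eq[of g "sec (p g)"] g sec[of "p g"] by (auto simp: root_c_inv)
  then have "corr G ?y (sec (p g)) = corr G ?y g"
    using cross_inv[of g] g by auto
  then show ?thesis
    using g * by (simp add: lam_def p_in_T)
qed

lemma lam_outside: "t \<notin> T \<Longrightarrow> lam y t = 0"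
  by (simp add: lam_def)

text \<open>So \<open>lam\<close> is a quadratic map whose polar form is given by the coefficients
  of \<open>y z^*\<close>: the two mixed terms are the values at \<open>g\<close> and at its inverse
  \<open>c g\<close>, the two points over \<open>t\<close>.\<close>

lemma lam_add:
  assumes "supp_in A y" "supp_in A z" "t \<in> T"
  shows "lam (\<lambda>u. y u + z u) t = lam y t + lam z t + cross A y z t"
proof -
  obtain g where g: "g \<in> carrier G" "g \<otimes> g = c" and t: "t = p g"
    using assms T_cases by blast
  let ?x = "lift y" and ?w = "lift z"
  have "push (\<lambda>h. ?x h + ?w h) = (\<lambda>u. push ?x u + push ?w u)"
    by (simp add: push_def sum.distrib)
  then have s: "push (\<lambda>h. ?x h + ?w h) = (\<lambda>u. y u + z u)"
    using assms by (simp add: push_lift)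
  have "lam (\<lambda>u. y u + z u) t = corr G (\<lambda>h. ?x h + ?w h) g"
    using lam_push[OF g, of "\<lambda>h. ?x h + ?w h"] unfolding s t .
  also have "\<dots> = corr G ?x g + corr G ?w g + (cross G ?x ?w g + cross G ?w ?x g)"
    unfolding cross_add_left cross_add_right by (simp add: ac_simps)
  also have "cross G ?w ?x g = cross G ?x ?w (c \<otimes> g)"
    using cross_inv[of g ?x ?w] g by (simp add: root_c_inv)
  also have "cross G ?x ?w g + cross G ?x ?w (c \<otimes> g) = cross A y z t"
    using cross_push[OF g(1), of ?x ?w] assms t by (simp add: push_lift)
  finally show ?thesis
    using lam_push[OF g, of ?x] lam_push[OF g, of ?w] assms t by (simp add: push_lift)
qed

text \<open>A monomial lifts to a monomial \<open>x\<close>, and \<open>x x^*\<close> is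
  concentrated at \<one>.\<close>

lemma lam_delta:
  assumes "h \<in> carrier A"
  shows "lam (\<lambda>k. a * delta h k) t = 0"
proof (cases "t \<in> T")
  case True
  then obtain g where g: "g \<in> carrier G" "g \<otimes> g = c" and t: "t = p g"
    using T_cases by blast
  obtain k where k: "k \<in> carrier G" "p k = h"
    using p_surj assms by metis
  have "push (\<lambda>l. a * delta k l) = (\<lambda>l. a * delta h l)"
  proof
    fix u
    have "push (\<lambda>l. a * delta k l) u = (\<Sum>g | g \<in> carrier G \<and> p g = u. if g = k then a else 0)"
      unfolding push_def delta_def by (rule sum.cong) auto
    also have "\<dots> = a * delta h u"
      using fin k by (auto simp: delta_def)
    finally show "push (\<lambda>l. a * delta k l) u = a * delta h u" .
  qed
  then have "lam (\<lambda>l. a * delta h l) t = corr G (\<lambda>l. a * delta k l) g"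
    using lam_push[OF g, of "\<lambda>l. a * delta k l"] t by simp
  also have "\<dots> = 0"
    using k g c by (simp add: cross_delta) (auto simp: delta_def)
  finally show ?thesis .
qed (simp add: lam_outside)

lemma push_US:
  assumes "x \<in> US G"
  shows "push x \<in> US A" "lam (push x) = (\<lambda>t. 0)"
proof -
  have x0: "corr G x g = 0" if "g \<in> carrier G" "g \<noteq> \<one>" for g
    using assms that by (simp add: US_def)
  have "corr A (push x) u = 0" if u: "u \<in> carrier A" "u \<noteq> \<one>\<^bsub>A\<^esub>" for u
  proof -
    obtain g where g: "g \<in> carrier G" "u = p g"
      using u p_surj by metis
    then have "g \<noteq> \<one>" "c \<otimes> g \<noteq> \<one>"
      using u ker[OF g(1)] c c_sq by (auto, metis c_c l_one r_one)
    then show ?thesis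
      using g c x0 by (simp add: cross_push)
  qed
  then show "push x \<in> US A"
    using assms by (auto simp: US_def sum_push supp_push)
  show "lam (push x) = (\<lambda>t. 0)"
  proof
    fix t
    show "lam (push x) t = 0"
    proof (cases "t \<in> T")
      case True
      then obtain g where g: "g \<in> carrier G" "g \<otimes> g = c" "t = p g"
        using T_cases by blast
      then have "g \<noteq> \<one>" using c by auto
      then show ?thesis using g x0 lam_push by simp
    qed (simp add: lam_outside)
  qed
qed

text \<open>Let \<open>x1\<close>, \<open>x2\<close> lift \<open>y1\<close>, \<open>y2\<close> and
  write \<open>x2 x2^* = 1 + r\<close>. As \<open>y2\<close> is unitary, \<open>r\<close> is
  \<open>c\<close>-invariant, so it is pulled back from some \<open>R\<close> on \<open>A\<close>.
  Then \<open>x1 x2 x2^* x1^* = x1 x1^* + x1 r x1^*\<close>, and the last summand is the pullback of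
  \<open>y1 R y1^*\<close>, which is \<open>R\<close> because \<open>FA\<close> is commutative and
  \<open>y1\<close> is unitary.\<close>

lemma lam_conv:
  assumes y: "y1 \<in> US A" "y2 \<in> US A"
  shows "lam (conv A y1 y2) = (\<lambda>t. lam y1 t + lam y2 t)"
proof
  fix t
  show "lam (conv A y1 y2) t = lam y1 t + lam y2 t"
  proof (cases "t \<in> T")
    case True
    then obtain g where g: "g \<in> carrier G" "g \<otimes> g = c" and t: "t = p g"
      using T_cases by blast
    define x1 where "x1 = lift y1"
    define x2 where "x2 = lift y2"
    have s: "supp_in A y1" "supp_in A y2" using y by (auto simp: US_def)
    have p1: "push x1 = y1" and p2: "push x2 = y2"
      using s by (simp_all add: x1_def x2_def push_lift)
    define r where "r h = conv G x2 (star G x2) h + delta \<one> h" for h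
    have rc: "r (c \<otimes> h) = r h" if h: "h \<in> carrier G" for h
    proof -
      have "conv G x2 (star G x2) h + conv G x2 (star G x2) (c \<otimes> h) = corr A y2 (p h)"
        using h c cross_push[OF h, of x2 x2] p2 by (simp add: conv_star)
      also have "\<dots> = delta \<one>\<^bsub>A\<^esub> (p h)"
        using y(2) h A.conv_star[of "p h" y2] by (auto simp: A.US_iff)
      also have "\<dots> = delta \<one> h + delta \<one> (c \<otimes> h)"
        using h c c_sq ker[OF h] by (auto simp: delta_def) (metis c_c r_one)
      finally have "conv G x2 (star G x2) h + conv G x2 (star G x2) (c \<otimes> h)
          = delta \<one> h + delta \<one> (c \<otimes> h)" .
      from add_swap[OF this] show ?thesis unfolding r_def by simp
    qed
    define R where "R u = (if u \<in> carrier A then r (sec u) else 0)" for u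
    have Rp: "R (p h) = r h" if h: "h \<in> carrier G" for h
      using p_eq[of h "sec (p h)"] h sec[of "p h"] rc by (auto simp: R_def)
    have suppR: "supp_in A R" by (simp add: R_def supp_in_def)
    have c2: "conv G x2 (star G x2) = (\<lambda>h. delta \<one> h + r h)"
      by (rule ext) (simp add: r_def add.commute[of "conv G x2 (star G x2) _"])
    have s1: "conv G r (star G x1) h = conv A R (star A y1) (p h)" if h: "h \<in> carrier G" for h
    proof -
      have "conv G r (star G x1) h = (\<Sum>k\<in>carrier G. x1 (inv h \<otimes> k) * R (p k))"
        using h Rp by (auto simp: conv_def star_def inv_mult_group mult.commute intro!: sum.cong)
      also have "\<dots> = (\<Sum>k\<in>carrier G. x1 (inv h \<otimes> (h \<otimes> k)) * R (p (h \<otimes> k)))"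
        using sum_translate[OF h, of "\<lambda>k. x1 (inv h \<otimes> k) * R (p k)"] by simp
      also have "\<dots> = (\<Sum>k\<in>carrier G. x1 k * R (p h \<otimes>\<^bsub>A\<^esub> p k))"
        using h by (intro sum.cong) (auto simp: m_assoc[symmetric])
      also have "\<dots> = (\<Sum>u\<in>carrier A. y1 u * R (p h \<otimes>\<^bsub>A\<^esub> u))"
        unfolding p1[symmetric] by (rule sum_push_mult[symmetric])
      also have "\<dots> = (\<Sum>u\<in>carrier A. y1 (inv\<^bsub>A\<^esub> (p h) \<otimes>\<^bsub>A\<^esub> (p h \<otimes>\<^bsub>A\<^esub> u)) * R (p h \<otimes>\<^bsub>A\<^esub> u))"
        using h by (intro sum.cong) (auto simp: A.m_assoc[symmetric])
      also have "\<dots> = (\<Sum>u\<in>carrier A. y1 (inv\<^bsub>A\<^esub> (p h) \<otimes>\<^bsub>A\<^esub> u) * R u)"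
        using A.sum_translate[of "p h" "\<lambda>u. y1 (inv\<^bsub>A\<^esub> (p h) \<otimes>\<^bsub>A\<^esub> u) * R u"] h by simp
      also have "\<dots> = conv A R (star A y1) (p h)"
        using h by (auto simp: conv_def star_def A.inv_mult_group mult.commute intro!: sum.cong)
      finally show ?thesis .
    qed
    have s2: "conv G x1 (conv G r (star G x1)) h = R (p h)" if h: "h \<in> carrier G" for h
    proof -
      have "conv G x1 (conv G r (star G x1)) h
          = (\<Sum>k\<in>carrier G. x1 k * conv A R (star A y1) (inv\<^bsub>A\<^esub> (p k) \<otimes>\<^bsub>A\<^esub> p h))"
        using h unfolding conv_def[of G x1] by (auto simp: s1 intro!: sum.cong)
      also have "\<dots> = conv A y1 (conv A R (star A y1)) (p h)"
        using h sum_push_mult[of x1 "\<lambda>u. conv A R (star A y1) (inv\<^bsub>A\<^esub> u \<otimes>\<^bsub>A\<^esub> p h)"]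
        unfolding p1 conv_def[of A y1] by simp
      also have "conv A y1 (conv A R (star A y1)) = conv A (conv A y1 (star A y1)) R"
        by (simp add: A.conv_comm[of R] A.conv_assoc)
      also have "\<dots> = R"
        using y(1) suppR by (simp add: A.US_iff A.conv_one_left)
      finally show ?thesis .
    qed
    have "corr G (conv G x1 x2) g = conv G x1 (conv G (conv G x2 (star G x2)) (star G x1)) g"
      using g by (simp add: conv_star[symmetric] star_conv conv_assoc)
    also have "\<dots> = corr G x1 g + R (p g)"
      unfolding c2 conv_add_left conv_add_right
      using g by (simp add: s2 conv_one_left supp_star conv_star)
    also have "R (p g) = corr G x2 g"
      using g c by (auto simp: Rp r_def delta_def conv_star)
    finally show ?thesis
      using lam_push[OF g, of "conv G x1 x2"] lam_push[OF g, of x1] lam_push[OF g, of x2]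
      by (simp add: p1 p2 t push_conv)
  qed (simp add: lam_outside)
qed

section \<open>Fibres over unitary elements and the resulting count\<close>

lemma conv_star_eq_cross:
  assumes "u \<in> carrier A"
  shows "conv A (star A y) w u = cross A y w u"
proof -
  have "conv A (star A y) w u = (\<Sum>h\<in>carrier A. y (inv\<^bsub>A\<^esub> h) * w (u \<otimes>\<^bsub>A\<^esub> inv\<^bsub>A\<^esub> h))"
    using assms by (auto simp: conv_def star_def A.m_comm intro!: sum.cong)
  also have "\<dots> = cross A y w u"
    unfolding cross_def by (rule A.sum_inv)
  finally show ?thesis .
qed

lemma corr_lift_invariant:
  assumes "g \<in> carrier G" "p g \<noteq> \<one>\<^bsub>A\<^esub>" "y \<in> US A"
  shows "corr G (lift y) (c \<otimes> g) = corr G (lift y) g"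
proof -
  have "corr A y (p g) = 0" "supp_in A y"
    using assms by (auto simp: US_def)
  then show ?thesis
    using cross_push[OF assms(1), of "lift y" "lift y"] by (simp add: push_lift)
qed

text \<open>A preimage of \<open>y\<close> is \<open>lift y + (1 + c) w\<close>; putting \<open>v = y\<^sup>* w\<close>, it is unitary iff \<open>v + v\<^sup>*\<close>
  equals a prescribed symmetric element, whose coefficients at involutions are given by \<open>lam y\<close>.\<close>

lemma card_fiber:
  assumes y: "y \<in> US A" and l: "lam y = (\<lambda>t. 0)"
  shows "card {x \<in> US G. push x = y} = card (UNIV :: 'f set) ^ A.sdim"
proof -
  define x0 where "x0 = lift y"
  have sy: "supp_in A y" using y by (simp add: US_def)
  have px0: "push x0 = y" using sy by (simp add: x0_def push_lift)
  have sx0: "supp_in G x0" by (simp add: x0_def supp_lift)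
  \<comment> \<open>\<open>r\<close> is \<open>x0 x0^* + 1\<close> seen on \<open>A\<close>. It is 0
    at \<one>: over the identity the coefficient 1 is cancelled, and \<open>c\<close> is an
    involution.\<close>
  define r where "r u = (if u = \<one>\<^bsub>A\<^esub> then 0 else corr G x0 (sec u))" for u
  have rp: "r (p g) = corr G x0 g" if g: "g \<in> carrier G" "g \<noteq> \<one>" for g
  proof (cases "p g = \<one>\<^bsub>A\<^esub>")
    case True
    then have "g = c" using g ker by auto
    then show ?thesis
      using True c c_sq corr_involution[of c x0] by (simp add: r_def)
  next
    case False
    have "sec (p g) = g \<or> sec (p g) = c \<otimes> g"
      using p_eq[of g "sec (p g)"] g sec[of "p g"] by auto
    then show ?thesis
      using False g y corr_lift_invariant[of g y] by (auto simp: r_def x0_def)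
  qed
  have r1: "r \<one>\<^bsub>A\<^esub> = 0" by (simp add: r_def)
  have r_inv: "r (inv\<^bsub>A\<^esub> u) = r u" if u: "u \<in> carrier A" for u
  proof -
    obtain g where g: "g \<in> carrier G" "p g = u" using u p_surj by metis
    show ?thesis
    proof (cases "g = \<one>")
      case True
      then show ?thesis using g(2)[symmetric] by simp
    next
      case False
      then have "inv g \<noteq> \<one>" using g by (metis inv_inv inv_one)
      then show ?thesis
        using rp[of g] rp[of "inv g"] False g cross_inv[of g x0 x0] by simp
    qed
  qed
  \<comment> \<open>A lift of \<open>u\<close> has square \<one> or \<open>c\<close>. In the first
    case the coefficient is 0 automatically, in the second by the assumption on
    \<open>lam y\<close>.\<close>
  have r_sq: "r u = 0" if u: "u \<in> carrier A" "u \<otimes>\<^bsub>A\<^esub> u = \<one>\<^bsub>A\<^esub>" for u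
  proof -
    obtain g where g: "g \<in> carrier G" "p g = u" using u p_surj by metis
    have "g \<otimes> g = \<one> \<or> g \<otimes> g = c"
      using ker[of "g \<otimes> g"] g u by simp
    then show ?thesis
    proof
      assume "g \<otimes> g = \<one>"
      then show ?thesis
        using g rp[of g] r1 corr_involution[of g x0] by (cases "g = \<one>") auto
    next
      assume gc: "g \<otimes> g = c"
      then have "g \<noteq> \<one>" using c by auto
      then show ?thesis
        using g rp[of g] lam_push[OF g(1) gc, of x0] l px0 by simp
    qed
  qed
  define S where "S = {v. supp_in A v \<and> (\<forall>u\<in>carrier A. v u + v (inv\<^bsub>A\<^esub> u) = r u)}"
  define \<Phi> where "\<Phi> v = (\<lambda>g. x0 g + (if g \<in> carrier G then conv A y v (p g) else 0))" for v
  have cancel: "conv A (star A y) (conv A y v) = v" if "supp_in A v" for v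
    using A.US_conv_inv[OF y] that by (simp add: A.conv_assoc[symmetric] A.conv_one_left)
  have cancel': "conv A y (conv A (star A y) v) = v" if "supp_in A v" for v
    using y that by (simp add: A.US_iff A.conv_assoc[symmetric] A.conv_one_left)
  \<comment> \<open>The summand \<open>D D^*\<close> is 0, and the two mixed terms are the values of
    \<open>v\<close> at \<open>p g\<close> and at its inverse.\<close>
  have corr\<Phi>: "corr G (\<Phi> v) g = corr G x0 g + (v (p g) + v (inv\<^bsub>A\<^esub> (p g)))"
    if v: "supp_in A v" and g: "g \<in> carrier G" for v g
  proof -
    define D where "D g = (if g \<in> carrier G then conv A y v (p g) else 0)" for g
    have cr: "cross G x0 D h = v (p h)" if h: "h \<in> carrier G" for h
    proof -
      have "cross G x0 D h = cross G x0 (\<lambda>k. conv A y v (p k)) h"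
        unfolding cross_def by (rule sum.cong) (use h in \<open>auto simp: D_def\<close>)
      also have "\<dots> = conv A (star A y) (conv A y v) (p h)"
        using h by (simp add: cross_push_comp px0 conv_star_eq_cross)
      finally show ?thesis using v by (simp add: cancel)
    qed
    have "corr G D g = 0"
      using g c by (intro corr_invariant) (auto simp: D_def)
    moreover have "cross G D x0 g = v (inv\<^bsub>A\<^esub> (p g))"
      using cr[of "inv g"] cross_inv[of g x0 D] g by simp
    moreover have "\<Phi> v = (\<lambda>g. x0 g + D g)"
      by (simp add: \<Phi>_def D_def)
    ultimately show ?thesis
      using cr[OF g] by (simp add: cross_add_left cross_add_right ac_simps)
  qed
  have push\<Phi>: "push (\<Phi> v) = y" if v: "supp_in A v" for v
  proof
    fix u
    show "push (\<Phi> v) u = y u"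
    proof (cases "u \<in> carrier A")
      case True
      then obtain g where g: "g \<in> carrier G" "p g = u" using p_surj by metis
      have "push (\<Phi> v) (p g) = push x0 (p g)"
        unfolding push_p[OF g(1)] using g c by (auto simp: \<Phi>_def add.commute add.left_commute)
      then show ?thesis using g px0 by simp
    next
      case False
      then show ?thesis using supp_push sy by (metis supp_in_def)
    qed
  qed
  have US\<Phi>: "\<Phi> v \<in> US G \<longleftrightarrow> v \<in> S" if v: "supp_in A v" for v
  proof -
    have "supp_in G (\<Phi> v)"
      using sx0 by (auto simp: \<Phi>_def supp_in_def)
    moreover have "(\<Sum>g\<in>carrier G. \<Phi> v g) = 1"
      using sum_push[of "\<Phi> v"] push\<Phi>[OF v] y by (simp add: US_def)
    moreover have "(\<forall>g\<in>carrier G. g \<noteq> \<one> \<longrightarrow> corr G (\<Phi> v) g = 0) \<longleftrightarrow>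
        (\<forall>g\<in>carrier G. g \<noteq> \<one> \<longrightarrow> v (p g) + v (inv\<^bsub>A\<^esub> (p g)) = r (p g))"
      using v rp by (auto simp: corr\<Phi>)
    moreover have "\<dots> \<longleftrightarrow> (\<forall>g\<in>carrier G. v (p g) + v (inv\<^bsub>A\<^esub> (p g)) = r (p g))"
    proof -
      have "v (p \<one>) + v (inv\<^bsub>A\<^esub> (p \<one>)) = r (p \<one>)" using r1 by simp
      then show ?thesis by metis
    qed
    moreover have "\<dots> \<longleftrightarrow> (\<forall>u\<in>carrier A. v u + v (inv\<^bsub>A\<^esub> u) = r u)"
      unfolding surj[symmetric] by simp
    ultimately show ?thesis
      using v unfolding US_def S_def by simp
  qed
  have "bij_betw \<Phi> S {x \<in> US G. push x = y}"
  proof (rule bij_betw_imageI)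
    show "inj_on \<Phi> S"
    proof (rule inj_onI)
      fix v w assume vw: "v \<in> S" "w \<in> S" "\<Phi> v = \<Phi> w"
      have "conv A y v = conv A y w"
      proof
        fix u
        show "conv A y v u = conv A y w u"
        proof (cases "u \<in> carrier A")
          case True
          then obtain g where "g \<in> carrier G" "p g = u" using p_surj by metis
          then show ?thesis using fun_cong[OF vw(3), of g] by (simp add: \<Phi>_def)
        qed (simp add: conv_def)
      qed
      then show "v = w"
        using cancel vw unfolding S_def by (metis (no_types, lifting) mem_Collect_eq)
    qed
    show "\<Phi> ` S = {x \<in> US G. push x = y}"
    proof (intro equalityI subsetI)
      fix x assume "x \<in> \<Phi> ` S"
      then show "x \<in> {x \<in> US G. push x = y}"
        using US\<Phi> push\<Phi> by (auto simp: S_def)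
    next
      fix x assume "x \<in> {x \<in> US G. push x = y}"
      then have x: "x \<in> US G" "push x = y" by auto
      have sx: "supp_in G x" using x by (simp add: US_def)
      define D where "D g = x g + x0 g" for g
      define w where "w u = (if u \<in> carrier A then D (sec u) else 0)" for u
      have Dc: "D (c \<otimes> g) = D g" if g: "g \<in> carrier G" for g
      proof -
        have "x g + x (c \<otimes> g) = x0 g + x0 (c \<otimes> g)"
          using g x(2) px0 by (simp add: push_p[symmetric])
        from add_swap[OF this] show ?thesis unfolding D_def by simp
      qed
      have wp: "w (p g) = D g" if g: "g \<in> carrier G" for g
        using p_eq[of g "sec (p g)"] g sec[of "p g"] Dc by (auto simp: w_def)
      have sw: "supp_in A w" by (simp add: supp_in_def w_def)
      define v where "v = conv A (star A y) w"
      have sv: "supp_in A v" by (simp add: v_def A.supp_conv)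
      have "\<Phi> v = x"
      proof
        fix g
        show "\<Phi> v g = x g"
          using sx sx0 sw wp[of g]
          by (auto simp: \<Phi>_def v_def cancel' supp_in_def D_def add.commute add.left_commute)
      qed
      then show "x \<in> \<Phi> ` S"
        using US\<Phi>[OF sv] x by blast
    qed
  qed
  then have "card {x \<in> US G. push x = y} = card S"
    by (simp add: bij_betw_same_card)
  also have "\<dots> = card (UNIV :: 'f set) ^ A.sdim"
    unfolding S_def using r_inv r_sq by (rule A.card_skew_solutions)
  finally show ?thesis .
qed

definition lam_image :: "('h \<Rightarrow> 'f) set" where
  "lam_image = lam ` US A"

text \<open>\<open>US G\<close> has the order of the kernel of \<open>lam\<close> times the fibre
  size, and \<open>US A\<close> has the order of the kernel times that of the image. Left
  multiplication by a preimage identifies the kernel with any other fibre of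
  \<open>lam\<close>.\<close>

lemma card_US_ext: "card (US G :: ('g \<Rightarrow> 'f) set) * card lam_image
    = card (US A :: ('h \<Rightarrow> 'f) set) * card (UNIV :: 'f set) ^ A.sdim"
proof -
  define U where "U = {y \<in> US A. lam y = (\<lambda>t. 0)}"
  have finU: "finite U" using A.finite_US by (simp add: U_def)
  have "card (US G :: ('g \<Rightarrow> 'f) set) = (\<Sum>y\<in>push ` US G. card {x \<in> US G. push x = y})"
    using sum.image_gen[OF finite_US, of "\<lambda>_. 1 :: nat" push] by simp
  also have "\<dots> = (\<Sum>y\<in>U. card {x \<in> US G. push x = y})"
  proof (rule sum.mono_neutral_left[OF finU])
    show "push ` US G \<subseteq> U"
      using push_US by (auto simp: U_def)
    show "\<forall>y\<in>U - push ` US G. card {x \<in> US G. push x = y} = 0"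
      by (auto simp: card_eq_0_iff)
  qed
  also have "\<dots> = (\<Sum>y\<in>U. card (UNIV :: 'f set) ^ A.sdim)"
    by (intro sum.cong card_fiber) (auto simp: U_def)
  finally have 1: "card (US G :: ('g \<Rightarrow> 'f) set) = card U * card (UNIV :: 'f set) ^ A.sdim" by simp
  have fib: "card {y \<in> US A. lam y = f} = card U" if f: "f \<in> lam_image" for f
  proof -
    obtain y0 where y0: "y0 \<in> US A" "lam y0 = f" using f by (auto simp: lam_image_def)
    have inv1: "conv A y0 (conv A (star A y0) y) = y" "conv A (star A y0) (conv A y0 y) = y"
      if "y \<in> US A" for y
      using that y0 A.US_conv_inv[OF y0(1)]
      by (auto simp: A.US_iff A.conv_assoc[symmetric] A.conv_one_left)
    have "bij_betw (conv A y0) U {y \<in> US A. lam y = f}"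
    proof (rule bij_betw_byWitness[where f' = "conv A (star A y0)"])
      show "conv A y0 ` U \<subseteq> {y \<in> US A. lam y = f}"
        using y0 by (auto simp: U_def lam_conv A.US_conv)
      show "conv A (star A y0) ` {y \<in> US A. lam y = f} \<subseteq> U"
      proof
        fix z assume "z \<in> conv A (star A y0) ` {y \<in> US A. lam y = f}"
        then obtain y where y: "y \<in> US A" "lam y = f" "z = conv A (star A y0) y" by blast
        have z: "z \<in> US A" using y y0 by (simp add: A.US_conv A.US_star)
        have "lam (conv A y0 z) = (\<lambda>t. lam y0 t + lam z t)"
          using y0 z by (simp add: lam_conv)
        then have "f t = f t + lam z t" for t
          using y y0 inv1 by (metis (no_types, lifting))
        then have "lam z = (\<lambda>t. 0)"
          by (metis (no_types) add_cancel_left_right)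
        then show "z \<in> U" using z by (simp add: U_def)
      qed
    qed (use inv1 in \<open>auto simp: U_def\<close>)
    then show ?thesis by (simp add: bij_betw_same_card)
  qed
  have "card (US A :: ('h \<Rightarrow> 'f) set) = (\<Sum>f\<in>lam_image. card {y \<in> US A. lam y = f})"
    unfolding lam_image_def using sum.image_gen[OF A.finite_US, of "\<lambda>_. 1 :: nat" lam] by simp
  also have "\<dots> = card lam_image * card U"
    using fib by simp
  finally show ?thesis using 1 by simp
qed

lemma lam_image_add:
  assumes "f \<in> lam_image" "g \<in> lam_image"
  shows "(\<lambda>t. f t + g t) \<in> lam_image"
proof -
  obtain y z where "y \<in> US A" "z \<in> US A" "f = lam y" "g = lam z"
    using assms by (auto simp: lam_image_def)
  then show ?thesis
    unfolding lam_image_def by (intro image_eqI[of _ _ "conv A y z"]) (auto simp: lam_conv A.US_conv)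
qed

section \<open>Elements of the image of \<open>lam\<close>\<close>

definition single :: "'h \<Rightarrow> 'f \<Rightarrow> 'h \<Rightarrow> 'f" where
  "single t a = (\<lambda>u. if u = t then a else 0)"

lemma finite_T: "finite T"
  using T_carrier A.fin finite_subset by blast

lemma lam_delta_one: "lam (delta \<one>\<^bsub>A\<^esub>) = (\<lambda>t. 0)"
  using lam_delta[of "\<one>\<^bsub>A\<^esub>" 1] by auto

lemma delta_one_US: "delta \<one>\<^bsub>A\<^esub> \<in> (US A :: ('h \<Rightarrow> 'f) set)"
proof -
  have "star A (delta \<one>\<^bsub>A\<^esub>) = (delta \<one>\<^bsub>A\<^esub> :: 'h \<Rightarrow> 'f)"
    by (auto simp: star_def delta_def fun_eq_iff)
  then show ?thesis
    using A.fin by (simp add: A.US_iff A.supp_delta A.conv_one_left) (simp add: delta_def)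
qed

lemma zero_lam_image: "(\<lambda>t. 0) \<in> lam_image"
  unfolding lam_image_def using delta_one_US lam_delta_one by (metis image_eqI)

lemma sum_lam_image:
  assumes "finite S" "\<And>t. t \<in> S \<Longrightarrow> f t \<in> lam_image"
  shows "(\<lambda>u. \<Sum>t\<in>S. f t u) \<in> lam_image"
  using assms by (induction S) (auto simp: zero_lam_image lam_image_add)

text \<open>The image is only known to be closed under addition, not under scalars, so each
  coordinate has to be hit by every field element.\<close>

lemma lam_image_singles:
  assumes "\<And>t a. t \<in> T \<Longrightarrow> single t a \<in> lam_image"
  shows "card lam_image = card (UNIV :: 'f set) ^ card T"
proof -
  have "lam_image = {f. \<forall>t. (t \<in> T \<longrightarrow> f t \<in> UNIV) \<and> (t \<notin> T \<longrightarrow> f t = 0)}"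
  proof (intro equalityI subsetI)
    fix f assume "f \<in> {f. \<forall>t. (t \<in> T \<longrightarrow> f t \<in> (UNIV :: 'f set)) \<and> (t \<notin> T \<longrightarrow> f t = 0)}"
    then have "f = (\<lambda>u. \<Sum>t\<in>T. single t (f t) u)"
      using finite_T by (auto simp: single_def fun_eq_iff)
    moreover have "(\<lambda>u. \<Sum>t\<in>T. single t (f t) u) \<in> lam_image"
      using assms finite_T by (intro sum_lam_image) auto
    ultimately show "f \<in> lam_image" by simp
  qed (auto simp: lam_image_def lam_outside)
  moreover have "bij_betw (\<lambda>f. restrict f T) {f. \<forall>t. (t \<in> T \<longrightarrow> f t \<in> (UNIV :: 'f set)) \<and> (t \<notin> T \<longrightarrow> f t = 0)}
      (T \<rightarrow>\<^sub>E UNIV)"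
    by (rule bij_betw_byWitness[where f' = "\<lambda>f t. if t \<in> T then f t else 0"])
      (auto simp: fun_eq_iff PiE_def extensional_def)
  ultimately show ?thesis
    using finite_T by (simp add: bij_betw_same_card card_PiE)
qed

text \<open>The image under \<open>lam\<close> of the unit \<open>1 + a (h + k)\<close>.\<close>

lemma special_unit:
  assumes hk: "h \<in> carrier A" "k \<in> carrier A"
    and cond: "(h \<otimes>\<^bsub>A\<^esub> h = \<one>\<^bsub>A\<^esub> \<and> k \<otimes>\<^bsub>A\<^esub> k = \<one>\<^bsub>A\<^esub>) \<or>
      (k = inv\<^bsub>A\<^esub> h \<and> (h \<otimes>\<^bsub>A\<^esub> h) \<otimes>\<^bsub>A\<^esub> (h \<otimes>\<^bsub>A\<^esub> h) = \<one>\<^bsub>A\<^esub>)"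
  shows "(\<lambda>t. if t \<in> T then a * delta h t + a * delta k t + (if t = h \<otimes>\<^bsub>A\<^esub> inv\<^bsub>A\<^esub> k then a^2 else 0) else 0)
    \<in> lam_image"
proof -
  define z :: "'h \<Rightarrow> 'f" where "z = (\<lambda>u. a * delta h u + a * delta k u)"
  define y where "y = (\<lambda>u. delta \<one>\<^bsub>A\<^esub> u + z u)"
  have sd: "supp_in A (\<lambda>u. a * delta h u)" "supp_in A (\<lambda>u. a * delta k u)"
    using hk by (auto simp: supp_in_def delta_def)
  then have sz: "supp_in A z" unfolding z_def supp_in_def by (metis add_0)
  have s1: "supp_in A (delta \<one>\<^bsub>A\<^esub>)" by (simp add: A.supp_delta)
  have c1: "cross A (delta \<one>\<^bsub>A\<^esub>) z u = z u" if "u \<in> carrier A" for u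
    using A.cross_delta[of "\<one>\<^bsub>A\<^esub>" 1 z u] that by simp
  have c2: "cross A (\<lambda>u. a * delta h u) (\<lambda>u. a * delta k u) u = (if u = h \<otimes>\<^bsub>A\<^esub> inv\<^bsub>A\<^esub> k then a^2 else 0)"
    if "u \<in> carrier A" "h \<otimes>\<^bsub>A\<^esub> inv\<^bsub>A\<^esub> k = k \<otimes>\<^bsub>A\<^esub> inv\<^bsub>A\<^esub> h" for u
  proof -
    have "u \<otimes>\<^bsub>A\<^esub> h = k \<longleftrightarrow> u = h \<otimes>\<^bsub>A\<^esub> inv\<^bsub>A\<^esub> k"
      using that hk by (metis A.inv_solve_right')
    then show ?thesis
      unfolding A.cross_delta[OF hk(1)] by (simp add: delta_def power2_eq_square)
  qed
  have inv_sq: "inv\<^bsub>A\<^esub> u = u" if "u \<in> carrier A" "u \<otimes>\<^bsub>A\<^esub> u = \<one>\<^bsub>A\<^esub>" for u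
    using that by (simp add: A.inv_equality)
  \<comment> \<open>In both cases \<open>h k^-1\<close> is its own inverse; this is what makes the
    mixed terms of \<open>z z^*\<close> cancel.\<close>
  have hk_sym: "h \<otimes>\<^bsub>A\<^esub> inv\<^bsub>A\<^esub> k = k \<otimes>\<^bsub>A\<^esub> inv\<^bsub>A\<^esub> h"
    using cond
  proof
    assume "h \<otimes>\<^bsub>A\<^esub> h = \<one>\<^bsub>A\<^esub> \<and> k \<otimes>\<^bsub>A\<^esub> k = \<one>\<^bsub>A\<^esub>"
    then show ?thesis using hk by (simp add: inv_sq A.m_comm)
  next
    assume *: "k = inv\<^bsub>A\<^esub> h \<and> (h \<otimes>\<^bsub>A\<^esub> h) \<otimes>\<^bsub>A\<^esub> (h \<otimes>\<^bsub>A\<^esub> h) = \<one>\<^bsub>A\<^esub>"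
    then show ?thesis using hk inv_sq[of "h \<otimes>\<^bsub>A\<^esub> h"] by (simp add: A.inv_mult)
  qed
  have z_sym: "z (inv\<^bsub>A\<^esub> u) = z u" if u: "u \<in> carrier A" for u
  proof -
    have "inv\<^bsub>A\<^esub> u = h \<longleftrightarrow> u = inv\<^bsub>A\<^esub> h" "inv\<^bsub>A\<^esub> u = k \<longleftrightarrow> u = inv\<^bsub>A\<^esub> k"
      using u hk by auto
    then show ?thesis
      using cond hk inv_sq[of h] inv_sq[of k] by (auto simp: z_def delta_def)
  qed
  have hk_inv: "inv\<^bsub>A\<^esub> (h \<otimes>\<^bsub>A\<^esub> inv\<^bsub>A\<^esub> k) = h \<otimes>\<^bsub>A\<^esub> inv\<^bsub>A\<^esub> k"
    using hk hk_sym by (simp add: A.inv_mult_group)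
  have cz: "corr A z u = 0" if u: "u \<in> carrier A" "u \<noteq> \<one>\<^bsub>A\<^esub>" for u
  proof -
    have cd: "corr A (\<lambda>u. a * delta l u) u = 0" if "l \<in> carrier A" for l
      using that u by (simp add: A.cross_delta) (simp add: delta_def)
    have "inv\<^bsub>A\<^esub> u = h \<otimes>\<^bsub>A\<^esub> inv\<^bsub>A\<^esub> k \<longleftrightarrow> u = h \<otimes>\<^bsub>A\<^esub> inv\<^bsub>A\<^esub> k"
      using hk_inv u hk by (metis A.inv_inv)
    then have "cross A (\<lambda>u. a * delta k u) (\<lambda>u. a * delta h u) u
        = cross A (\<lambda>u. a * delta h u) (\<lambda>u. a * delta k u) u"
      using A.cross_inv[of u "\<lambda>u. a * delta h u" "\<lambda>u. a * delta k u"] u hk_sym by (simp add: c2)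
    then show ?thesis
      unfolding z_def A.cross_add_left A.cross_add_right using cd hk by (simp add: ac_simps)
  qed
  \<comment> \<open>\<open>y y^* = 1 + z + z^* + z z^*\<close>, where \<open>z^* = z\<close> and
    \<open>z z^*\<close> has no coefficient off \<one>.\<close>
  have "corr A y u = 0" if u: "u \<in> carrier A" "u \<noteq> \<one>\<^bsub>A\<^esub>" for u
  proof -
    have "corr A (delta \<one>\<^bsub>A\<^esub>) u = (0 :: 'f)"
      using A.cross_delta[of "\<one>\<^bsub>A\<^esub>" "1 :: 'f" "delta \<one>\<^bsub>A\<^esub>" u] u by (simp add: delta_def)
    moreover have "cross A z (delta \<one>\<^bsub>A\<^esub>) u = z u"
      using A.cross_inv[of u "delta \<one>\<^bsub>A\<^esub>" z] c1[of "inv\<^bsub>A\<^esub> u"] z_sym u by simp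
    ultimately show ?thesis
      unfolding y_def A.cross_add_left A.cross_add_right using cz[OF u] c1 u by simp
  qed
  moreover have "(\<Sum>u\<in>carrier A. y u) = 1"
  proof -
    have "(\<Sum>u\<in>carrier A. a * delta l u) = a" if "l \<in> carrier A" for l
      using that A.fin by (simp add: delta_def sum_distrib_left[symmetric])
    then show ?thesis
      using hk A.fin by (simp add: y_def z_def sum.distrib) (simp add: delta_def)
  qed
  ultimately have "y \<in> US A"
    using s1 sz by (auto simp: US_def y_def supp_in_def)
  moreover have "lam y = (\<lambda>t. if t \<in> T then a * delta h t + a * delta k t
      + (if t = h \<otimes>\<^bsub>A\<^esub> inv\<^bsub>A\<^esub> k then a^2 else 0) else 0)"
  proof
    fix t
    show "lam y t = (if t \<in> T then a * delta h t + a * delta k t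
      + (if t = h \<otimes>\<^bsub>A\<^esub> inv\<^bsub>A\<^esub> k then a^2 else 0) else 0)"
    proof (cases "t \<in> T")
      case t: True
      then have tA: "t \<in> carrier A" using T_carrier by auto
      \<comment> \<open>The monomials contribute nothing, so only the polar form of
        \<open>lam\<close> remains: \<open>a^2\<close> at \<open>h k^-1\<close>.\<close>
      have "lam z t = (if t = h \<otimes>\<^bsub>A\<^esub> inv\<^bsub>A\<^esub> k then a^2 else 0)"
        using lam_add[OF sd t] hk hk_sym tA by (simp add: z_def lam_delta c2)
      then show ?thesis
        using lam_add[OF s1 sz t] t tA by (simp add: y_def lam_delta_one c1) (simp add: z_def)
    qed (simp add: lam_outside)
  qed
  ultimately show ?thesis
    unfolding lam_image_def by (metis image_eqI)
qed

section \<open>Counting square roots of \<one> and of \<open>c\<close>\<close>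

lemma card_two_fibers:
  assumes "S \<subseteq> carrier A"
  shows "card {g \<in> carrier G. p g \<in> S} = 2 * card S"
proof -
  have finS: "finite S" using assms A.fin finite_subset by blast
  have "card {g \<in> carrier G. p g \<in> S} = card (\<Union>u\<in>S. {g \<in> carrier G. p g = u})"
    by (rule arg_cong[of _ _ card]) auto
  also have "\<dots> = (\<Sum>u\<in>S. card {g \<in> carrier G. p g = u})"
    using finS fin by (intro card_UN_disjoint) auto
  also have "\<dots> = (\<Sum>u\<in>S. 2)"
  proof (rule sum.cong[OF HOL.refl])
    fix u assume "u \<in> S"
    then obtain g where g: "g \<in> carrier G" "p g = u" using assms p_surj by blast
    then have "{h \<in> carrier G. p h = u} = {g, c \<otimes> g}"
      using p_eq[of g] c by auto
    then show "card {h \<in> carrier G. p h = u} = 2"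
      using c_neq[OF g(1)] by simp
  qed
  finally show ?thesis by simp
qed

lemma order_ext: "card (carrier G) = 2 * card (carrier A)"
  using card_two_fibers[of "carrier A"] by (simp cong: conj_cong)

lemma card_roots: "card {g \<in> carrier G. g \<otimes> g = c} = 2 * card T"
proof -
  have "{g \<in> carrier G. g \<otimes> g = c} = {g \<in> carrier G. p g \<in> T}"
    using p_in_T by auto
  then show ?thesis using card_two_fibers[OF T_carrier] by simp
qed

lemma sq_in_ker: "g \<in> carrier G \<Longrightarrow> p g \<otimes>\<^bsub>A\<^esub> p g = \<one>\<^bsub>A\<^esub> \<longleftrightarrow> g \<otimes> g = \<one> \<or> g \<otimes> g = c"
  using ker[of "g \<otimes> g"] by simp

text \<open>Both kinds of roots together are the full preimage of the elements of \<open>A\<close>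
  with square \<one>, and every fibre has two elements.\<close>

lemma card_roots_both: "card {g \<in> carrier G. g \<otimes> g = \<one>} + card {g \<in> carrier G. g \<otimes> g = c}
    = 2 * card {u \<in> carrier A. u \<otimes>\<^bsub>A\<^esub> u = \<one>\<^bsub>A\<^esub>}"
proof -
  have "{g \<in> carrier G. p g \<in> {u \<in> carrier A. u \<otimes>\<^bsub>A\<^esub> u = \<one>\<^bsub>A\<^esub>}}
      = {g \<in> carrier G. g \<otimes> g = \<one>} \<union> {g \<in> carrier G. g \<otimes> g = c}"
    using sq_in_ker by auto
  then have "2 * card {u \<in> carrier A. u \<otimes>\<^bsub>A\<^esub> u = \<one>\<^bsub>A\<^esub>}
      = card ({g \<in> carrier G. g \<otimes> g = \<one>} \<union> {g \<in> carrier G. g \<otimes> g = c})"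
    using card_two_fibers[of "{u \<in> carrier A. u \<otimes>\<^bsub>A\<^esub> u = \<one>\<^bsub>A\<^esub>}"] by simp
  then show ?thesis
    using fin c by (subst (asm) card_Un_disjoint) auto
qed

lemma sq_mult_commuting:
  assumes "g \<in> carrier G" "z \<in> carrier G" "g \<otimes> z = z \<otimes> g"
  shows "(g \<otimes> z) \<otimes> (g \<otimes> z) = (g \<otimes> g) \<otimes> (z \<otimes> z)"
  using assms by (metis m_assoc m_closed)

text \<open>Multiplication by \<open>z\<close> exchanges the square roots of \<open>\<one>\<close> and of \<open>c\<close>.\<close>

lemma card_roots_eq:
  assumes z: "z \<in> carrier G" "z \<otimes> z = c"
    and comm: "\<And>g. g \<in> carrier G \<Longrightarrow> g \<otimes> g = \<one> \<or> g \<otimes> g = c \<Longrightarrow> g \<otimes> z = z \<otimes> g"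
  shows "card {g \<in> carrier G. g \<otimes> g = \<one>} = card {g \<in> carrier G. g \<otimes> g = c}"
proof (rule bij_betw_same_card[of "\<lambda>g. g \<otimes> z"], rule bij_betw_imageI)
  show "inj_on (\<lambda>g. g \<otimes> z) {g \<in> carrier G. g \<otimes> g = \<one>}"
    using z by (auto intro: inj_onI)
  show "(\<lambda>g. g \<otimes> z) ` {g \<in> carrier G. g \<otimes> g = \<one>} = {g \<in> carrier G. g \<otimes> g = c}"
  proof (intro equalityI subsetI)
    fix g assume "g \<in> (\<lambda>g. g \<otimes> z) ` {g \<in> carrier G. g \<otimes> g = \<one>}"
    then obtain h where h: "h \<in> carrier G" "h \<otimes> h = \<one>" "g = h \<otimes> z" by blast
    then have "g \<otimes> g = c" using sq_mult_commuting[of h z] comm[of h] z c by simp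
    then show "g \<in> {g \<in> carrier G. g \<otimes> g = c}" using h z by simp
  next
    fix g assume "g \<in> {g \<in> carrier G. g \<otimes> g = c}"
    then have g: "g \<in> carrier G" "g \<otimes> g = c" by auto
    have zz: "(c \<otimes> z) \<otimes> z = \<one>"
      using z c c_sq by (simp add: m_assoc)
    \<comment> \<open>\<open>c z\<close> is the inverse of \<open>z\<close>.\<close>
    define h where "h = g \<otimes> (c \<otimes> z)"
    have "h \<otimes> z = g"
      using g z c zz by (simp add: h_def m_assoc)
    moreover have "h \<otimes> h = \<one>"
    proof -
      have "g \<otimes> (c \<otimes> z) = (g \<otimes> c) \<otimes> z" using g z c by (simp add: m_assoc)
      also have "\<dots> = c \<otimes> (g \<otimes> z)" using g z c by (simp add: c_comm m_assoc)
      also have "\<dots> = (c \<otimes> z) \<otimes> g" using g z c comm[of g] by (simp add: m_assoc)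
      finally have "h \<otimes> h = (g \<otimes> g) \<otimes> ((c \<otimes> z) \<otimes> (c \<otimes> z))"
        unfolding h_def using g z c by (intro sq_mult_commuting) auto
      also have "\<dots> = \<one>"
        unfolding sq_c[OF z(1)] using g z c_sq by simp
      finally show ?thesis .
    qed
    ultimately show "g \<in> (\<lambda>g. g \<otimes> z) ` {g \<in> carrier G. g \<otimes> g = \<one>}"
      using g z c by (intro image_eqI[of _ _ h]) (auto simp: h_def)
  qed
qed

section \<open>Two situations in which \<open>lam\<close> is onto\<close>

lemma special_pair:
  assumes "g \<in> carrier G" "k \<in> carrier G" "p g \<otimes>\<^bsub>A\<^esub> p g = \<one>\<^bsub>A\<^esub>" "p k \<otimes>\<^bsub>A\<^esub> p k = \<one>\<^bsub>A\<^esub>"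
  shows "(\<lambda>t. if t \<in> T then a * delta (p g) t + a * delta (p k) t
      + (if t = p (g \<otimes> k) then a^2 else 0) else 0) \<in> lam_image"
proof -
  have eq: "p (g \<otimes> k) = p g \<otimes>\<^bsub>A\<^esub> inv\<^bsub>A\<^esub> (p k)" using assms by (simp add: A.inv_equality)
  show ?thesis unfolding eq using assms by (intro special_unit) auto
qed

lemma single_from_sum:
  assumes "(\<lambda>u. single s b u + single t a u) \<in> lam_image" "single s b \<in> lam_image"
  shows "single t a \<in> lam_image"
  using lam_image_add[OF assms(2,1)] by simp

text \<open>Coefficients at squares are handled by the units \<open>1 + a (h + h\<inverse>)\<close>.\<close>

lemma card_lam_image_square:
  assumes z: "z \<in> carrier G" "z \<otimes> z = c"
    and comm: "\<And>g. g \<in> carrier G \<Longrightarrow> g \<otimes> g = c \<Longrightarrow> g \<otimes> z = z \<otimes> g"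
    and h: "h \<in> carrier G" "p (h \<otimes> h) = p z"
  shows "card lam_image = card (UNIV :: 'f set) ^ card T"
proof (rule lam_image_singles)
  have zT: "p z \<in> T" using z p_in_T by simp
  have hz: "p h \<otimes>\<^bsub>A\<^esub> p h = p z" using h by simp
  have z1: "p z \<noteq> \<one>\<^bsub>A\<^esub>" using zT one_notin_T by auto
  \<comment> \<open>In \<open>1 + b (h + h^-1)\<close> neither monomial meets \<open>T\<close>,
    since its square is \<open>p z\<close> or the inverse of that, not \<one>. Only the quadratic
    term \<open>b^2\<close> at \<open>p z\<close> remains, and every field element is a
    square.\<close>
  have sz: "single (p z) a \<in> lam_image" for a
  proof -
    obtain b where b: "b^2 = a" using square_root by blast
    have phA: "p h \<in> carrier A" using h by simp
    then have "inv\<^bsub>A\<^esub> (p h) \<otimes>\<^bsub>A\<^esub> inv\<^bsub>A\<^esub> (p h) = inv\<^bsub>A\<^esub> (p z)"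
      by (simp add: hz[symmetric] A.inv_mult)
    moreover have "inv\<^bsub>A\<^esub> (p z) \<noteq> \<one>\<^bsub>A\<^esub>"
      using z1 z(1) by (metis A.inv_inv A.inv_one p.hom_closed)
    ultimately have nT: "p h \<notin> T" "inv\<^bsub>A\<^esub> (p h) \<notin> T"
      using T_sq[of "p h"] T_sq[of "inv\<^bsub>A\<^esub> (p h)"] hz z1 by auto
    have "(p h \<otimes>\<^bsub>A\<^esub> p h) \<otimes>\<^bsub>A\<^esub> (p h \<otimes>\<^bsub>A\<^esub> p h) = \<one>\<^bsub>A\<^esub>"
      unfolding hz using T_sq[OF zT] .
    then have "(\<lambda>t. if t \<in> T then b * delta (p h) t + b * delta (inv\<^bsub>A\<^esub> (p h)) t
        + (if t = p h \<otimes>\<^bsub>A\<^esub> inv\<^bsub>A\<^esub> (inv\<^bsub>A\<^esub> (p h)) then b^2 else 0) else 0) \<in> lam_image"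
      using h by (intro special_unit) auto
    also have "(\<lambda>t. if t \<in> T then b * delta (p h) t + b * delta (inv\<^bsub>A\<^esub> (p h)) t
        + (if t = p h \<otimes>\<^bsub>A\<^esub> inv\<^bsub>A\<^esub> (inv\<^bsub>A\<^esub> (p h)) then b^2 else 0) else 0) = single (p z) a"
      unfolding A.inv_inv[OF phA] hz using nT zT b by (auto simp: single_def delta_def fun_eq_iff)
    finally show ?thesis .
  qed
  fix t a assume t: "t \<in> T"
  show "single t a \<in> lam_image"
  proof (cases "t = p z")
    case False
    obtain g where g: "g \<in> carrier G" "g \<otimes> g = c" "t = p g" using t T_cases by blast
    \<comment> \<open>\<open>z\<close> and \<open>g\<close> are commuting roots of \<open>c\<close>,
      so \<open>z g\<close> is a root of \<one> and the quadratic term of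
      \<open>1 + a (z + g)\<close> falls outside \<open>T\<close>; the coordinate at
      \<open>p z\<close> can then be subtracted.\<close>
    have "(z \<otimes> g) \<otimes> (z \<otimes> g) = \<one>"
      using sq_mult_commuting[of z g] g z comm c_sq by simp
    then have "p (z \<otimes> g) \<notin> T" using g z c by (subst p_in_T) auto
    then have "(\<lambda>t. if t \<in> T then a * delta (p z) t + a * delta (p g) t
        + (if t = p (z \<otimes> g) then a^2 else 0) else 0) = (\<lambda>u. single (p z) a u + single t a u)"
      using zT t g by (auto simp: single_def delta_def fun_eq_iff)
    then have "(\<lambda>u. single (p z) a u + single t a u) \<in> lam_image"
      using special_pair[of z g a] g z zT T_sq t by metis
    then show ?thesis using sz single_from_sum by blast
  qed (simp add: sz)
qed

lemma noncomm_c: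
  assumes "g \<in> carrier G" "k \<in> carrier G" "g \<otimes> k \<noteq> k \<otimes> g"
  shows "g \<otimes> k = c \<otimes> (k \<otimes> g)"
  using p_eq[of "k \<otimes> g" "g \<otimes> k"] assms by (simp add: A.m_comm)

lemma sq_mult_noncommuting:
  assumes "g \<in> carrier G" "k \<in> carrier G" "g \<otimes> k \<noteq> k \<otimes> g"
  shows "(g \<otimes> k) \<otimes> (g \<otimes> k) = c \<otimes> ((g \<otimes> g) \<otimes> (k \<otimes> k))"
proof -
  have e: "k \<otimes> g = c \<otimes> (g \<otimes> k)"
    using noncomm_c[OF assms] assms by simp
  have "(g \<otimes> k) \<otimes> (g \<otimes> k) = g \<otimes> ((k \<otimes> g) \<otimes> k)"
    using assms by (simp add: m_assoc)
  also have "\<dots> = (g \<otimes> c) \<otimes> (g \<otimes> (k \<otimes> k))"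
    unfolding e using assms c by (simp add: m_assoc)
  also have "\<dots> = c \<otimes> ((g \<otimes> g) \<otimes> (k \<otimes> k))"
    using assms c by (simp add: c_comm) (simp add: m_assoc)
  finally show ?thesis .
qed

text \<open>A substitute for a root of \<open>c\<close> that is a square modulo \<open>c\<close>:
  for a root \<open>g\<close> and a noncommuting involution \<open>s\<close>, the unit
  \<open>1 + a (g + g s)\<close> has its only contribution at \<open>p g\<close>. From
  \<open>g0\<close> and \<open>s\<close> every root \<open>g\<close> is reached: through
  \<open>1 + a (g0 + g)\<close> if it commutes with \<open>g0\<close>, and with the involution
  \<open>g0 z\<close> in the role of \<open>s\<close> if it does not.\<close>

lemma card_lam_image_noncomm:
  assumes z: "z \<in> carrier G" "z \<otimes> z = c"
    and comm: "\<And>g. g \<in> carrier G \<Longrightarrow> g \<otimes> g = \<one> \<or> g \<otimes> g = c \<Longrightarrow> g \<otimes> z = z \<otimes> g"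
    and g0: "g0 \<in> carrier G" "g0 \<otimes> g0 = c" and s: "s \<in> carrier G" "s \<otimes> s = \<one>" "g0 \<otimes> s \<noteq> s \<otimes> g0"
  shows "card lam_image = card (UNIV :: 'f set) ^ card T"
proof (rule lam_image_singles)
  text \<open>If \<open>g\<close> is a root of \<open>c\<close> and \<open>s\<close> an involution not commuting with it, \<open>gs\<close> is an involution.\<close>
  have step: "single (p g) a \<in> lam_image"
    if g: "g \<in> carrier G" "g \<otimes> g = c" and s: "s \<in> carrier G" "s \<otimes> s = \<one>" "g \<otimes> s \<noteq> s \<otimes> g" for g s a
  proof -
    have gs: "(g \<otimes> s) \<otimes> (g \<otimes> s) = \<one>"
      using sq_mult_noncommuting[of g s] g s c c_sq by simp
    have 1: "p g \<in> T" "p s \<notin> T" "p (g \<otimes> s) \<notin> T"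
      using g s gs c p_in_T[of g] p_in_T[of s] p_in_T[of "g \<otimes> s"] by auto
    have "g \<otimes> (g \<otimes> s) = c \<otimes> s" using g s by (simp add: m_assoc[symmetric])
    then have eq: "p (g \<otimes> (g \<otimes> s)) = p s" using s c by simp
    have "p (g \<otimes> s) \<otimes>\<^bsub>A\<^esub> p (g \<otimes> s) = \<one>\<^bsub>A\<^esub>" "p g \<otimes>\<^bsub>A\<^esub> p g = \<one>\<^bsub>A\<^esub>"
      using sq_in_ker[of "g \<otimes> s"] sq_in_ker[of g] g s gs by blast+
    then have "(\<lambda>t. if t \<in> T then a * delta (p g) t + a * delta (p (g \<otimes> s)) t
      + (if t = p s then a^2 else 0) else 0) \<in> lam_image"
      using special_pair[of g "g \<otimes> s" a] g s unfolding eq by simp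
    moreover have "(\<lambda>t. if t \<in> T then a * delta (p g) t + a * delta (p (g \<otimes> s)) t
      + (if t = p s then a^2 else 0) else 0) = single (p g) a"
      using 1 by (auto simp: single_def delta_def fun_eq_iff)
    ultimately show ?thesis by simp
  qed
  fix t a assume t: "t \<in> T"
  obtain g where g: "g \<in> carrier G" "g \<otimes> g = c" "t = p g" using t T_cases by blast
  show "single t a \<in> lam_image"
  proof (cases "g \<otimes> g0 = g0 \<otimes> g")
    case True
    show ?thesis
    proof (cases "t = p g0")
      case True
      then show ?thesis using step[OF g0 s] by simp
    next
      case False
      have "(g0 \<otimes> g) \<otimes> (g0 \<otimes> g) = \<one>"
        using sq_mult_commuting[of g0 g] True g g0 c_sq by simp
      then have "p (g0 \<otimes> g) \<notin> T" using g g0 c by (subst p_in_T) auto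
      moreover have g0T: "p g0 \<in> T" using g0 p_in_T by simp
      ultimately have "(\<lambda>t. if t \<in> T then a * delta (p g0) t + a * delta (p g) t
          + (if t = p (g0 \<otimes> g) then a^2 else 0) else 0) = (\<lambda>u. single (p g0) a u + single t a u)"
        using t g False by (auto simp: single_def delta_def fun_eq_iff)
      then have "(\<lambda>u. single (p g0) a u + single t a u) \<in> lam_image"
        using special_pair[of g0 g a] g g0 g0T T_sq t by metis
      then show ?thesis using step[OF g0 s] single_from_sum by blast
    qed
  next
    case False
    \<comment> \<open>\<open>z\<close> commutes with every root, so \<open>g0 z\<close> is an
      involution and, like \<open>g0\<close>, does not commute with \<open>g\<close>.\<close>
    have cz: "g0 \<otimes> z = z \<otimes> g0" using comm g0 by simp
    have gz: "g \<otimes> z = z \<otimes> g" using comm g by simp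
    have "(g0 \<otimes> z) \<otimes> g = (g0 \<otimes> g) \<otimes> z"
      using g g0 z gz by (simp add: m_assoc)
    moreover have "g \<otimes> (g0 \<otimes> z) = (g \<otimes> g0) \<otimes> z"
      using g g0 z by (simp add: m_assoc)
    ultimately have "g \<otimes> (g0 \<otimes> z) \<noteq> (g0 \<otimes> z) \<otimes> g"
      using False g g0 z by simp
    moreover have "(g0 \<otimes> z) \<otimes> (g0 \<otimes> z) = \<one>"
      using sq_mult_commuting[OF g0(1) z(1) cz] g0 z c_sq by simp
    ultimately show ?thesis
      using step[of g "g0 \<otimes> z"] g g0 z by simp
  qed
qed

end

section \<open>The Artin-Schreier subgroup and the case of index 2\<close>

context char2
begin

definition artin_schreier :: "'f set" where
  "artin_schreier = range (\<lambda>a. a^2 + a)"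

text \<open>The map is two-to-one: \<open>a\<close> and \<open>a + 1\<close> have the same value,
  and no other element shares it.\<close>

lemma card_artin_schreier: "2 * card artin_schreier = card (UNIV :: 'f set)"
proof -
  have eq: "b^2 + b = a^2 + a \<longleftrightarrow> b = a \<or> b = a + 1" for a b :: 'f
  proof -
    have "b^2 + b = a^2 + a \<longleftrightarrow> (b + a) * (b + a + 1) = 0"
    proof -
      have "(b + a) * (b + a + 1) = (b^2 + b) + (a^2 + a)"
        using square_add[of b a] by (simp add: distrib_left power2_eq_square ac_simps)
      then show ?thesis by simp
    qed
    then show ?thesis
      by (simp add: add.assoc)
  qed
  have "card (UNIV :: 'f set) = (\<Sum>v\<in>artin_schreier. card {a. a^2 + a = v})"
    unfolding artin_schreier_def
    using sum.image_gen[of "UNIV :: 'f set" "\<lambda>_. 1 :: nat" "\<lambda>a. a^2 + a"] by simp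
  also have "\<dots> = (\<Sum>v\<in>artin_schreier. 2)"
  proof (rule sum.cong[OF HOL.refl])
    fix v assume "v \<in> artin_schreier"
    then obtain a where "v = a^2 + a" by (auto simp: artin_schreier_def)
    then have "{b. b^2 + b = v} = {a, a + 1}" using eq by auto
    then show "card {b. b^2 + b = v} = 2" by simp
  qed
  finally show ?thesis by simp
qed

end

context central_ext
begin

text \<open>Here \<open>A\<close> is the direct product of \<open>N\<close> and a group of order 2.  For \<open>y\<close> unitary with
  \<open>s = (\<Sum>u\<in>N. y u)\<close>, expanding \<open>s (1 + s)\<close> over \<open>N\<close> and its complement and cancelling \<open>u\<close> against
  \<open>u\<inverse>\<close> leaves the sum of the \<open>lam y t\<close>; this gives the upper bound.\<close>

lemma sum_lam_artin_schreier:
  assumes N: "subgroup N A" and idx: "\<And>u v. u \<in> carrier A - N \<Longrightarrow> v \<in> carrier A - N \<Longrightarrow> u \<otimes>\<^bsub>A\<^esub> v \<in> N"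
    and T: "T = {t \<in> carrier A - N. t \<otimes>\<^bsub>A\<^esub> t = \<one>\<^bsub>A\<^esub>}"
    and y: "y \<in> US A"
  shows "(\<Sum>t\<in>T. lam y t) \<in> artin_schreier"
proof -
  define C where "C = carrier A - N"
  have NA: "N \<subseteq> carrier A" using N subgroup.subset by blast
  have fin': "finite N" "finite C" using NA A.fin by (auto simp: C_def intro: finite_subset)
  have mulN: "u \<otimes>\<^bsub>A\<^esub> h \<in> C" if "u \<in> C" "h \<in> N" for u h
  proof -
    have "u \<otimes>\<^bsub>A\<^esub> h \<notin> N"
    proof
      assume "u \<otimes>\<^bsub>A\<^esub> h \<in> N"
      then have "(u \<otimes>\<^bsub>A\<^esub> h) \<otimes>\<^bsub>A\<^esub> inv\<^bsub>A\<^esub> h \<in> N"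
        using that N by (metis subgroup.m_closed subgroup.m_inv_closed)
      then show False using that NA by (auto simp: C_def A.m_assoc)
    qed
    then show ?thesis using that NA by (auto simp: C_def)
  qed
  have invC: "inv\<^bsub>A\<^esub> u \<in> C" if "u \<in> C" for u
    using that N by (auto simp: C_def) (metis A.inv_inv subgroup.m_inv_closed)
  have mulC: "u \<otimes>\<^bsub>A\<^esub> h \<in> N" if "u \<in> C" "h \<in> C" for u h
    using that idx by (simp add: C_def)
  \<comment> \<open>The part over \<open>N\<close> of the correlation of \<open>y\<close>. For
    \<open>u\<close> outside \<open>N\<close> the part over the complement is \<open>w\<close> at
    the inverse of \<open>u\<close>, so unitarity makes \<open>w\<close> invariant under
    inversion.\<close>
  define w where "w u = (\<Sum>h\<in>N. y h * y (u \<otimes>\<^bsub>A\<^esub> h))" for u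
  have NC: "carrier A = N \<union> C" "N \<inter> C = {}" using NA by (auto simp: C_def)
  define s where "s = (\<Sum>h\<in>N. y h)"
  have "s + (\<Sum>u\<in>C. y u) = 1"
    using y fin' NC unfolding US_def s_def by (simp add: sum.union_disjoint)
  then have sC: "(\<Sum>u\<in>C. y u) = 1 + s"
    by (metis add.commute add_self_left)
  have "s * (1 + s) = (\<Sum>h\<in>N. \<Sum>u\<in>C. y h * y u)"
    unfolding sC[symmetric] unfolding s_def by (rule sum_product)
  also have "\<dots> = (\<Sum>h\<in>N. \<Sum>u\<in>C. y h * y (u \<otimes>\<^bsub>A\<^esub> h))"
  proof (rule sum.cong[OF HOL.refl])
    fix h assume h: "h \<in> N"
    show "(\<Sum>u\<in>C. y h * y u) = (\<Sum>u\<in>C. y h * y (u \<otimes>\<^bsub>A\<^esub> h))"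
    proof (rule sum.reindex_bij_witness[where i = "\<lambda>u. u \<otimes>\<^bsub>A\<^esub> h" and j = "\<lambda>u. u \<otimes>\<^bsub>A\<^esub> inv\<^bsub>A\<^esub> h"])
      show "u \<otimes>\<^bsub>A\<^esub> inv\<^bsub>A\<^esub> h \<in> C" if "u \<in> C" for u
        using that h N mulN by (simp add: subgroup.m_inv_closed)
    qed (use h NA mulN in \<open>auto simp: A.m_assoc C_def\<close>)
  qed
  also have "\<dots> = (\<Sum>u\<in>C. w u)"
    unfolding w_def by (rule sum.swap)
  also have "\<dots> = (\<Sum>u | u \<in> C \<and> inv\<^bsub>A\<^esub> u = u. w u)"
  proof (rule sum_involution[OF fin'(2)])
    fix u assume u: "u \<in> C"
    then have uA: "u \<in> carrier A" "u \<noteq> \<one>\<^bsub>A\<^esub>"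
      using N by (auto simp: C_def subgroup.one_closed)
    have "0 = corr A y u" using y uA by (simp add: US_def)
    also have "\<dots> = w u + (\<Sum>h\<in>C. y h * y (u \<otimes>\<^bsub>A\<^esub> h))"
      using fin' NC unfolding cross_def w_def by (simp add: sum.union_disjoint)
    also have "(\<Sum>h\<in>C. y h * y (u \<otimes>\<^bsub>A\<^esub> h)) = w (inv\<^bsub>A\<^esub> u)"
      unfolding w_def
    proof (rule sum.reindex_bij_witness[where i = "\<lambda>h. inv\<^bsub>A\<^esub> u \<otimes>\<^bsub>A\<^esub> h" and j = "\<lambda>h. u \<otimes>\<^bsub>A\<^esub> h"])
      fix h assume h: "h \<in> C"
      then have hA: "h \<in> carrier A" by (simp add: C_def)
      show "inv\<^bsub>A\<^esub> u \<otimes>\<^bsub>A\<^esub> (u \<otimes>\<^bsub>A\<^esub> h) = h" using hA uA by (simp add: A.m_assoc[symmetric])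
      show "u \<otimes>\<^bsub>A\<^esub> h \<in> N" using u h by (rule mulC)
      show "y (u \<otimes>\<^bsub>A\<^esub> h) * y (inv\<^bsub>A\<^esub> u \<otimes>\<^bsub>A\<^esub> (u \<otimes>\<^bsub>A\<^esub> h)) = y h * y (u \<otimes>\<^bsub>A\<^esub> h)"
        using hA uA by (simp add: A.m_assoc[symmetric] mult.commute)
    next
      fix h assume h: "h \<in> N"
      then have hA: "h \<in> carrier A" using NA by blast
      show "u \<otimes>\<^bsub>A\<^esub> (inv\<^bsub>A\<^esub> u \<otimes>\<^bsub>A\<^esub> h) = h" using hA uA by (simp add: A.m_assoc[symmetric])
      show "inv\<^bsub>A\<^esub> u \<otimes>\<^bsub>A\<^esub> h \<in> C" using invC[OF u] h by (rule mulN)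
    qed
    finally show "w (inv\<^bsub>A\<^esub> u) = w u" by simp
  qed (use invC in \<open>auto simp: C_def\<close>)
  also have "{u \<in> C. inv\<^bsub>A\<^esub> u = u} = T"
    unfolding T C_def[symmetric]
    by (auto simp: C_def) (metis A.r_inv, metis A.inv_equality)
  also have "(\<Sum>t\<in>T. w t) = (\<Sum>t\<in>T. lam y t)"
  proof (rule sum.cong[OF HOL.refl])
    fix t assume t: "t \<in> T"
    then have tC: "t \<in> C" and tA: "t \<in> carrier A" unfolding T C_def by auto
    define y1 where "y1 u = (if u \<in> N then y u else 0)" for u
    define y2 where "y2 u = (if u \<in> C then y u else 0)" for u
    have sy: "supp_in A y1" "supp_in A y2" using NC by (auto simp: y1_def y2_def supp_in_def)
    have yy: "y = (\<lambda>u. y1 u + y2 u)"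
      using y NC by (auto simp: y1_def y2_def US_def supp_in_def fun_eq_iff)
    obtain g where g: "g \<in> carrier G" "g \<otimes> g = c" "t = p g" using t T_cases by blast
    \<comment> \<open>If \<open>t\<close> moves \<open>D\<close> off itself, the lift has no pair
      \<open>h\<close>, \<open>g h\<close> in its support, so \<open>lam\<close> vanishes. This
      applies to \<open>N\<close> and to its complement, and only the polar form between the two
      parts is left.\<close>
    have lam0: "lam (\<lambda>u. if u \<in> D then y u else 0) t = 0"
      if D: "D \<subseteq> carrier A" "\<And>h. h \<in> D \<Longrightarrow> t \<otimes>\<^bsub>A\<^esub> h \<notin> D" for D
    proof -
      let ?z = "\<lambda>u. if u \<in> D then y u else 0"
      have s: "supp_in A ?z" using D by (auto simp: supp_in_def)
      have "lift ?z h * lift ?z (g \<otimes> h) = 0" if "h \<in> carrier G" for h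
      proof -
        have "p (g \<otimes> h) \<notin> D" if "p h \<in> D" using D(2)[OF that] \<open>h \<in> carrier G\<close> g by simp
        then show ?thesis by (auto simp: lift_def simp del: p.hom_mult)
      qed
      then have "corr G (lift ?z) g = 0" unfolding cross_def by (intro sum.neutral) blast
      then show ?thesis using lam_push[OF g(1,2), of "lift ?z"] push_lift[OF s] g by simp
    qed
    have "lam y1 t = 0"
      using lam0[OF NA] mulN[OF tC] by (simp add: y1_def[abs_def] C_def)
    moreover have "lam y2 t = 0"
      using lam0[of C] mulC[OF tC] by (simp add: y2_def[abs_def] C_def)
    moreover have "cross A y1 y2 t = w t"
    proof -
      have "cross A y1 y2 t = (\<Sum>h\<in>N. y1 h * y2 (t \<otimes>\<^bsub>A\<^esub> h))"
        unfolding cross_def using NA A.fin by (intro sum.mono_neutral_right) (auto simp: y1_def)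
      then show ?thesis
        using mulN[OF tC] by (auto simp: w_def y1_def y2_def intro!: sum.cong)
    qed
    ultimately show "w t = lam y t"
      using lam_add[OF sy t] yy by simp
  qed
  finally have "(\<Sum>t\<in>T. lam y t) = s^2 + s"
    by (simp add: distrib_left power2_eq_square add.commute)
  then show ?thesis by (auto simp: artin_schreier_def)
qed

text \<open>Take \<open>y = b + (1 + b) t\<close>. As \<open>t\<close> is an involution, the mixed
  terms coincide and \<open>y y^* = b^2 + (1 + b)^2 = 1\<close>; the polar form gives
  \<open>b (1 + b)\<close> at \<open>t\<close>.\<close>

lemma single_artin_schreier:
  assumes t: "t \<in> T" and a: "a \<in> artin_schreier"
  shows "single t a \<in> lam_image"
proof -
  obtain b where b: "a = b^2 + b" using a by (auto simp: artin_schreier_def)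
  define y where "y = (\<lambda>u. b * delta \<one>\<^bsub>A\<^esub> u + (1 + b) * delta t u)"
  have tA: "t \<in> carrier A" "t \<noteq> \<one>\<^bsub>A\<^esub>" "t \<otimes>\<^bsub>A\<^esub> t = \<one>\<^bsub>A\<^esub>"
    using t T_carrier one_notin_T T_sq by auto
  have sd: "supp_in A (\<lambda>u. e * delta l u)" if "l \<in> carrier A" for e :: 'f and l
    using that by (auto simp: supp_in_def delta_def)
  have "(\<Sum>u\<in>carrier A. e * delta l u) = e" if "l \<in> carrier A" for e :: 'f and l
    using that A.fin by (simp add: delta_def sum_distrib_left[symmetric])
  then have "(\<Sum>u\<in>carrier A. y u) = 1"
    using tA by (simp add: y_def sum.distrib add.left_commute)
  moreover have "corr A y u = 0" if u: "u \<in> carrier A" "u \<noteq> \<one>\<^bsub>A\<^esub>" for u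
  proof -
    have "u \<otimes>\<^bsub>A\<^esub> t = \<one>\<^bsub>A\<^esub> \<longleftrightarrow> u = t"
      using u tA by (metis A.inv_equality)
    then show ?thesis
      unfolding y_def A.cross_add_left A.cross_add_right using u tA
      by (simp add: A.cross_delta) (simp add: delta_def mult.commute)
  qed
  moreover have "supp_in A y"
    using tA by (auto simp: supp_in_def y_def delta_def)
  ultimately have y: "y \<in> US A" by (simp add: US_def)
  have "lam y = single t a"
  proof
    fix r
    show "lam y r = single t a r"
    proof (cases "r \<in> T")
      case True
      then have rA: "r \<in> carrier A" using T_carrier by auto
      have "lam y r = cross A (\<lambda>u. b * delta \<one>\<^bsub>A\<^esub> u) (\<lambda>u. (1 + b) * delta t u) r"
        unfolding y_def using lam_add[OF sd sd True] tA by (simp add: lam_delta)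
      also have "\<dots> = single t a r"
        using rA by (simp add: A.cross_delta) (simp add: delta_def single_def b distrib_left power2_eq_square add.commute)
      finally show ?thesis .
    qed (use t in \<open>auto simp: lam_outside single_def\<close>)
  qed
  then show ?thesis using y unfolding lam_image_def by (metis image_eqI)
qed

text \<open>A product of two elements of \<open>T\<close> lies in \<open>N\<close>, hence not in
  \<open>T\<close>, so the unit \<open>1 + a (t0 + t)\<close> has no quadratic term and adds
  \<open>a\<close> at both \<open>t0\<close> and \<open>t\<close>. Together with the Artin-Schreier
  values at \<open>t0\<close> these fill the subgroup allowed by
  \<open>sum_lam_artin_schreier\<close>.\<close>

lemma card_lam_image_index2:
  assumes N: "subgroup N A" and idx: "\<And>u v. u \<in> carrier A - N \<Longrightarrow> v \<in> carrier A - N \<Longrightarrow> u \<otimes>\<^bsub>A\<^esub> v \<in> N"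
    and T: "T = {t \<in> carrier A - N. t \<otimes>\<^bsub>A\<^esub> t = \<one>\<^bsub>A\<^esub>}" and t0: "t0 \<in> T"
  shows "2 * card lam_image = card (UNIV :: 'f set) ^ card T"
proof -
  let ?P = "{f :: 'h \<Rightarrow> 'f. (\<forall>t. t \<notin> T \<longrightarrow> f t = 0) \<and> (\<Sum>t\<in>T. f t) \<in> artin_schreier}"
  have pair: "(\<lambda>u. single t0 a u + single t a u) \<in> lam_image" if t: "t \<in> T" "t \<noteq> t0" for t a
  proof -
    have "t0 \<otimes>\<^bsub>A\<^esub> t \<in> N" using idx t t0 T by auto
    then have nT: "t0 \<otimes>\<^bsub>A\<^esub> t \<notin> T" using T by auto
    have tA: "t \<in> carrier A" "t0 \<in> carrier A" "inv\<^bsub>A\<^esub> t = t"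
      using t t0 T_carrier T_sq[OF t(1)] by (auto simp: A.inv_equality)
    then have "(\<lambda>u. if u \<in> T then a * delta t0 u + a * delta t u
        + (if u = t0 \<otimes>\<^bsub>A\<^esub> t then a^2 else 0) else 0) \<in> lam_image"
      using special_unit[of t0 t a] T_sq t t0 unfolding tA(3) by simp
    also have "(\<lambda>u. if u \<in> T then a * delta t0 u + a * delta t u
        + (if u = t0 \<otimes>\<^bsub>A\<^esub> t then a^2 else 0) else 0) = (\<lambda>u. single t0 a u + single t a u)"
      using t t0 nT by (auto simp: single_def delta_def fun_eq_iff)
    finally show ?thesis .
  qed
  have "lam_image = ?P"
  proof (intro equalityI subsetI)
    fix f assume f: "f \<in> ?P"
    define T' where "T' = T - {t0}"
    have T': "finite T'" "T = insert t0 T'" "t0 \<notin> T'" using finite_T t0 by (auto simp: T'_def)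
    have "f = (\<lambda>u. single t0 (\<Sum>t\<in>T. f t) u + (\<Sum>t\<in>T'. single t0 (f t) u + single t (f t) u))"
    proof
      fix u
      have "(\<Sum>t\<in>T'. single t0 (f t) u) = single t0 (\<Sum>t\<in>T'. f t) u"
        by (simp add: single_def)
      moreover have "(\<Sum>t\<in>T'. single t (f t) u) = (if u \<in> T' then f u else 0)"
        using T' by (simp add: single_def)
      moreover have "(\<Sum>t\<in>T. f t) = f t0 + (\<Sum>t\<in>T'. f t)" using T' by simp
      ultimately show "f u = single t0 (\<Sum>t\<in>T. f t) u + (\<Sum>t\<in>T'. single t0 (f t) u + single t (f t) u)"
        using f T' by (auto simp: sum.distrib single_def add.assoc)
    qed
    moreover have "(\<lambda>u. single t0 (\<Sum>t\<in>T. f t) u + (\<Sum>t\<in>T'. single t0 (f t) u + single t (f t) u)) \<in> lam_image"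
    proof (rule lam_image_add)
      show "single t0 (\<Sum>t\<in>T. f t) \<in> lam_image"
        using f t0 single_artin_schreier by blast
      show "(\<lambda>u. \<Sum>t\<in>T'. single t0 (f t) u + single t (f t) u) \<in> lam_image"
        using T' pair by (intro sum_lam_image) auto
    qed
    ultimately show "f \<in> lam_image" by simp
  next
    fix f assume "f \<in> lam_image"
    then show "f \<in> ?P"
      using sum_lam_artin_schreier[OF N idx T] by (auto simp: lam_image_def lam_outside)
  qed
  \<comment> \<open>Coordinates on this subgroup: the values off \<open>t0\<close>, which are free,
    and the total sum, which is restricted.\<close>
  moreover have "bij_betw (\<lambda>f. (restrict f (T - {t0}), \<Sum>t\<in>T. f t)) ?P
      (((T - {t0}) \<rightarrow>\<^sub>E UNIV) \<times> artin_schreier)"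
  proof -
    define ext where "ext f s = (\<lambda>t. if t = t0 then s + (\<Sum>t\<in>T - {t0}. f t) else if t \<in> T then f t else 0)"
      for f :: "'h \<Rightarrow> 'f" and s
    have ins: "sum h T = h t0 + sum h (T - {t0})" for h :: "'h \<Rightarrow> 'f"
      using finite_T t0 by (rule sum.remove)
    have sum_ext: "sum (ext f s) T = s" for f s
    proof -
      have "sum (ext f s) (T - {t0}) = sum f (T - {t0})"
        by (rule sum.cong) (auto simp: ext_def)
      then show ?thesis unfolding ins[of "ext f s"] by (simp add: ext_def add.assoc)
    qed
    have 1: "ext (restrict f (T - {t0})) (sum f T) = f" if f: "f \<in> ?P" for f
    proof
      fix t
      have "sum (restrict f (T - {t0})) (T - {t0}) = sum f (T - {t0})"
        by (rule sum.cong) auto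
      then show "ext (restrict f (T - {t0})) (sum f T) t = f t"
        using f ins[of f] by (auto simp: ext_def add.assoc)
    qed
    have 2: "restrict (ext f s) (T - {t0}) = f" if "f \<in> (T - {t0}) \<rightarrow>\<^sub>E UNIV" for f s
      using that by (auto simp: ext_def PiE_def extensional_def restrict_def fun_eq_iff)
    have 3: "ext f s \<in> ?P" if "s \<in> artin_schreier" for f s
    proof -
      have "ext f s t = 0" if "t \<notin> T" for t using that t0 by (auto simp: ext_def)
      then show ?thesis using that sum_ext[of f s] by simp
    qed
    show ?thesis
    proof (rule bij_betw_byWitness[where f' = "\<lambda>(f, s). ext f s"])
      show "\<forall>f\<in>?P. (case (restrict f (T - {t0}), sum f T) of (f, s) \<Rightarrow> ext f s) = f"
        using 1 by simp
      show "\<forall>x\<in>((T - {t0}) \<rightarrow>\<^sub>E UNIV) \<times> artin_schreier.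
          (restrict (case x of (f, s) \<Rightarrow> ext f s) (T - {t0}), sum (case x of (f, s) \<Rightarrow> ext f s) T) = x"
        using 2 sum_ext by auto
      show "(\<lambda>f. (restrict f (T - {t0}), sum f T)) ` ?P \<subseteq> ((T - {t0}) \<rightarrow>\<^sub>E UNIV) \<times> artin_schreier"
        by (auto split: if_splits)
      show "(\<lambda>(f, s). ext f s) ` (((T - {t0}) \<rightarrow>\<^sub>E UNIV) \<times> artin_schreier) \<subseteq> ?P"
        using 3 by force
    qed
  qed
  ultimately have "card lam_image = card (((T - {t0}) \<rightarrow>\<^sub>E (UNIV :: 'f set)) \<times> artin_schreier)"
    by (simp add: bij_betw_same_card)
  also have "\<dots> = card (UNIV :: 'f set) ^ (card T - 1) * card artin_schreier"
    using finite_T t0 by (simp add: card_cartesian_product card_PiE)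
  finally have "2 * card lam_image = card (UNIV :: 'f set) ^ (card T - 1) * (2 * card artin_schreier)"
    by simp
  then have "2 * card lam_image = card (UNIV :: 'f set) ^ (card T - 1) * card (UNIV :: 'f set)"
    unfolding card_artin_schreier .
  moreover have "card T \<noteq> 0"
    using finite_T t0 by auto
  ultimately show ?thesis
    by (cases "card T") auto
qed

end

section \<open>Abelian groups\<close>

lemma card_finite_support:
  assumes "finite S"
  shows "card {f :: 'a \<Rightarrow> 'f::{field, finite}. \<forall>t. t \<notin> S \<longrightarrow> f t = 0} = card (UNIV :: 'f set) ^ card S"
proof -
  have "bij_betw (\<lambda>f. restrict f S) {f :: 'a \<Rightarrow> 'f. \<forall>t. t \<notin> S \<longrightarrow> f t = 0} (S \<rightarrow>\<^sub>E UNIV)"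
    by (rule bij_betw_byWitness[where f' = "\<lambda>f t. if t \<in> S then f t else 0"])
      (auto simp: fun_eq_iff PiE_def extensional_def)
  then show ?thesis
    using assms by (simp add: bij_betw_same_card card_PiE)
qed

context fin_group2
begin

text \<open>That is, \<open>|V\<^sub>*(FG)| = \<theta> |F|\<close> to the power \<open>(|G| + |\<Omega>\<^sub>1(G)|) / 2 - 1\<close>, without subtraction.\<close>

definition has_theta :: "nat \<Rightarrow> bool" where
  "has_theta \<theta> \<longleftrightarrow> card (US G :: (_ \<Rightarrow> 'f) set) * card (UNIV :: 'f set) = \<theta> * card (UNIV :: 'f set) ^ sdim"

text \<open>Here \<open>x^* = x\<close>, so every element of augmentation 1 is unitary. These form
  one of the \<open>|F|\<close> fibres of the augmentation, all of equal size.\<close>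

lemma theta_elementary:
  assumes sq: "\<And>g. g \<in> carrier G \<Longrightarrow> g \<otimes> g = \<one>"
  shows "has_theta 1"
proof -
  let ?S = "{x :: _ \<Rightarrow> 'f. supp_in G x}"
  let ?tot = "\<lambda>x :: _ \<Rightarrow> 'f. \<Sum>h\<in>carrier G. x h"
  have US: "US G = {x \<in> ?S. ?tot x = 1}"
    using sq corr_involution by (auto simp: US_def)
  have tot: "?tot (\<lambda>h. x h + a * delta \<one> h) = ?tot x + a" for x a
    using fin by (simp add: sum.distrib delta_def sum_distrib_left[symmetric])
  have supp: "supp_in G (\<lambda>h. x h + a * delta \<one> h)" if "supp_in G x" for x and a :: 'f
    using that by (auto simp: supp_in_def delta_def)
  have fib: "card {x \<in> ?S. ?tot x = a} = card (US G :: (_ \<Rightarrow> 'f) set)" for a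
  proof -
    have "bij_betw (\<lambda>x h. x h + (1 + a) * delta \<one> h) {x \<in> ?S. ?tot x = a} (US G)"
      unfolding US
      by (rule bij_betw_byWitness[where f' = "\<lambda>x h. x h + (1 + a) * delta \<one> h"])
        (auto simp: tot supp add.assoc add.commute add.left_commute)
    then show ?thesis by (simp add: bij_betw_same_card)
  qed
  have surj: "?tot ` ?S = UNIV"
  proof -
    have "?tot (\<lambda>h. a * delta \<one> h) = a" "supp_in G (\<lambda>h. a * delta \<one> h)" for a
      using tot[of "\<lambda>_. 0" a] supp[of "\<lambda>_. 0" a] by (simp_all add: supp_in_def)
    then show ?thesis by (auto simp: image_iff) (metis mem_Collect_eq)
  qed
  have "card ?S = (\<Sum>a\<in>?tot ` ?S. card {x \<in> ?S. ?tot x = a})"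
    using sum.image_gen[OF finite_supp, of "\<lambda>_. 1 :: nat" ?tot] by simp
  then have "card ?S = card (UNIV :: 'f set) * card (US G :: (_ \<Rightarrow> 'f) set)"
    unfolding surj fib by simp
  moreover have "card ?S = card (UNIV :: 'f set) ^ card (carrier G)"
    unfolding supp_in_def by (rule card_finite_support[OF fin])
  moreover have "{u \<in> carrier G. u \<otimes> u = \<one>} = carrier G" using sq by auto
  then have "sdim = card (carrier G)" by (simp add: sdim_def)
  ultimately show ?thesis by (simp add: has_theta_def mult.commute)
qed

text \<open>Pulling back along \<open>f\<close> is injective. The inequality is enough, since it
  applies to the inverse isomorphism as well.\<close>

lemma card_US_le_iso:
  assumes H: "fin_group2 TYPE('f) H" and f: "f \<in> iso G H"
  shows "card (US H :: (_ \<Rightarrow> 'f) set) \<le> card (US G :: (_ \<Rightarrow> 'f) set)"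
proof -
  interpret H: fin_group2 H "TYPE('f)" by (rule H)
  have hom: "f \<in> hom G H" and bij: "bij_betw f (carrier G) (carrier H)"
    using f by (auto simp: iso_def)
  define \<phi> where "\<phi> y g = (if g \<in> carrier G then y (f g) else 0)" for y :: "_ \<Rightarrow> 'f" and g
  have f_in: "f g \<in> carrier H" if "g \<in> carrier G" for g using hom that by (rule hom_in_carrier)
  have f1: "f g = \<one>\<^bsub>H\<^esub> \<longleftrightarrow> g = \<one>" if "g \<in> carrier G" for g
  proof -
    have "f \<one> = \<one>\<^bsub>H\<^esub>" using hom_one[OF hom is_group H.is_group] .
    then show ?thesis
      using that bij by (metis bij_betw_imp_inj_on inj_onD one_closed)
  qed
  show ?thesis
  proof (rule card_inj_on_le[of \<phi>])
    show "inj_on \<phi> (US H)"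
    proof (rule inj_onI)
      fix y z assume yz: "y \<in> US H" "z \<in> US H" "\<phi> y = \<phi> z"
      have "y u = z u" for u
      proof (cases "u \<in> carrier H")
        case True
        then obtain g where "g \<in> carrier G" "u = f g" using bij by (auto simp: bij_betw_def)
        then show ?thesis using fun_cong[OF yz(3), of g] by (simp add: \<phi>_def)
      next
        case False
        then show ?thesis using yz by (simp add: US_def supp_in_def)
      qed
      then show "y = z" by auto
    qed
    show "\<phi> ` US H \<subseteq> US G"
    proof
      fix x assume "x \<in> \<phi> ` US H"
      then obtain y where y: "y \<in> US H" and x: "x = \<phi> y" by auto
      have "cross G x x g = cross H y y (f g)" if g: "g \<in> carrier G" for g
      proof -
        have "cross H y y (f g) = (\<Sum>h\<in>carrier G. y (f h) * y (f g \<otimes>\<^bsub>H\<^esub> f h))"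
          unfolding cross_def by (rule sum.reindex_bij_betw[OF bij, symmetric])
        also have "\<dots> = cross G x x g"
          using g hom by (auto simp: cross_def x \<phi>_def hom_mult intro!: sum.cong)
        finally show ?thesis ..
      qed
      moreover have "(\<Sum>h\<in>carrier G. x h) = (\<Sum>h\<in>carrier H. y h)"
        unfolding sum.reindex_bij_betw[OF bij, symmetric] by (rule sum.cong) (auto simp: x \<phi>_def)
      ultimately show "x \<in> US G"
        using y f_in f1 by (auto simp: US_def x \<phi>_def supp_in_def)
    qed
  qed (rule finite_US)
qed

lemma card_involutions_iso:
  assumes H: "group H" and f: "f \<in> iso G H"
  shows "card {u \<in> carrier H. u \<otimes>\<^bsub>H\<^esub> u = \<one>\<^bsub>H\<^esub>} = card {u \<in> carrier G. u \<otimes> u = \<one>}"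
proof -
  interpret H: group H by (rule H)
  have hom: "f \<in> hom G H" and bij: "bij_betw f (carrier G) (carrier H)"
    using f by (auto simp: iso_def)
  have f1: "f g = \<one>\<^bsub>H\<^esub> \<longleftrightarrow> g = \<one>" if "g \<in> carrier G" for g
  proof -
    have "f \<one> = \<one>\<^bsub>H\<^esub>" using hom_one[OF hom is_group H.is_group] .
    then show ?thesis
      using that bij by (metis bij_betw_imp_inj_on inj_onD one_closed)
  qed
  have sq: "f u \<otimes>\<^bsub>H\<^esub> f u = \<one>\<^bsub>H\<^esub> \<longleftrightarrow> u \<otimes> u = \<one>" if "u \<in> carrier G" for u
    using that f1[of "u \<otimes> u"] hom by (simp add: hom_mult)
  have "bij_betw f {u \<in> carrier G. u \<otimes> u = \<one>} {u \<in> carrier H. u \<otimes>\<^bsub>H\<^esub> u = \<one>\<^bsub>H\<^esub>}"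
  proof (rule bij_betw_imageI)
    show "inj_on f {u \<in> carrier G. u \<otimes> u = \<one>}"
      using bij by (auto simp: bij_betw_def intro: inj_on_subset)
    show "f ` {u \<in> carrier G. u \<otimes> u = \<one>} = {u \<in> carrier H. u \<otimes>\<^bsub>H\<^esub> u = \<one>\<^bsub>H\<^esub>}"
      using bij sq by (auto simp: bij_betw_def image_iff set_eq_iff) metis+
  qed
  then show ?thesis by (simp add: bij_betw_same_card)
qed

lemma theta_iso:
  assumes H: "fin_group2 TYPE('f) H" and f: "f \<in> iso G H" and t: "has_theta \<theta>"
  shows "fin_group2.has_theta TYPE('f) H \<theta>"
proof -
  interpret H: fin_group2 H "TYPE('f)" by (rule H)
  have "inv_into (carrier G) f \<in> iso H G" using f by (rule iso_set_sym)
  then have "card (US G :: (_ \<Rightarrow> 'f) set) = card (US H :: (_ \<Rightarrow> 'f) set)"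
    using card_US_le_iso[OF H f] H.card_US_le_iso[OF fin_group2_axioms] by (meson le_antisym)
  moreover have "H.sdim = sdim"
    unfolding sdim_def H.sdim_def card_involutions_iso[OF H.is_group f]
    using f by (auto simp: iso_def bij_betw_same_card)
  ultimately show ?thesis
    using t by (simp add: has_theta_def H.has_theta_def)
qed

end

context central_ext
begin

text \<open>Counting roots gives \<open>2 * A.sdim = sdim + card T\<close>. Inserted into
  \<open>card_US_ext\<close> this leaves \<open>|F|^|T|\<close> divided by the size of the image,
  which is \<open>d\<close>.\<close>

lemma theta_ext:
  assumes "A.has_theta \<theta>" and "d * card lam_image = card (UNIV :: 'f set) ^ card T"
  shows "has_theta (d * \<theta>)"
proof -
  let ?q = "card (UNIV :: 'f set)"
  have "card {g \<in> carrier G. g \<otimes> g = \<one>} + 2 * card T = 2 * card {u \<in> carrier A. u \<otimes>\<^bsub>A\<^esub> u = \<one>\<^bsub>A\<^esub>}"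
    using card_roots_both card_roots by simp
  then have s: "2 * A.sdim = sdim + card T"
    using sdim A.sdim order_ext by simp
  have q: "?q > 0" by (simp add: card_gt_0_iff)
  have L: "card lam_image > 0"
    using assms(2) q by (metis gr0I mult_0_right power_not_zero less_numeral_extra(3))
  have "card lam_image * (card (US G :: ('g \<Rightarrow> 'f) set) * ?q) = card (US A :: ('h \<Rightarrow> 'f) set) * ?q * ?q ^ A.sdim"
    using card_US_ext by (metis mult.assoc mult.commute)
  also have "\<dots> = \<theta> * ?q ^ (2 * A.sdim)"
    using assms(1) by (simp add: A.has_theta_def mult_2 power_add)
  also have "\<dots> = card lam_image * (d * \<theta> * ?q ^ sdim)"
    unfolding s power_add assms(2)[symmetric] by simp
  finally show ?thesis
    using L by (simp add: has_theta_def)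
qed

end

section \<open>Adjoining a cyclic direct factor\<close>

lemma central_ext_cyclic:
  assumes N: "fin_group2 TYPE('f) N" "comm_group N"
  shows "central_ext TYPE('f::{field,finite}) (integer_mod_group (2 ^ Suc i) \<times>\<times> N) (integer_mod_group (2 ^ i) \<times>\<times> N)
    (\<lambda>(x, b). (x mod 2 ^ i, b)) (2 ^ i, \<one>\<^bsub>N\<^esub>)"
proof -
  interpret N: fin_group2 N "TYPE('f)" by (rule N(1))
  interpret N: comm_group N by (rule N(2))
  have grp: "group (integer_mod_group j \<times>\<times> N)" for j
    by (intro DirProd_group group_integer_mod_group N.is_group)
  interpret G: group "integer_mod_group (2 ^ Suc i) \<times>\<times> N" by (rule grp)
  interpret A: group "integer_mod_group (2 ^ i) \<times>\<times> N" by (rule grp)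
  have comm: "comm_group (integer_mod_group (2 ^ i) \<times>\<times> N)"
    by (rule A.group_comm_groupI) (auto simp: N.m_comm add.commute)
  have modmod: "(x mod (2 * 2 ^ i)) mod 2 ^ i = x mod (2 ^ i :: int)" for x
    by (simp add: mod_mod_cancel)
  have ker: "2 ^ i dvd x \<longleftrightarrow> x = 0 \<or> x = 2 ^ i" if "0 \<le> x" "x < 2 * 2 ^ i" for x :: int
  proof
    assume "2 ^ i dvd x"
    then obtain y where y: "x = 2 ^ i * y" by (auto simp: dvd_def)
    have "0 \<le> y" using that y by (simp add: zero_le_mult_iff)
    moreover have "y < 2" using that y by (simp add: mult.commute)
    ultimately have "y = 0 \<or> y = 1" by linarith
    then show "x = 0 \<or> x = 2 ^ i" using y by auto
  qed auto
  show ?thesis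
  proof (intro central_ext.intro fin_group2.intro fin_group.intro central_ext_axioms.intro grp comm
      fin_group_axioms.intro)
    show "finite (carrier (integer_mod_group (2 ^ Suc i) \<times>\<times> N))"
      using N.fin by (simp add: carrier_integer_mod_group)
    show "char2 TYPE('f)" by (rule N.char2_axioms)
    show "(\<lambda>(x, b). (x mod 2 ^ i, b)) \<in> hom (integer_mod_group (2 ^ Suc i) \<times>\<times> N) (integer_mod_group (2 ^ i) \<times>\<times> N)"
      by (rule homI) (auto simp: carrier_integer_mod_group modmod mod_add_eq)
    show "(\<lambda>(x, b). (x mod 2 ^ i, b)) ` carrier (integer_mod_group (2 ^ Suc i) \<times>\<times> N)
        = carrier (integer_mod_group (2 ^ i) \<times>\<times> N)"
    proof (intro equalityI subsetI)
      fix u assume "u \<in> carrier (integer_mod_group (2 ^ i) \<times>\<times> N)"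
      then show "u \<in> (\<lambda>(x, b). (x mod 2 ^ i, b)) ` carrier (integer_mod_group (2 ^ Suc i) \<times>\<times> N)"
        by (intro image_eqI[of _ _ u]) (auto simp: carrier_integer_mod_group)
    qed (auto simp: carrier_integer_mod_group)
  qed (use ker in \<open>auto simp: carrier_integer_mod_group\<close>)
qed

definition theta :: "('g, 'x) monoid_scheme \<Rightarrow> 'f::{field, finite} itself \<Rightarrow> nat \<Rightarrow> bool" where
  "theta G F \<theta> \<longleftrightarrow> fin_group2 F G \<and> comm_group G \<and> fin_group2.has_theta F G \<theta>"

text \<open>The factor 2 appears at one step only. From order 1 to 2 the new involution
  \<open>c\<close> has no square root and \<open>T\<close> is empty. From order 2 to 4,
  \<open>T\<close> consists of the involutions outside the factor \<open>N\<close>, and the index is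
  2. Later \<open>c\<close> always has a root that is itself a square.\<close>

lemma theta_cyclic_prod:
  assumes N: "theta N TYPE('f::{field,finite}) \<theta>"
  shows "theta (integer_mod_group (2 ^ i) \<times>\<times> N) TYPE('f) ((if i \<ge> 2 then 2 else 1) * \<theta>)"
proof (induction i)
  case 0
  interpret N: fin_group2 N "TYPE('f)" using N by (simp add: theta_def)
  interpret N: comm_group N using N by (simp add: theta_def)
  \<comment> \<open>Interpreted for the facts about its quotient, which is the group of the base
    case.\<close>
  interpret E: central_ext "integer_mod_group (2 ^ Suc 0) \<times>\<times> N" "TYPE('f)" "integer_mod_group (2 ^ 0) \<times>\<times> N"
    "\<lambda>(x, b). (x mod 2 ^ 0, b)" "(2 ^ 0, \<one>\<^bsub>N\<^esub>)"
    using N by (intro central_ext_cyclic) (auto simp: theta_def)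
  have "(\<lambda>b. (0, b)) \<in> iso N (integer_mod_group (2 ^ 0) \<times>\<times> N)"
    by (auto simp: iso_def hom_def bij_betw_def inj_on_def carrier_integer_mod_group)
  then have "fin_group2.has_theta TYPE('f) (integer_mod_group (2 ^ 0) \<times>\<times> N) \<theta>"
    by (rule N.theta_iso[OF E.A.fin_group2_axioms]) (use N in \<open>simp add: theta_def\<close>)
  then show ?case
    using E.A.fin_group2_axioms E.A.comm_group_axioms by (simp add: theta_def)
next
  case (Suc i)
  interpret N: fin_group2 N "TYPE('f)" using N by (simp add: theta_def)
  interpret N: comm_group N using N by (simp add: theta_def)
  let ?G = "integer_mod_group (2 ^ Suc i) \<times>\<times> N" and ?A = "integer_mod_group (2 ^ i) \<times>\<times> N"
  let ?q = "card (UNIV :: 'f set)"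
  interpret E: central_ext ?G "TYPE('f)" ?A "\<lambda>(x, b). (x mod 2 ^ i, b)" "(2 ^ i, \<one>\<^bsub>N\<^esub>)"
    using N by (intro central_ext_cyclic) (auto simp: theta_def)
  have comm: "comm_group ?G"
    by (rule E.group_comm_groupI) (auto simp: N.m_comm add.commute)
  have IH: "E.A.has_theta ((if i \<ge> 2 then 2 else 1) * \<theta>)"
    using Suc by (simp add: theta_def)
  consider "i = 0" | "i = 1" | j where "i = Suc (Suc j)" by (metis One_nat_def not0_implies_Suc)
  then have "E.has_theta ((if Suc i \<ge> 2 then 2 else 1) * \<theta>)"
  proof cases
    case 1
    have "E.T = {}"
      unfolding E.T_def using 1 by (auto simp: carrier_integer_mod_group)
    then have "1 * card E.lam_image = ?q ^ card E.T"
      using E.lam_image_singles by simp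
    from E.theta_ext[OF IH this] show ?thesis using 1 by simp
  next
    case 2
    let ?N = "{0} \<times> carrier N"
    have T: "E.T = {t \<in> carrier ?A - ?N. t \<otimes>\<^bsub>?A\<^esub> t = \<one>\<^bsub>?A\<^esub>}"
    proof (intro equalityI subsetI)
      fix t assume "t \<in> E.T"
      then show "t \<in> {t \<in> carrier ?A - ?N. t \<otimes>\<^bsub>?A\<^esub> t = \<one>\<^bsub>?A\<^esub>}"
        unfolding E.T_def using 2 by (auto simp: carrier_integer_mod_group)
    next
      fix t assume t: "t \<in> {t \<in> carrier ?A - ?N. t \<otimes>\<^bsub>?A\<^esub> t = \<one>\<^bsub>?A\<^esub>}"
      then have "fst t = 1" using 2 by (auto simp: carrier_integer_mod_group)
      then show "t \<in> E.T"
        unfolding E.T_def using 2 t by (intro image_eqI[of _ _ t]) (auto simp: carrier_integer_mod_group)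
    qed
    have "2 * card E.lam_image = ?q ^ card E.T"
    proof (rule E.card_lam_image_index2[OF _ _ T])
      show "subgroup ?N ?A"
        using 2 by unfold_locales (auto simp: carrier_integer_mod_group inv_DirProd)
      show "u \<otimes>\<^bsub>?A\<^esub> v \<in> ?N" if "u \<in> carrier ?A - ?N" "v \<in> carrier ?A - ?N" for u v
      proof -
        have "fst u = 1" "fst v = 1" using that 2 by (auto simp: carrier_integer_mod_group)
        then show ?thesis using that 2 by (cases u, cases v) auto
      qed
      show "(1, \<one>\<^bsub>N\<^esub>) \<in> E.T"
        unfolding T using 2 by (auto simp: carrier_integer_mod_group)
    qed
    from E.theta_ext[OF IH this] show ?thesis using 2 by simp
  next
    case 3
    have "card E.lam_image = ?q ^ card E.T"
    proof (rule E.card_lam_image_square[of "(2 ^ Suc j, \<one>\<^bsub>N\<^esub>)" "(2 ^ j, \<one>\<^bsub>N\<^esub>)"])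
      show "(2 ^ Suc j, \<one>\<^bsub>N\<^esub>) \<in> carrier ?G" "(2 ^ j, \<one>\<^bsub>N\<^esub>) \<in> carrier ?G"
        using 3 by (auto simp: carrier_integer_mod_group)
    qed (use 3 in \<open>auto simp: N.m_comm add.commute\<close>)
    then have "1 * card E.lam_image = ?q ^ card E.T" by simp
    from E.theta_ext[OF IH this] show ?thesis using 3 by simp
  qed
  then show ?case
    using comm E.fin_group2_axioms by (simp add: theta_def)
qed

text \<open>The elementary abelian 2-group with basis \<open>S\<close>. Indexing by subsets lets
  \<open>finprod\<close> serve as the map to any group generated by involutions
  \<open>u s\<close>.\<close>

definition symdiff_group :: "'a set \<Rightarrow> 'a set monoid" where
  "symdiff_group S = \<lparr>carrier = Pow S, monoid.mult = (\<lambda>X Y. (X - Y) \<union> (Y - X)), one = {}\<rparr>"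

lemma comm_group_symdiff: "comm_group (symdiff_group S)"
  by (rule comm_groupI) (auto simp: symdiff_group_def)

lemma theta_symdiff:
  assumes "finite S" "char2 TYPE('f::{field,finite})"
  shows "theta (symdiff_group S) TYPE('f) 1"
proof -
  interpret comm_group "symdiff_group S" by (rule comm_group_symdiff)
  interpret char2 "TYPE('f)" by (rule assms(2))
  interpret fin_group2 "symdiff_group S" "TYPE('f)"
    using assms by unfold_locales (simp add: symdiff_group_def)
  have "has_theta 1"
    by (rule theta_elementary) (auto simp: symdiff_group_def)
  then show ?thesis
    using fin_group2_axioms comm_group_axioms by (simp add: theta_def)
qed

section \<open>The structure of the group\<close>

lemma (in group) hom_integer_mod_group:
  assumes u: "u \<in> carrier G" "u [^] N = \<one>"
  shows "(\<lambda>i. u [^] i) \<in> hom (integer_mod_group N) G"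
proof (rule homI)
  fix i j :: int
  have "u [^] (i + j) = u [^] (int N * ((i + j) div int N) + (i + j) mod int N)" by simp
  also have "\<dots> = u [^] (int N * ((i + j) div int N)) \<otimes> u [^] ((i + j) mod int N)"
    using u by (simp only: int_pow_mult)
  also have "u [^] (int N * ((i + j) div int N)) = (u [^] int N) [^] ((i + j) div int N)"
    using u by (simp add: int_pow_pow)
  also have "\<dots> = \<one>" using u by (simp add: int_pow_int)
  finally have "u [^] (i + j) = u [^] ((i + j) mod int N)" using u by simp
  then show "u [^] (i \<otimes>\<^bsub>integer_mod_group N\<^esub> j) = u [^] i \<otimes> u [^] j"
    using u by (simp add: int_pow_mult)
qed (use u in simp)

text \<open>The factors over \<open>X \<inter> Y\<close> occur twice and cancel because each
  \<open>u s\<close> has square \<one>.\<close>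

lemma (in comm_group) hom_symdiff_group:
  assumes S: "finite S" and u: "\<And>s. s \<in> S \<Longrightarrow> u s \<in> carrier G" "\<And>s. s \<in> S \<Longrightarrow> u s \<otimes> u s = \<one>"
  shows "finprod G u \<in> hom (symdiff_group S) G"
proof (rule homI)
  fix X assume "X \<in> carrier (symdiff_group S)"
  then show "finprod G u X \<in> carrier G"
    using u by (intro finprod_closed) (auto simp: symdiff_group_def)
next
  fix X Y assume "X \<in> carrier (symdiff_group S)" "Y \<in> carrier (symdiff_group S)"
  then have XY: "X \<subseteq> S" "Y \<subseteq> S" by (auto simp: symdiff_group_def)
  have fin: "finite X" "finite Y" using XY S finite_subset by auto
  have cl: "u \<in> Z \<rightarrow> carrier G" if "Z \<subseteq> S" for Z using that u by auto
  let ?D = "X - Y" and ?E = "Y - X" and ?I = "X \<inter> Y"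
  have c: "finprod G u ?D \<in> carrier G" "finprod G u ?E \<in> carrier G" "finprod G u ?I \<in> carrier G"
    using XY cl by (auto intro!: finprod_closed)
  have "finprod G u ?I \<otimes> finprod G u ?I = finprod G (\<lambda>s. u s \<otimes> u s) ?I"
    using XY cl by (intro finprod_multf[symmetric]) auto
  also have "\<dots> = \<one>"
    using XY u by (intro finprod_one_eqI) auto
  finally have I: "finprod G u ?I \<otimes> finprod G u ?I = \<one>" .
  have "finprod G u X = finprod G u (?D \<union> ?I)" by (rule arg_cong[of _ _ "finprod G u"]) auto
  also have "\<dots> = finprod G u ?D \<otimes> finprod G u ?I"
    using fin XY cl by (intro finprod_Un_disjoint) auto
  finally have X: "finprod G u X = finprod G u ?D \<otimes> finprod G u ?I" .
  have "finprod G u Y = finprod G u (?E \<union> ?I)" by (rule arg_cong[of _ _ "finprod G u"]) auto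
  also have "\<dots> = finprod G u ?E \<otimes> finprod G u ?I"
    using fin XY cl by (intro finprod_Un_disjoint) auto
  finally have Y: "finprod G u Y = finprod G u ?E \<otimes> finprod G u ?I" .
  have "finprod G u (X \<otimes>\<^bsub>symdiff_group S\<^esub> Y) = finprod G u (?D \<union> ?E)"
    by (simp add: symdiff_group_def)
  also have "\<dots> = finprod G u ?D \<otimes> finprod G u ?E"
    using fin XY cl by (intro finprod_Un_disjoint) auto
  also have "\<dots> = finprod G u ?D \<otimes> finprod G u ?E \<otimes> (finprod G u ?I \<otimes> finprod G u ?I)"
    using c by (simp add: I)
  also have "\<dots> = finprod G u X \<otimes> finprod G u Y"
    unfolding X Y using c by (simp add: m_ac)
  finally show "finprod G u (X \<otimes>\<^bsub>symdiff_group S\<^esub> Y) = finprod G u X \<otimes> finprod G u Y" .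
qed

lemma (in group) commute_mult:
  assumes "x \<in> carrier G" "y \<in> carrier G" "g \<in> carrier G" "x \<otimes> g = g \<otimes> x" "y \<otimes> g = g \<otimes> y"
  shows "(x \<otimes> y) \<otimes> g = g \<otimes> (x \<otimes> y)"
  using assms by (metis m_assoc)

lemma (in group) commute_pow:
  assumes "x \<in> carrier G" "g \<in> carrier G" "x \<otimes> g = g \<otimes> x"
  shows "(x [^] (j :: nat)) \<otimes> g = g \<otimes> (x [^] j)"
proof (induction j)
  case (Suc j)
  then show ?case using assms commute_mult[of "x [^] j" x g] by simp
qed (use assms in simp)

text \<open>The other generator of the same \<open>D_8\<close>, the only one that does not commute
  with \<open>w s\<close>.\<close>

definition partner :: "nat \<times> bool \<Rightarrow> nat \<times> bool" where
  "partner s = (fst s, \<not> snd s)"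

text \<open>\<open>w (l, False)\<close> and \<open>w (l, True)\<close> are the generators, of orders 4 and 2, of the \<open>l\<close>-th factor
  \<open>D\<^sub>8\<close>, numbered from 1.\<close>

locale m2_d8_product = group G for G (structure) +
  fixes a b c :: 'a and w :: "nat \<times> bool \<Rightarrow> 'a" and n m k :: nat
  assumes a: "a \<in> carrier G" and b: "b \<in> carrier G" and c: "c \<in> carrier G"
    and w: "\<And>s. s \<in> {1..<k} \<times> UNIV \<Longrightarrow> w s \<in> carrier G"
    and c_neq: "c \<noteq> \<one>" and c_sq: "c \<otimes> c = \<one>"
    and c_central: "\<And>g. g \<in> carrier G \<Longrightarrow> g \<otimes> c = c \<otimes> g"
    and comm_mod: "\<And>g h. g \<in> carrier G \<Longrightarrow> h \<in> carrier G \<Longrightarrow> g \<otimes> h = h \<otimes> g \<or> g \<otimes> h = c \<otimes> (h \<otimes> g)"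
    and a_pow: "a [^] (2 ^ n :: nat) = c" and b_pow: "b [^] (2 ^ Suc m :: nat) = \<one>"
    and ab_ind: "\<And>(i :: nat) (j :: nat). a [^] i \<otimes> b [^] j \<in> {\<one>, c} \<Longrightarrow> 2 ^ Suc m dvd j"
    and w_sq: "\<And>s. s \<in> {1..<k} \<times> UNIV \<Longrightarrow> w s \<otimes> w s \<in> {\<one>, c}"
    and w_ab: "\<And>s. s \<in> {1..<k} \<times> UNIV \<Longrightarrow> a \<otimes> w s = w s \<otimes> a"
      "\<And>s. s \<in> {1..<k} \<times> UNIV \<Longrightarrow> b \<otimes> w s = w s \<otimes> b"
    and w_w: "\<And>s t. s \<in> {1..<k} \<times> UNIV \<Longrightarrow> t \<in> {1..<k} \<times> UNIV \<Longrightarrow>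
      w s \<otimes> w t = w t \<otimes> w s \<longleftrightarrow> t \<noteq> partner s"
    and gen: "carrier G = generate G ({a, b} \<union> w ` ({1..<k} \<times> UNIV))"
    and nmk: "n \<ge> 1" "m \<ge> 1" "k \<ge> 1"
    and w_1: "k \<ge> 2 \<Longrightarrow> w (1, False) \<otimes> w (1, False) = c" "k \<ge> 2 \<Longrightarrow> w (1, True) \<otimes> w (1, True) = \<one>"
begin

section \<open>The quotient by \<open>c\<close> and coordinates on it\<close>

abbreviation "S \<equiv> {1..<k} \<times> (UNIV :: bool set)"
abbreviation "C \<equiv> {\<one>, c}"

definition Q :: "'a set monoid" where "Q = G Mod C"

definition p :: "'a \<Rightarrow> 'a set" where "p g = C #> g"

lemma subgroup_C: "subgroup C G"
proof
  have "inv c = c" using c c_sq by (rule_tac inv_equality) auto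
  then show "inv x \<in> C" if "x \<in> C" for x using that by auto
qed (use c c_sq in auto)

sublocale C: normal C G
proof (rule normal_invI[OF subgroup_C])
  fix x h assume x: "x \<in> carrier G" "h \<in> C"
  then have "x \<otimes> h = h \<otimes> x" "h \<in> carrier G" using c_central c by auto
  then show "x \<otimes> h \<otimes> inv x \<in> C" using x by (simp add: m_assoc)
qed

lemma p_hom: "p \<in> hom G Q" unfolding p_def[abs_def] Q_def by (rule C.r_coset_hom_Mod)

lemma p_surj: "p ` carrier G = carrier Q" by (auto simp: p_def Q_def carrier_FactGroup)

lemma p_ex: "u \<in> carrier Q \<Longrightarrow> \<exists>g\<in>carrier G. p g = u"
  unfolding p_surj[symmetric] by blast

lemma p_one: "g \<in> carrier G \<Longrightarrow> p g = \<one>\<^bsub>Q\<^esub> \<longleftrightarrow> g = \<one> \<or> g = c"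
  unfolding p_def Q_def using coset_join1[OF _ _ subgroup_C, of g] coset_join2[OF _ subgroup_C, of g] C.subset by auto

lemma group_Q: "group Q" unfolding Q_def by (rule C.factorgroup_is_group)

sublocale p: group_hom G Q p
  by (simp add: group_hom_def group_hom_axioms_def group_Q p_hom is_group)

lemma p_eqD: "g \<in> carrier G \<Longrightarrow> h \<in> carrier G \<Longrightarrow> p g = p h \<Longrightarrow> g = h \<or> g = c \<otimes> h"
proof -
  assume gh: "g \<in> carrier G" "h \<in> carrier G" "p g = p h"
  note gh = gh(1,2) gh(3)[unfolded p_def]
  have "g \<in> C #> h" using gh rcos_self[OF gh(1) subgroup_C] by simp
  then show ?thesis using gh by (auto simp: r_coset_def)
qed

lemma p_c_mult: "g \<in> carrier G \<Longrightarrow> p (c \<otimes> g) = p g"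
  using c p_one[of c] by simp

lemma comm_Q: "comm_group Q"
proof (rule group.group_comm_groupI[OF group_Q])
  fix u v assume "u \<in> carrier Q" "v \<in> carrier Q"
  then obtain g h where g: "g \<in> carrier G" "h \<in> carrier G" "u = p g" "v = p h"
    using p_surj by (metis imageE)
  have "p (g \<otimes> h) = p (h \<otimes> g)"
    using comm_mod[OF g(1,2)] p_c_mult[of "h \<otimes> g"] g by (metis m_closed)
  then show "u \<otimes>\<^bsub>Q\<^esub> v = v \<otimes>\<^bsub>Q\<^esub> u"
    using g by simp
qed

sublocale Q: comm_group Q by (rule comm_Q)

text \<open>Moving \<open>h\<close> past \<open>g\<close> twice produces at most
  \<open>c^2 = \<one>\<close>.\<close>

lemma sq_central:
  assumes "g \<in> carrier G" "h \<in> carrier G"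
  shows "(g \<otimes> g) \<otimes> h = h \<otimes> (g \<otimes> g)"
  using comm_mod[OF assms]
proof
  assume "g \<otimes> h = h \<otimes> g"
  then show ?thesis using assms by (intro commute_mult) auto
next
  assume e: "g \<otimes> h = c \<otimes> (h \<otimes> g)"
  have "(g \<otimes> g) \<otimes> h = g \<otimes> (c \<otimes> (h \<otimes> g))" using assms e by (simp add: m_assoc)
  also have "\<dots> = c \<otimes> ((g \<otimes> h) \<otimes> g)" using assms c c_central[of g] by (metis m_assoc m_closed)
  also have "\<dots> = (c \<otimes> c) \<otimes> (h \<otimes> (g \<otimes> g))" unfolding e using assms c by (simp add: m_assoc)
  finally show ?thesis using assms c_sq by simp
qed

lemma C_commutes:
  assumes "g \<in> carrier G" "h \<in> carrier G" "g \<in> C" shows "g \<otimes> h = h \<otimes> g"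
  using assms c_central by auto

text \<open>The exponent of \<open>a\<close> is taken modulo \<open>2^n\<close>, although
  \<open>a\<close> has order \<open>2^(n+1)\<close>, because \<open>a^(2^n) = c\<close> dies in the
  quotient.\<close>

definition phi :: "int \<times> int \<times> (nat \<times> bool) set \<Rightarrow> 'a set" where
  "phi = (\<lambda>(i, j, X). p a [^]\<^bsub>Q\<^esub> i \<otimes>\<^bsub>Q\<^esub> (p b [^]\<^bsub>Q\<^esub> j \<otimes>\<^bsub>Q\<^esub> finprod Q (\<lambda>s. p (w s)) X))"

abbreviation "M \<equiv> integer_mod_group (2 ^ n) \<times>\<times> (integer_mod_group (2 ^ Suc m) \<times>\<times> symdiff_group S)"

lemma finite_S: "finite S" by simp

lemma group_M: "group M"
  by (intro DirProd_group group_integer_mod_group comm_group.axioms(2)[OF comm_group_symdiff])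

lemma p_pow: "g \<in> carrier G \<Longrightarrow> p (g [^] (j::nat)) = p g [^]\<^bsub>Q\<^esub> j"
  by (rule p.hom_nat_pow)

lemma phi_hom: "phi \<in> hom M Q"
proof -
  have "p a [^]\<^bsub>Q\<^esub> (2 ^ n :: nat) = \<one>\<^bsub>Q\<^esub>"
    using p_pow[OF a, of "2 ^ n"] p_one[OF c] a_pow by simp
  then have 1: "(\<lambda>i. p a [^]\<^bsub>Q\<^esub> i) \<in> hom (integer_mod_group (2 ^ n)) Q"
    using a by (intro p.H.hom_integer_mod_group) auto
  have "p b [^]\<^bsub>Q\<^esub> (2 ^ Suc m :: nat) = \<one>\<^bsub>Q\<^esub>"
    using p_pow[OF b, of "2 ^ Suc m"] p_one[of \<one>] b_pow by (simp del: power_Suc)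
  then have 2: "(\<lambda>i. p b [^]\<^bsub>Q\<^esub> i) \<in> hom (integer_mod_group (2 ^ Suc m)) Q"
    using b by (intro p.H.hom_integer_mod_group) auto
  have 3: "finprod Q (\<lambda>s. p (w s)) \<in> hom (symdiff_group S) Q"
  proof (rule Q.hom_symdiff_group[OF finite_S])
    fix s assume s: "s \<in> S"
    then show "p (w s) \<in> carrier Q" using w[OF s] by (intro p.hom_closed)
    have "p (w s \<otimes> w s) = \<one>\<^bsub>Q\<^esub>" using w_sq[OF s] w[OF s] by (subst p_one) auto
    then show "p (w s) \<otimes>\<^bsub>Q\<^esub> p (w s) = \<one>\<^bsub>Q\<^esub>" using w[OF s] by simp
  qed
  show ?thesis
  proof (rule homI)
    fix u assume "u \<in> carrier M"
    then show "phi u \<in> carrier Q"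
      using hom_in_carrier[OF 1] hom_in_carrier[OF 2] hom_in_carrier[OF 3]
      by (cases u) (auto simp: phi_def)
  next
    fix u v assume uv: "u \<in> carrier M" "v \<in> carrier M"
    obtain i j X where u: "u = (i, j, X)" by (cases u)
    obtain i' j' X' where v: "v = (i', j', X')" by (cases v)
    have ci: "i \<in> carrier (integer_mod_group (2 ^ n))" "i' \<in> carrier (integer_mod_group (2 ^ n))"
      "j \<in> carrier (integer_mod_group (2 ^ Suc m))" "j' \<in> carrier (integer_mod_group (2 ^ Suc m))"
      "X \<in> carrier (symdiff_group S)" "X' \<in> carrier (symdiff_group S)"
      using uv u v by auto
    note cl = hom_in_carrier[OF 1 ci(1)] hom_in_carrier[OF 1 ci(2)] hom_in_carrier[OF 2 ci(3)]
      hom_in_carrier[OF 2 ci(4)] hom_in_carrier[OF 3 ci(5)] hom_in_carrier[OF 3 ci(6)]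
    have "phi (u \<otimes>\<^bsub>M\<^esub> v) = p a [^]\<^bsub>Q\<^esub> (i \<otimes>\<^bsub>integer_mod_group (2 ^ n)\<^esub> i')
        \<otimes>\<^bsub>Q\<^esub> (p b [^]\<^bsub>Q\<^esub> (j \<otimes>\<^bsub>integer_mod_group (2 ^ Suc m)\<^esub> j')
        \<otimes>\<^bsub>Q\<^esub> finprod Q (\<lambda>s. p (w s)) (X \<otimes>\<^bsub>symdiff_group S\<^esub> X'))"
      unfolding u v phi_def by (simp del: mult_integer_mod_group power_Suc)
    also have "\<dots> = (p a [^]\<^bsub>Q\<^esub> i \<otimes>\<^bsub>Q\<^esub> p a [^]\<^bsub>Q\<^esub> i') \<otimes>\<^bsub>Q\<^esub> ((p b [^]\<^bsub>Q\<^esub> j \<otimes>\<^bsub>Q\<^esub> p b [^]\<^bsub>Q\<^esub> j')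
        \<otimes>\<^bsub>Q\<^esub> (finprod Q (\<lambda>s. p (w s)) X \<otimes>\<^bsub>Q\<^esub> finprod Q (\<lambda>s. p (w s)) X'))"
      using hom_mult[OF 1 ci(1,2)] hom_mult[OF 2 ci(3,4)] hom_mult[OF 3 ci(5,6)] by simp
    also have "\<dots> = phi u \<otimes>\<^bsub>Q\<^esub> phi v"
      unfolding u v phi_def using cl by (simp add: Q.m_ac)
    finally show "phi (u \<otimes>\<^bsub>M\<^esub> v) = phi u \<otimes>\<^bsub>Q\<^esub> phi v" .
  qed
qed

text \<open>The generators occurring in \<open>d\<close> are detected by commutation with their partners.\<close>

lemma lift_finprod:
  assumes "finite X" "X \<subseteq> S"
  shows "\<exists>d\<in>carrier G. p d = finprod Q (\<lambda>s. p (w s)) X \<and> a \<otimes> d = d \<otimes> a \<and> b \<otimes> d = d \<otimes> b \<and>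
    (\<forall>s\<in>S. d \<otimes> w (partner s) = w (partner s) \<otimes> d \<longleftrightarrow> s \<notin> X)"
  using assms
proof (induction X)
  case empty
  have "w (partner s) \<in> carrier G" if "s \<in> S" for s
    using that by (intro w) (auto simp: partner_def)
  then show ?case
    using a b p_one[of \<one>] by (intro bexI[of _ \<one>]) auto
next
  case (insert t X)
  have t: "t \<in> S" and X: "X \<subseteq> S" using insert.prems by auto
  from insert.IH[OF X] obtain d where d0: "d \<in> carrier G"
    and d1: "p d = finprod Q (\<lambda>s. p (w s)) X \<and> a \<otimes> d = d \<otimes> a \<and> b \<otimes> d = d \<otimes> b \<and>
      (\<forall>s\<in>S. d \<otimes> w (partner s) = w (partner s) \<otimes> d \<longleftrightarrow> s \<notin> X)"
    by (rule bexE)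
  note d = d0 d1[THEN conjunct1] d1[THEN conjunct2, THEN conjunct1]
    d1[THEN conjunct2, THEN conjunct2, THEN conjunct1]
  note ds = bspec[OF d1[THEN conjunct2, THEN conjunct2, THEN conjunct2]]
  have wt: "w t \<in> carrier G" using t by (rule w)
  show ?case
  proof (intro bexI[of _ "w t \<otimes> d"] conjI ballI)
    show "w t \<otimes> d \<in> carrier G" using wt d by simp
    show "p (w t \<otimes> d) = finprod Q (\<lambda>s. p (w s)) (insert t X)"
    proof -
      have "(\<lambda>s. p (w s)) \<in> X \<rightarrow> carrier Q"
        using X by (intro Pi_I p.hom_closed w) auto
      moreover have "p (w t) \<in> carrier Q" using wt by (rule p.hom_closed)
      ultimately show ?thesis
        using insert.hyps d wt by (simp add: Q.finprod_insert p.hom_mult)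
    qed
    show "a \<otimes> (w t \<otimes> d) = (w t \<otimes> d) \<otimes> a"
      using commute_mult[OF wt d(1) a] w_ab(1)[OF t] d by simp
    show "b \<otimes> (w t \<otimes> d) = (w t \<otimes> d) \<otimes> b"
      using commute_mult[OF wt d(1) b] w_ab(2)[OF t] d by simp
    fix s assume s: "s \<in> S"
    let ?v = "w (partner s)"
    have ps: "partner s \<in> S" using s by (auto simp: partner_def)
    have v: "?v \<in> carrier G" using ps by (rule w)
    have wv: "w t \<otimes> ?v = ?v \<otimes> w t \<longleftrightarrow> s \<noteq> t"
      using w_w[OF t ps] by (auto simp: partner_def prod_eq_iff)
    show "(w t \<otimes> d) \<otimes> ?v = ?v \<otimes> (w t \<otimes> d) \<longleftrightarrow> s \<notin> insert t X"
    proof (cases "s = t")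
      case True
      then have "d \<otimes> ?v = ?v \<otimes> d" using ds[OF s] insert.hyps by auto
      then have "(w t \<otimes> d) \<otimes> ?v = (w t \<otimes> ?v) \<otimes> d" using wt d v by (simp add: m_assoc)
      moreover have "w t \<otimes> ?v \<noteq> ?v \<otimes> w t" using wv True by simp
      ultimately show ?thesis
        using True wt d v by (simp add: m_assoc[symmetric])
    next
      case False
      then have "?v \<otimes> w t = w t \<otimes> ?v" using wv by simp
      then have "?v \<otimes> (w t \<otimes> d) = w t \<otimes> (?v \<otimes> d)" using wt d v by (simp add: m_assoc[symmetric])
      then show ?thesis
        using False wt d v ds[OF s] by (simp add: m_assoc)
    qed
  qed
qed

lemma phi_lift:
  assumes "(i, j, X) \<in> carrier M"
  obtains d where "d \<in> carrier G" "a \<otimes> d = d \<otimes> a" "b \<otimes> d = d \<otimes> b"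
    "\<And>s. s \<in> S \<Longrightarrow> d \<otimes> w (partner s) = w (partner s) \<otimes> d \<longleftrightarrow> s \<notin> X"
    "p d = finprod Q (\<lambda>s. p (w s)) X"
    "phi (i, j, X) = p (a [^] nat i \<otimes> (b [^] nat j \<otimes> d))"
proof -
  have X: "X \<subseteq> S" and ij: "i \<ge> 0" "j \<ge> 0"
    using assms by (auto simp: symdiff_group_def carrier_integer_mod_group)
  from lift_finprod[OF finite_subset[OF X finite_S] X] obtain d where d0: "d \<in> carrier G"
    and d1: "p d = finprod Q (\<lambda>s. p (w s)) X \<and> a \<otimes> d = d \<otimes> a \<and> b \<otimes> d = d \<otimes> b \<and>
      (\<forall>s\<in>S. d \<otimes> w (partner s) = w (partner s) \<otimes> d \<longleftrightarrow> s \<notin> X)"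
    by (rule bexE)
  note d = d0 d1[THEN conjunct1] d1[THEN conjunct2, THEN conjunct1]
    d1[THEN conjunct2, THEN conjunct2, THEN conjunct1]
  note ds = bspec[OF d1[THEN conjunct2, THEN conjunct2, THEN conjunct2]]
  have "p a [^]\<^bsub>Q\<^esub> i = p (a [^] nat i)" "p b [^]\<^bsub>Q\<^esub> j = p (b [^] nat j)"
    using ij p_pow[OF a, of "nat i"] p_pow[OF b, of "nat j"] by (simp_all add: int_pow_def)
  then have "phi (i, j, X) = p (a [^] nat i \<otimes> (b [^] nat j \<otimes> d))"
    using d(1,2) a b by (simp add: phi_def p.hom_mult)
  with that[OF d(1,3,4) ds d(2)] show ?thesis by blast
qed

lemma nat_small_dvd:
  assumes "0 \<le> (i :: int)" "i < 2 ^ r" "2 ^ r dvd nat i"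
  shows "i = 0"
proof (rule ccontr)
  assume "i \<noteq> 0"
  then have "nat i > 0" using assms(1) by simp
  then have "2 ^ r \<le> nat i" using assms(3) by (rule dvd_imp_le[rotated])
  then have "int (2 ^ r) \<le> i" using assms(1) by linarith
  then show False using assms(2) by simp
qed

text \<open>An element of \<open>{\<one>, c}\<close> commutes with everything, and \<open>a\<close>,
  \<open>b\<close> commute with every \<open>w s\<close>; so the lift \<open>d\<close> commutes with
  all partners and \<open>X\<close> is empty. Then \<open>ab_ind\<close> kills the exponent of
  \<open>b\<close>, and that of \<open>a\<close> is a multiple of \<open>2^n\<close> because
  \<open>a\<close> has order \<open>2^(n+1)\<close>.\<close>

lemma phi_one:
  assumes u: "u \<in> carrier M" and one: "phi u = \<one>\<^bsub>Q\<^esub>"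
  shows "u = \<one>\<^bsub>M\<^esub>"
proof -
  obtain i j X where u': "u = (i, j, X)" by (cases u)
  have bounds: "0 \<le> i" "i < 2 ^ n" "0 \<le> j" "j < 2 ^ Suc m" and X: "X \<subseteq> S"
    using u u' by (auto simp: symdiff_group_def carrier_integer_mod_group)
  obtain d where d: "d \<in> carrier G" "p d = finprod Q (\<lambda>s. p (w s)) X"
    and ds: "\<And>s. s \<in> S \<Longrightarrow> d \<otimes> w (partner s) = w (partner s) \<otimes> d \<longleftrightarrow> s \<notin> X"
    and ph: "phi (i, j, X) = p (a [^] nat i \<otimes> (b [^] nat j \<otimes> d))"
    using u u' phi_lift by metis
  let ?ab = "a [^] nat i \<otimes> b [^] nat j"
  have ab: "?ab \<in> carrier G" using a b by simp
  have abd: "?ab \<otimes> d \<in> C"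
    using one u' ph p_one[of "a [^] nat i \<otimes> (b [^] nat j \<otimes> d)"] a b d by (auto simp: m_assoc)
  have "X = {}"
  proof (rule ccontr)
    assume "X \<noteq> {}"
    then obtain s where s: "s \<in> X" "s \<in> S" using X by auto
    let ?v = "w (partner s)"
    have ps: "partner s \<in> S" using s by (auto simp: partner_def)
    have v: "?v \<in> carrier G" using ps by (rule w)
    have "?ab \<otimes> ?v = ?v \<otimes> ?ab"
      using a b v w_ab[OF ps] by (intro commute_mult commute_pow) auto
    then have "?v \<otimes> (?ab \<otimes> d) = ?ab \<otimes> (?v \<otimes> d)" using ab v d by (simp add: m_assoc[symmetric])
    moreover have "(?ab \<otimes> d) \<otimes> ?v = ?v \<otimes> (?ab \<otimes> d)"
      using abd ab d v by (intro C_commutes) auto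
    ultimately have "?ab \<otimes> (d \<otimes> ?v) = ?ab \<otimes> (?v \<otimes> d)" using ab d v by (simp add: m_assoc)
    then have "d \<otimes> ?v = ?v \<otimes> d" using ab d v by simp
    then show False using ds[OF s(2)] s by simp
  qed
  then have "p d = \<one>\<^bsub>Q\<^esub>" using d by simp
  then have dC: "d \<in> C" using p_one d by auto
  have "?ab = (?ab \<otimes> d) \<otimes> inv d" using ab d by (simp add: m_assoc)
  then have abC: "?ab \<in> C"
    using abd dC subgroup_C by (metis subgroup.m_closed subgroup.m_inv_closed)
  then have dj: "2 ^ Suc m dvd nat j" by (rule ab_ind)
  then have j: "j = 0"
    using bounds nat_small_dvd by blast
  have "a [^] nat i \<in> C" using abC j a by simp
  \<comment> \<open>Squaring turns membership in \<open>{\<one>, c}\<close> into a statement about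
    the order of \<open>a\<close>.\<close>
  then have "(a [^] nat i) \<otimes> (a [^] nat i) = \<one>" using c_sq by auto
  then have "a [^] (2 * nat i) = \<one>" using a by (simp add: nat_pow_mult mult_2)
  then have "ord a dvd 2 * nat i" using a pow_eq_id by blast
  moreover have "a [^] (2 ^ Suc n :: nat) = \<one>"
    using a a_pow c_sq by (simp add: nat_pow_mult[symmetric] mult_2)
  then have "ord a dvd 2 ^ Suc n" using a pow_eq_id by blast
  then obtain r where r: "r \<le> Suc n" "ord a = 2 ^ r" using divides_primepow_nat[OF two_is_prime_nat, of "ord a" "Suc n"] by blast
  have "\<not> ord a dvd 2 ^ n" using a_pow c_neq a pow_eq_id by metis
  then have "r = Suc n" using r by (metis le_SucE le_imp_power_dvd)
  ultimately have "2 ^ n dvd nat i" using r by simp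
  then have i: "i = 0"
    using bounds nat_small_dvd by blast
  show ?thesis using u' i j \<open>X = {}\<close> by (simp add: symdiff_group_def)
qed

end

lemma double_mod_power2:
  assumes "0 \<le> (i :: int)" "i < 2 ^ Suc r"
  shows "(i + i) mod 2 ^ Suc r = 0 \<longleftrightarrow> i = 0 \<or> i = 2 ^ r"
proof
  assume "(i + i) mod 2 ^ Suc r = 0"
  then have "2 * 2 ^ r dvd 2 * i" by (simp add: mod_eq_0_iff_dvd)
  then have "2 ^ r dvd i" by simp
  then obtain y where y: "i = 2 ^ r * y" by (auto simp: dvd_def)
  have "0 \<le> y" using assms y by (simp add: zero_le_mult_iff)
  moreover have "y < 2" using assms y by (simp add: mult.commute)
  ultimately have "y = 0 \<or> y = 1" by linarith
  then show "i = 0 \<or> i = 2 ^ r" using y by auto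
qed auto

context m2_d8_product
begin

lemma phi_iso: "phi \<in> iso M Q"
proof -
  interpret M: group M by (rule group_M)
  interpret ph: group_hom M Q phi
    by unfold_locales (rule phi_hom)
  let ?I = "phi ` carrier M"
  have I: "subgroup ?I Q" by (rule ph.img_is_subgroup)
  have M_in: "(i, j, X) \<in> carrier M" if "i \<in> {0..<2 ^ n}" "j \<in> {0..<2 ^ Suc m}" "X \<subseteq> S" for i j X
    using that by (simp add: carrier_integer_mod_group symdiff_group_def)
  have big: "(1::int) < 2 ^ n" "(1::int) < 2 ^ Suc m"
    using nmk one_less_power[of "2 :: int" n] one_less_power[of "2 :: int" "Suc m"] by simp_all
  have pcl: "p a \<in> carrier Q" "p b \<in> carrier Q" using a b by auto
  have pa: "p a \<in> ?I"
    by (rule image_eqI[OF _ M_in[of 1 0 "{}"]]) (use pcl big in \<open>auto simp: phi_def\<close>)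
  have pb: "p b \<in> ?I"
    by (rule image_eqI[OF _ M_in[of 0 1 "{}"]]) (use pcl big in \<open>auto simp: phi_def\<close>)
  have pw: "p (w s) \<in> ?I" if s: "s \<in> S" for s
  proof (rule image_eqI)
    show "(0, 0, {s}) \<in> carrier M" using s by (intro M_in) auto
    have "p (w s) \<in> carrier Q" using w[OF s] by simp
    then show "p (w s) = phi (0, 0, {s})" using pcl by (simp add: phi_def)
  qed
  have "p g \<in> ?I" if "g \<in> generate G ({a, b} \<union> w ` S)" for g
    using that
  proof (induction g rule: generate.induct)
    case one
    then show ?case using subgroup.one_closed[OF I] by simp
  next
    case (incl h)
    then show ?case using pa pb pw by auto
  next
    case (inv h)
    then have "h \<in> carrier G" using a b w by auto
    moreover have "p h \<in> ?I" using inv pa pb pw by auto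
    ultimately show ?case using subgroup.m_inv_closed[OF I] by simp
  next
    case (eng h1 h2)
    then have "h1 \<in> carrier G" "h2 \<in> carrier G" using gen by auto
    then show ?case using subgroup.m_closed[OF I eng.IH] by simp
  qed
  then have "p ` carrier G \<subseteq> ?I"
    unfolding gen by (rule image_subsetI)
  then have "carrier Q \<subseteq> ?I"
    unfolding p_surj .
  then show ?thesis
    unfolding ph.iso_iff using phi_one by (intro conjI ballI impI)
qed

section \<open>Finiteness, square roots and the order of the unitary group\<close>

lemma finite_M: "finite (carrier M)"
  by (simp add: carrier_integer_mod_group symdiff_group_def)

lemma finite_G: "finite (carrier G)"
proof -
  have "phi ` carrier M = carrier Q" using phi_iso by (auto simp: iso_def bij_betw_def)
  then have "finite (carrier Q)" using finite_M by (metis finite_imageI)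
  moreover have "carrier G \<subseteq> (\<Union>u\<in>carrier Q. u)"
    using rcos_self[OF _ subgroup_C] p_surj unfolding p_def by auto
  moreover have "finite u" if u: "u \<in> carrier Q" for u
  proof -
    obtain g where "u = p g" using p_ex[OF u] by blast
    then show ?thesis by (simp add: p_def r_coset_def)
  qed
  ultimately show ?thesis by (meson finite_UN_I finite_subset)
qed

lemma central_ext_Q:
  assumes "char2 TYPE('f::{field, finite})"
  shows "central_ext TYPE('f) G Q p c"
  using assms by (intro central_ext.intro fin_group2.intro fin_group.intro fin_group_axioms.intro
      central_ext_axioms.intro is_group finite_G comm_Q p_hom p_surj c c_neq p_one)

text \<open>Two choices from each cyclic factor and all \<open>2^(2k-2)\<close> subsets of
  \<open>S\<close>.\<close>

lemma card_involutions_M: "card {u \<in> carrier M. u \<otimes>\<^bsub>M\<^esub> u = \<one>\<^bsub>M\<^esub>} = 2 ^ (2 * k)"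
proof -
  obtain n' where n': "n = Suc n'" using nmk by (cases n) auto
  have pos: "0 \<le> i \<and> i < 2 ^ Suc r \<and> (i + i) mod 2 ^ Suc r = 0 \<longleftrightarrow> i = 0 \<or> i = 2 ^ r" for i :: int and r
    using double_mod_power2[of i r] by auto
  have "{u \<in> carrier M. u \<otimes>\<^bsub>M\<^esub> u = \<one>\<^bsub>M\<^esub>} = {0, 2 ^ n'} \<times> ({0, 2 ^ m} \<times> Pow S)"
  proof -
    have "(i, j, X) \<in> carrier M \<and> (i, j, X) \<otimes>\<^bsub>M\<^esub> (i, j, X) = \<one>\<^bsub>M\<^esub> \<longleftrightarrow>
        (i = 0 \<or> i = 2 ^ n') \<and> (j = 0 \<or> j = 2 ^ m) \<and> X \<subseteq> S" for i j X
    proof -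
      have "(i, j, X) \<in> carrier M \<and> (i, j, X) \<otimes>\<^bsub>M\<^esub> (i, j, X) = \<one>\<^bsub>M\<^esub> \<longleftrightarrow>
          (0 \<le> i \<and> i < 2 ^ Suc n' \<and> (i + i) mod 2 ^ Suc n' = 0) \<and>
          (0 \<le> j \<and> j < 2 ^ Suc m \<and> (j + j) mod 2 ^ Suc m = 0) \<and> X \<subseteq> S"
        unfolding n' by (simp add: carrier_integer_mod_group symdiff_group_def) blast
      then show ?thesis
        using pos[of i n'] pos[of j m] by (simp only:)
    qed
    then show ?thesis by (auto simp del: mult_DirProd carrier_DirProd one_DirProd)
  qed
  then have "card {u \<in> carrier M. u \<otimes>\<^bsub>M\<^esub> u = \<one>\<^bsub>M\<^esub>} = 2 * (2 * 2 ^ ((k - 1) * 2))"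
    by (simp add: card_cartesian_product card_Pow)
  also have "\<dots> = 2 ^ Suc (Suc ((k - 1) * 2))" by simp
  also have "Suc (Suc ((k - 1) * 2)) = 2 * k" using nmk by simp
  finally show ?thesis .
qed

text \<open>The class of \<open>g\<close> has trivial square, which leaves 0 and \<open>2^m\<close>
  as exponents of \<open>b\<close>. Such a power of \<open>b\<close> is central, and this is what
  the applications need.\<close>

lemma phi_normal_form:
  assumes g: "g \<in> carrier G" "g \<otimes> g \<in> C"
  obtains i j X d where "(i, j, X) \<in> carrier M" "p g = phi (i, j, X)" "j = 0 \<or> j = 2 ^ m"
    "d \<in> carrier G" "a \<otimes> d = d \<otimes> a" "p d = finprod Q (\<lambda>s. p (w s)) X"
    "p g = p (a [^] nat i \<otimes> (b [^] nat j \<otimes> d))"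
proof -
  interpret M: group M by (rule group_M)
  have "p g \<in> carrier Q" using g by simp
  moreover have "phi ` carrier M = carrier Q" using phi_iso by (simp add: iso_def bij_betw_def)
  ultimately have "p g \<in> phi ` carrier M" by (simp only:)
  then obtain u where u: "u \<in> carrier M" "p g = phi u" by (rule imageE)
  obtain i j X where u': "u = (i, j, X)" by (cases u)
  have "phi (u \<otimes>\<^bsub>M\<^esub> u) = p (g \<otimes> g)" using u g phi_hom by (simp add: hom_mult)
  also have "\<dots> = \<one>\<^bsub>Q\<^esub>" using g p_one[of "g \<otimes> g"] by auto
  finally have "u \<otimes>\<^bsub>M\<^esub> u = \<one>\<^bsub>M\<^esub>" by (rule phi_one[OF M.m_closed[OF u(1) u(1)]])
  then have j: "j = 0 \<or> j = 2 ^ m"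
    using u(1) u' double_mod_power2[of j m] by (simp add: carrier_integer_mod_group)
  obtain d where "d \<in> carrier G" "a \<otimes> d = d \<otimes> a" "p d = finprod Q (\<lambda>s. p (w s)) X"
    "phi (i, j, X) = p (a [^] nat i \<otimes> (b [^] nat j \<otimes> d))"
    by (rule phi_lift[OF u(1)[unfolded u']])
  then show ?thesis using that[of i j X d] u u' j by simp
qed

text \<open>As \<open>m\<close> is at least 1, \<open>b^(2^m)\<close> is a square, and squares are
  central.\<close>

lemma b_pow_central:
  assumes "j = 0 \<or> j = 2 ^ m" "g \<in> carrier G"
  shows "b [^] nat j \<otimes> g = g \<otimes> b [^] nat j"
proof -
  obtain m' where m': "m = Suc m'" using nmk by (cases m) auto
  define r :: nat where "r = (if j = 0 then 0 else 2 ^ m')"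
  have "nat j = r + r"
    using assms(1) by (auto simp: r_def m' nat_power_eq nat_mult_distrib)
  then have "b [^] nat j = b [^] r \<otimes> b [^] r"
    using b by (simp add: nat_pow_mult)
  then show ?thesis
    using sq_central[of "b [^] r" g] b assms(2) by simp
qed

definition z :: 'a where "z = a [^] (2 ^ (n - 1) :: nat)"

lemma z: "z \<in> carrier G" "z \<otimes> z = c"
proof -
  have "(2 ^ (n - 1) + 2 ^ (n - 1) :: nat) = 2 ^ n" using nmk by (cases n) auto
  then show "z \<in> carrier G" "z \<otimes> z = c"
    using a a_pow by (simp_all add: z_def nat_pow_mult)
qed

lemma z_square:
  assumes "n \<ge> 2"
  shows "a [^] (2 ^ (n - 2) :: nat) \<otimes> a [^] (2 ^ (n - 2) :: nat) = z"
proof -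
  have "n - 1 = Suc (n - 2)" using assms by simp
  then have "(2 ^ (n - 2) + 2 ^ (n - 2) :: nat) = 2 ^ (n - 1)" by simp
  then show ?thesis unfolding z_def using a by (simp add: nat_pow_mult)
qed

text \<open>For \<open>n\<close> at least 2, \<open>z\<close> is a square, hence central. For
  \<open>n = 1\<close> it is \<open>a\<close>, which need not be central; but an element with square
  in \<open>{\<one>, c}\<close> is, up to \<open>c\<close>, a product \<open>a^i b^j d\<close> in
  which \<open>b^j\<close> is central and \<open>d\<close> commutes with \<open>a\<close>.\<close>

lemma z_comm:
  assumes g: "g \<in> carrier G" "g \<otimes> g = \<one> \<or> g \<otimes> g = c"
  shows "g \<otimes> z = z \<otimes> g"
proof (cases "n \<ge> 2")
  case True
  then show ?thesis
    using sq_central[of "a [^] (2 ^ (n - 2) :: nat)" g] z_square a g by simp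
next
  case False
  then have "n - 1 = 0" by simp
  then have za: "z = a" unfolding z_def using a by simp
  obtain i j X d where j: "j = 0 \<or> j = 2 ^ m" and d: "d \<in> carrier G" "a \<otimes> d = d \<otimes> a"
    and pg: "p g = p (a [^] nat i \<otimes> (b [^] nat j \<otimes> d))"
    by (rule phi_normal_form[of g]) (use g in auto)
  define v where "v = a [^] nat i \<otimes> (b [^] nat j \<otimes> d)"
  have v: "v \<in> carrier G" using a b d by (simp add: v_def)
  have bd: "(b [^] nat j \<otimes> d) \<otimes> a = a \<otimes> (b [^] nat j \<otimes> d)"
    using a b d b_pow_central[OF j a] by (intro commute_mult) auto
  have va: "v \<otimes> a = a \<otimes> v"
    unfolding v_def using a b d by (intro commute_mult[OF _ _ _ commute_pow[OF a a HOL.refl] bd]) auto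
  have "g = v \<or> g = c \<otimes> v" using p_eqD[OF g(1) v] pg by (simp add: v_def)
  then show ?thesis
    unfolding za using va commute_mult[of c v a] c_central[OF a] c v a by auto
qed

lemma unitary_count:
  assumes "char2 TYPE('f::{field, finite})"
  shows "card {g \<in> carrier G. g \<otimes> g = \<one>} = 2 ^ (2 * k)" "card {g \<in> carrier G. g \<otimes> g = c} = 2 ^ (2 * k)"
    "card (US G :: ('a \<Rightarrow> 'f) set) = (if n = 1 \<and> k \<ge> 2 then 2 else 4)
      * card (UNIV :: 'f set) ^ ((card (carrier G) + 2 ^ (2 * k)) div 2 - 1)"
proof -
  interpret E: central_ext G "TYPE('f)" Q p c by (rule central_ext_Q[OF assms])
  let ?q = "card (UNIV :: 'f set)"
  \<comment> \<open>The cyclic factor of order \<open>2^(m+1)\<close> has order at least 4 and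
    contributes 2; the one of order \<open>2^n\<close> does so only if \<open>n\<close> is at least
    2.\<close>
  have M: "theta M TYPE('f) ((if n \<ge> 2 then 2 else 1) * ((if Suc m \<ge> 2 then 2 else 1) * 1))"
    by (intro theta_cyclic_prod theta_symdiff finite_S assms)
  then interpret M: fin_group2 M "TYPE('f)" by (simp add: theta_def)
  have eq: "card {g \<in> carrier G. g \<otimes> g = \<one>} = card {g \<in> carrier G. g \<otimes> g = c}"
    using z z_comm by (rule E.card_roots_eq)
  moreover have "card {u \<in> carrier Q. u \<otimes>\<^bsub>Q\<^esub> u = \<one>\<^bsub>Q\<^esub>} = 2 ^ (2 * k)"
    using M.card_involutions_iso[OF group_Q phi_iso] card_involutions_M by simp
  ultimately show c1: "card {g \<in> carrier G. g \<otimes> g = \<one>} = 2 ^ (2 * k)"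
    using E.card_roots_both by simp
  then show "card {g \<in> carrier G. g \<otimes> g = c} = 2 ^ (2 * k)" using eq by simp
  have tQ: "E.A.has_theta ((if n \<ge> 2 then 2 else 1) * 2)"
    by (rule M.theta_iso[OF E.A.fin_group2_axioms phi_iso]) (use M nmk in \<open>simp add: theta_def\<close>)
  have "E.has_theta (if n = 1 \<and> k \<ge> 2 then 2 else 4)"
  proof (cases "n \<ge> 2")
    case True
    have "card E.lam_image = ?q ^ card E.T"
      by (rule E.card_lam_image_square[OF z, of "a [^] (2 ^ (n - 2) :: nat)"])
        (use a z_comm z_square[OF True] in auto)
    then have "1 * card E.lam_image = ?q ^ card E.T" by simp
    from E.theta_ext[OF tQ this] show ?thesis using True by simp
  next
    case False
    then have n: "n = 1" using nmk by simp
    show ?thesis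
    proof (cases "k \<ge> 2")
      case True
      \<comment> \<open>The first \<open>D_8\<close> supplies a root of \<open>c\<close> and an
        involution that do not commute.\<close>
      have s: "(1, False) \<in> S" "(1, True) \<in> S" using True by auto
      have "w (1, False) \<otimes> w (1, True) \<noteq> w (1, True) \<otimes> w (1, False)"
        using w_w[OF s] by (simp add: partner_def)
      then have "card E.lam_image = ?q ^ card E.T"
        using E.card_lam_image_noncomm[OF z z_comm, of "w (1, False)" "w (1, True)"]
          w[OF s(1)] w[OF s(2)] w_1[OF True] by simp
      then have "1 * card E.lam_image = ?q ^ card E.T" by simp
      from E.theta_ext[OF tQ this] show ?thesis using True n by simp
    next
      case False
      then have S: "S = {}" by auto
      interpret ph: group_hom M Q phi by unfold_locales (rule phi_hom)
      \<comment> \<open>Without a \<open>D_8\<close>, \<open>N\<close> is the subgroup of index 2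
        spanned by the class of \<open>b\<close>, and the roots of \<open>c\<close> lie exactly over
        the involutions outside \<open>N\<close>.\<close>
      define N where "N = phi ` {u \<in> carrier M. fst u = 0}"
      have phi_inj: "inj_on phi (carrier M)" and phi_surj: "phi ` carrier M = carrier Q"
        using phi_iso by (auto simp: iso_def bij_betw_def)
      have N_iff: "phi u \<in> N \<longleftrightarrow> fst u = 0" if "u \<in> carrier M" for u
        using that inj_onD[OF phi_inj] by (auto simp: N_def)
      have fst01: "fst u = 0 \<or> fst u = 1" if "u \<in> carrier M" for u
        using that n by (auto simp: carrier_integer_mod_group)
      have T_iff: "t \<in> E.T \<longleftrightarrow> t \<notin> N" if t: "t \<in> carrier Q" "t \<otimes>\<^bsub>Q\<^esub> t = \<one>\<^bsub>Q\<^esub>" for t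
      proof -
        obtain g where g: "g \<in> carrier G" "p g = t" using p_ex[OF t(1)] by blast
        have "p (g \<otimes> g) = \<one>\<^bsub>Q\<^esub>" using g t by simp
        then have gC: "g \<otimes> g \<in> C" using g p_one[of "g \<otimes> g"] by auto
        obtain i j X d where iM: "(i, j, X) \<in> carrier M" "p g = phi (i, j, X)" and j: "j = 0 \<or> j = 2 ^ m"
          and d: "d \<in> carrier G" "p d = finprod Q (\<lambda>s. p (w s)) X"
          and pg: "p g = p (a [^] nat i \<otimes> (b [^] nat j \<otimes> d))"
          by (rule phi_normal_form[OF g(1) gC])
        have "X = {}" using iM S by (simp add: symdiff_group_def)
        define v where "v = a [^] nat i \<otimes> b [^] nat j"
        have v: "v \<in> carrier G" using a b by (simp add: v_def)
        have "p g = p v"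
          using pg d \<open>X = {}\<close> a b by (simp add: v_def)
        then have tv: "t = p v" using g by simp
        \<comment> \<open>With \<open>b^j\<close> central of square \<one>, only the exponent of
          \<open>a\<close>, which is 0 or 1, decides whether the square of \<open>v\<close> is
          \<open>c\<close>.\<close>
        have "b [^] nat j \<otimes> b [^] nat j = \<one>"
        proof -
          have "nat j + nat j = 0 \<or> nat j + nat j = 2 ^ Suc m"
            using j by (auto simp: nat_power_eq nat_mult_distrib)
          then show ?thesis using b b_pow by (auto simp: nat_pow_mult)
        qed
        moreover have "v \<otimes> v = (a [^] nat i \<otimes> a [^] nat i) \<otimes> (b [^] nat j \<otimes> b [^] nat j)"
          unfolding v_def
          by (rule E.sq_mult_commuting) (use a b b_pow_central[OF j, of "a [^] nat i"] in simp_all)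
        ultimately have "v \<otimes> v = a [^] nat i \<otimes> a [^] nat i" using a by simp
        moreover have "i = 0 \<or> i = 1" using fst01[OF iM(1)] by simp
        moreover have "a \<otimes> a = c" using a_pow n a by (simp add: numeral_2_eq_2)
        ultimately have "v \<otimes> v = c \<longleftrightarrow> i \<noteq> 0"
          using a c_neq by (elim disjE) (simp_all add: eq_commute[of \<one> c])
        then show ?thesis
          using E.p_in_T[OF v] tv g iM N_iff[OF iM(1)] by simp
      qed
      have T: "E.T = {t \<in> carrier Q - N. t \<otimes>\<^bsub>Q\<^esub> t = \<one>\<^bsub>Q\<^esub>}"
        using T_iff E.T_sq E.T_carrier by blast
      have "2 * card E.lam_image = ?q ^ card E.T"
      proof (rule E.card_lam_image_index2[OF _ _ T])
        have "subgroup {u \<in> carrier M. fst u = 0} M"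
        proof
          fix u assume "u \<in> {u \<in> carrier M. fst u = 0}"
          then have u: "u \<in> carrier M" "fst u = 0" by auto
          have "fst (inv\<^bsub>M\<^esub> u \<otimes>\<^bsub>M\<^esub> u) = 0" using u M.l_inv by simp
          then have "fst (inv\<^bsub>M\<^esub> u) mod 2 ^ n = 0" using u by (simp add: mult_DirProd')
          moreover have "0 \<le> fst (inv\<^bsub>M\<^esub> u)" "fst (inv\<^bsub>M\<^esub> u) < 2 ^ n"
            using M.inv_closed[OF u(1)] by (auto simp: carrier_integer_mod_group simp del: inv_DirProd)
          ultimately show "inv\<^bsub>M\<^esub> u \<in> {u \<in> carrier M. fst u = 0}" using M.inv_closed[OF u(1)] by simp
        next
          fix u v assume "u \<in> {u \<in> carrier M. fst u = 0}" "v \<in> {u \<in> carrier M. fst u = 0}"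
          then show "u \<otimes>\<^bsub>M\<^esub> v \<in> {u \<in> carrier M. fst u = 0}"
            using M.m_closed[of u v] by (simp add: mult_DirProd' del: carrier_DirProd)
        qed (auto simp: symdiff_group_def carrier_integer_mod_group)
        then show "subgroup N Q" unfolding N_def by (rule ph.subgroup_img_is_subgroup)
        show "u \<otimes>\<^bsub>Q\<^esub> v \<in> N" if "u \<in> carrier Q - N" "v \<in> carrier Q - N" for u v
        proof -
          have "u \<in> phi ` carrier M" "v \<in> phi ` carrier M" using that unfolding phi_surj by auto
          then obtain u' v' where uv: "u' \<in> carrier M" "u = phi u'" "v' \<in> carrier M" "v = phi v'"
            by (elim imageE)
          have "fst u' = 1" "fst v' = 1"
            using that N_iff[OF uv(1)] N_iff[OF uv(3)] fst01[OF uv(1)] fst01[OF uv(3)] uv(2,4) by auto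
          then have "fst (u' \<otimes>\<^bsub>M\<^esub> v') = 0" using n by (simp add: mult_DirProd')
          then have "phi (u' \<otimes>\<^bsub>M\<^esub> v') \<in> N" using N_iff[OF M.m_closed[OF uv(1,3)]] by blast
          then show ?thesis using uv by (simp only: ph.hom_mult)
        qed
        show "p a \<in> E.T"
          using E.p_in_T[OF a] a_pow n a by (simp add: numeral_2_eq_2)
      qed
      from E.theta_ext[OF tQ this] show ?thesis using False n by simp
    qed
  qed
  then have t: "card (US G :: ('a \<Rightarrow> 'f) set) * ?q = (if n = 1 \<and> k \<ge> 2 then 2 else 4) * ?q ^ E.sdim"
    by (simp add: E.has_theta_def)
  have sd: "E.sdim = (card (carrier G) + 2 ^ (2 * k)) div 2"
    using E.sdim_def c1 by simp
  \<comment> \<open>Positivity makes the subtraction of 1 in the exponent a genuine one.\<close>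
  have "2 * E.sdim > 0" unfolding E.sdim c1 by simp
  then have "?q ^ E.sdim = ?q ^ (E.sdim - 1) * ?q"
    by (cases E.sdim) auto
  then have "card (US G :: ('a \<Rightarrow> 'f) set) * ?q = ((if n = 1 \<and> k \<ge> 2 then 2 else 4) * ?q ^ (E.sdim - 1)) * ?q"
    using t by (simp only: mult.assoc)
  moreover have "?q \<noteq> 0" by simp
  ultimately have "card (US G :: ('a \<Rightarrow> 'f) set) = (if n = 1 \<and> k \<ge> 2 then 2 else 4) * ?q ^ (E.sdim - 1)"
    by (simp only: mult_cancel2) blast
  then show "card (US G :: ('a \<Rightarrow> 'f) set) = (if n = 1 \<and> k \<ge> 2 then 2 else 4)
      * ?q ^ ((card (carrier G) + 2 ^ (2 * k)) div 2 - 1)"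
    unfolding sd .
qed

end

section \<open>Extracting the structure from the presentations\<close>

lemma pres_class_eq_iff: "pres_class R u = pres_class R v \<longleftrightarrow> pres_eq R u v"
  unfolding pres_class_def by (auto intro: pres_eq.intros)

lemma mult_presented_group:
  "pres_class R u \<otimes>\<^bsub>presented_group R\<^esub> pres_class R v = pres_class R (u @ v)"
proof -
  have "pres_class R (u' @ v') = pres_class R (u @ v)"
    if "u' \<in> pres_class R u" "v' \<in> pres_class R v" for u' v'
    unfolding pres_class_eq_iff
    using that by (auto simp: pres_class_def intro: pres_eq.append pres_eq.sym)
  then have "(\<Union>u'\<in>pres_class R u. \<Union>v'\<in>pres_class R v. pres_class R (u' @ v'))
      = (\<Union>u'\<in>pres_class R u. \<Union>v'\<in>pres_class R v. pres_class R (u @ v))"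
    by (intro SUP_cong HOL.refl)
  moreover have "u \<in> pres_class R u" "v \<in> pres_class R v"
    by (auto simp: pres_class_def intro: pres_eq.refl)
  then have "pres_class R u \<noteq> {}" "pres_class R v \<noteq> {}" by blast+
  ultimately show ?thesis
    unfolding presented_group_def by simp
qed

fun exponent_sum :: "'x \<Rightarrow> 'x word \<Rightarrow> int" where
  "exponent_sum x [] = 0"
| "exponent_sum x ((y, e) # u) = (if y = x then (if e then 1 else - 1) else 0) + exponent_sum x u"

lemma exponent_sum_append: "exponent_sum x (u @ v) = exponent_sum x u + exponent_sum x v"
  by (induction x u rule: exponent_sum.induct) auto

lemma exponent_sum_wpow: "exponent_sum x (wpow y i) = (if x = y then int i else 0)"
  by (induction i) (auto simp: wpow_def)

text \<open>The exponent sum of a letter modulo \<open>N\<close> is well defined on the presented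
  group once the relations respect it. This bounds orders from below without a concrete model of the
  group.\<close>

lemma pres_eq_exponent_sum:
  assumes "pres_eq R u v" "\<And>u v. (u, v) \<in> R \<Longrightarrow> N dvd exponent_sum x u - exponent_sum x v"
  shows "N dvd exponent_sum x u - exponent_sum x v"
  using assms(1)
proof induction
  case (sym u v)
  then show ?case by (subst dvd_minus_iff[symmetric]) simp
next
  case (trans u v w)
  then show ?case using dvd_add[of N "exponent_sum x u - exponent_sum x v" "exponent_sum x v - exponent_sum x w"] by simp
next
  case (append u u' v v')
  then show ?case
    using dvd_add[of N "exponent_sum x u - exponent_sum x u'" "exponent_sum x v - exponent_sum x v'"]
    by (simp add: exponent_sum_append algebra_simps)
qed (use assms(2) in auto)

context group
begin

text \<open>\<open>f\<close> evaluates words in \<open>K\<close>: it sends a word to its class and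
  then applies the inverse isomorphism, so equal values mean derivability from
  \<open>R\<close>.\<close>

lemma presented_subgroup:
  assumes K: "subgroup K G" and iso: "G\<lparr>carrier := K\<rparr> \<cong> presented_group R"
  obtains f where "range f = K" "\<And>u v. f (u @ v) = f u \<otimes> f v" "\<And>u v. f u = f v \<longleftrightarrow> pres_eq R u v"
proof -
  let ?P = "presented_group R"
  obtain \<psi> where "\<psi> \<in> iso (G\<lparr>carrier := K\<rparr>) ?P" using iso by (auto simp: is_iso_def)
  then have hom: "\<And>x y. x \<in> K \<Longrightarrow> y \<in> K \<Longrightarrow> \<psi> (x \<otimes> y) = \<psi> x \<otimes>\<^bsub>?P\<^esub> \<psi> y"
    and bij: "bij_betw \<psi> K (range (pres_class R))"
    by (auto simp: iso_def hom_def presented_group_def)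
  define f where "f u = inv_into K \<psi> (pres_class R u)" for u
  have f: "f u \<in> K" "\<psi> (f u) = pres_class R u" for u
    using bij by (auto simp: f_def bij_betw_def inv_into_into f_inv_into_f)
  have inj: "x = y" if "x \<in> K" "y \<in> K" "\<psi> x = \<psi> y" for x y
    using bij that by (auto simp: bij_betw_def inj_on_def)
  have "range f = K"
  proof (intro equalityI subsetI)
    fix x assume x: "x \<in> K"
    then have "\<psi> x \<in> range (pres_class R)" using bij by (auto simp: bij_betw_def)
    then obtain u where "\<psi> x = pres_class R u" by (rule rangeE)
    then have "x = f u" using inj[OF x] f by simp
    then show "x \<in> range f" by simp
  qed (use f in auto)
  moreover have "f (u @ v) = f u \<otimes> f v" for u v
    using f hom subgroup.m_closed[OF K] by (intro inj) (auto simp: mult_presented_group)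
  moreover have "f u = f v \<longleftrightarrow> pres_eq R u v" for u v
    using f inj unfolding pres_class_eq_iff[symmetric] by metis
  ultimately show ?thesis by (rule that)
qed

lemma presented_by_two:
  fixes R :: "(gen word \<times> gen word) set"
  assumes K: "subgroup K G" and iso: "G\<lparr>carrier := K\<rparr> \<cong> presented_group R"
  obtains f a b where "a \<in> K" "b \<in> K" "K \<subseteq> generate G {a, b}"
    "\<And>u v. f (u @ v) = f u \<otimes> f v" "\<And>u v. f u = f v \<longleftrightarrow> pres_eq R u v" "f [] = \<one>"
    "f [(A, True)] = a" "f [(B, True)] = b" "f [(A, False)] = inv a" "f [(B, False)] = inv b"
    "\<And>i. f (wpow A i) = a [^] i" "\<And>i. f (wpow B i) = b [^] i"
proof -
  obtain f where f: "range f = K" "\<And>u v. f (u @ v) = f u \<otimes> f v" "\<And>u v. f u = f v \<longleftrightarrow> pres_eq R u v"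
    by (rule presented_subgroup[OF assms]) (rule that)
  have fK: "f u \<in> K" for u using f(1) by auto
  then have fG: "f u \<in> carrier G" for u using subgroup.subset[OF K] by auto
  have f0: "f [] = \<one>"
    using f(2)[of "[]" "[]"] fG[of "[]"] by simp
  have f_inv: "f [(x, False)] = inv (f [(x, True)])" for x
  proof -
    have "f ([(x, False)] @ [(x, True)]) = f []"
      using pres_eq.cancel[of R x False] f(3) by simp
    then show ?thesis using fG f0 unfolding f(2) by (metis inv_equality)
  qed
  have f_pow: "f (wpow x i) = f [(x, True)] [^] i" for x i
  proof (induction i)
    case (Suc i)
    have "wpow x (Suc i) = wpow x i @ [(x, True)]" by (simp add: wpow_def replicate_append_same)
    then show ?case using Suc by (simp add: f(2))
  qed (simp add: wpow_def f0)
  have "f u \<in> generate G {f [(A, True)], f [(B, True)]}" for u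
  proof (induction u)
    case Nil
    then show ?case by (simp add: f0 generate.one)
  next
    case (Cons l u)
    obtain x e where l: "l = (x, e)" by (cases l)
    have "f [(x, e)] \<in> generate G {f [(A, True)], f [(B, True)]}"
      by (cases x; cases e) (auto simp: f_inv intro: generate.incl generate.inv)
    then show ?case
      using Cons f(2)[of "[l]" u] l by (simp add: generate.eng)
  qed
  then have Ksub: "K \<subseteq> generate G {f [(A, True)], f [(B, True)]}" using f(1) by auto
  show ?thesis
    by (rule that[OF fK fK Ksub f(2,3) f0 HOL.refl HOL.refl f_inv f_inv f_pow f_pow])
qed

section \<open>Passing commutation from generators to the group\<close>

lemma subgroup_centralizer:
  assumes "g \<in> carrier G"
  shows "subgroup {h \<in> carrier G. h \<otimes> g = g \<otimes> h} G"
proof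
  fix h assume "h \<in> {h \<in> carrier G. h \<otimes> g = g \<otimes> h}"
  then have h: "h \<in> carrier G" "h \<otimes> g = g \<otimes> h" by auto
  have "inv h \<otimes> g = inv h \<otimes> ((g \<otimes> h) \<otimes> inv h)" using h assms by (simp add: m_assoc)
  also have "\<dots> = g \<otimes> inv h" using h assms by (simp only: h(2)[symmetric]) (simp add: m_assoc[symmetric])
  finally show "inv h \<in> {h \<in> carrier G. h \<otimes> g = g \<otimes> h}" using h by simp
qed (use assms commute_mult in auto)

lemma generate_commute:
  assumes X: "X \<subseteq> carrier G" and g: "g \<in> carrier G" "\<And>x. x \<in> X \<Longrightarrow> x \<otimes> g = g \<otimes> x" and h: "h \<in> generate G X"
  shows "h \<otimes> g = g \<otimes> h"
  using generate_subgroup_incl[OF _ subgroup_centralizer[OF g(1)], of X] X g(2) h by blast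

text \<open>Used contrapositively: in a factor with nontrivial derived subgroup the two generators
  cannot commute.\<close>

lemma generate_two_commute:
  assumes ab: "a \<in> carrier G" "b \<in> carrier G" "a \<otimes> b = b \<otimes> a"
    and xy: "x \<in> generate G {a, b}" "y \<in> generate G {a, b}"
  shows "x \<otimes> y = y \<otimes> x"
proof -
  have X: "{a, b} \<subseteq> carrier G" using ab by simp
  have xG: "x \<in> carrier G" using generate_in_carrier[OF X xy(1)] .
  have "a \<otimes> x = x \<otimes> a" "b \<otimes> x = x \<otimes> b"
    using generate_commute[OF X _ _ xy(1)] ab by (metis insertE singletonD)+
  then show ?thesis
    using generate_commute[OF X xG _ xy(2)] by (metis insertE singletonD)
qed

text \<open>Reduces commutation up to \<open>c\<close> to generators. Writing it with a factor from
  \<open>{\<one>, c}\<close> treats both alternatives at once.\<close>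

lemma subgroup_comm_mod:
  assumes c: "c \<in> carrier G" "c \<otimes> c = \<one>" "\<And>g. g \<in> carrier G \<Longrightarrow> g \<otimes> c = c \<otimes> g" and g: "g \<in> carrier G"
  shows "subgroup {h \<in> carrier G. h \<otimes> g = g \<otimes> h \<or> h \<otimes> g = c \<otimes> (g \<otimes> h)} G" (is "subgroup ?H G")
proof -
  have H: "h \<in> ?H \<longleftrightarrow> h \<in> carrier G \<and> (\<exists>e\<in>{\<one>, c}. h \<otimes> g = e \<otimes> (g \<otimes> h))" for h
    using g by auto
  have e: "e \<in> carrier G" "e \<otimes> e = \<one>" "\<And>g. g \<in> carrier G \<Longrightarrow> g \<otimes> e = e \<otimes> g" if "e \<in> {\<one>, c}" for e
  proof -
    have ec: "e = \<one> \<or> e = c" using that by simp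
    then show "e \<in> carrier G" "e \<otimes> e = \<one>" using c(1,2) by auto
    show "g \<otimes> e = e \<otimes> g" if "g \<in> carrier G" for g using c(3)[OF that] ec that by auto
  qed
  show ?thesis
  proof
    fix h k assume "h \<in> ?H" "k \<in> ?H"
    then obtain d e where h: "h \<in> carrier G" "d \<in> {\<one>, c}" "h \<otimes> g = d \<otimes> (g \<otimes> h)"
      and k: "k \<in> carrier G" "e \<in> {\<one>, c}" "k \<otimes> g = e \<otimes> (g \<otimes> k)"
      unfolding H by blast
    have "(h \<otimes> k) \<otimes> g = h \<otimes> (k \<otimes> g)" using h(1) k(1) g by (simp add: m_assoc)
    also have "\<dots> = (h \<otimes> e) \<otimes> (g \<otimes> k)" unfolding k(3) using h(1) k(1) g e(1)[OF k(2)] by (simp add: m_assoc)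
    also have "\<dots> = e \<otimes> ((h \<otimes> g) \<otimes> k)" unfolding e(3)[OF k(2) h(1)] using h(1) k(1) g e(1)[OF k(2)] by (simp add: m_assoc)
    also have "\<dots> = (e \<otimes> d) \<otimes> (g \<otimes> (h \<otimes> k))" unfolding h(3) using h(1) k(1) g e(1)[OF h(2)] e(1)[OF k(2)] by (simp add: m_assoc)
    finally have "(h \<otimes> k) \<otimes> g = (e \<otimes> d) \<otimes> (g \<otimes> (h \<otimes> k))" .
    moreover have "e \<otimes> d \<in> {\<one>, c}" using h(2) k(2) c(1,2) by auto
    ultimately show "h \<otimes> k \<in> ?H" unfolding H using h(1) k(1) by blast
  next
    fix h assume "h \<in> ?H"
    then obtain d where h: "h \<in> carrier G" "d \<in> {\<one>, c}" "h \<otimes> g = d \<otimes> (g \<otimes> h)" unfolding H by blast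
    note d = e[OF h(2)]
    have "d \<otimes> (h \<otimes> g) = (d \<otimes> d) \<otimes> (g \<otimes> h)" unfolding h(3) using h(1) g d(1) by (simp add: m_assoc)
    then have gh: "g \<otimes> h = d \<otimes> (h \<otimes> g)" using h(1) g d(2) by simp
    have "inv h \<otimes> g = inv h \<otimes> ((g \<otimes> h) \<otimes> inv h)" using h(1) g by (simp add: m_assoc)
    also have "\<dots> = (inv h \<otimes> d) \<otimes> (h \<otimes> (g \<otimes> inv h))" unfolding gh using h(1) g d(1) by (simp add: m_assoc)
    also have "inv h \<otimes> d = d \<otimes> inv h" using d(3)[of "inv h"] h(1) by simp
    also have "d \<otimes> inv h \<otimes> (h \<otimes> (g \<otimes> inv h)) = d \<otimes> (g \<otimes> inv h)"
      using h(1) g d(1) by (simp add: m_assoc) (simp add: m_assoc[symmetric])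
    finally show "inv h \<in> ?H" unfolding H using h(1,2) by blast
  qed (use g in auto)
qed

text \<open>Every commutator of elements of \<open>K\<close> is \<one> or \<open>c\<close>. Applied
  to \<open>c\<close> itself this shows that \<open>c\<close> is central: otherwise
  \<open>x c = c (c x) = x\<close>, which gives \<open>c = \<one>\<close>.\<close>

lemma derived_order2:
  assumes K: "subgroup K G" and d: "derived G K = {\<one>, c}" and c: "c \<noteq> \<one>"
  shows "c \<in> K" "c \<otimes> c = \<one>" "\<And>x y. x \<in> K \<Longrightarrow> y \<in> K \<Longrightarrow> x \<otimes> y = y \<otimes> x \<or> x \<otimes> y = c \<otimes> (y \<otimes> x)"
    "\<And>x. x \<in> K \<Longrightarrow> x \<otimes> c = c \<otimes> x" "\<exists>x\<in>K. \<exists>y\<in>K. x \<otimes> y \<noteq> y \<otimes> x"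
proof -
  have KG: "K \<subseteq> carrier G" using K by (rule subgroup.subset)
  show cK: "c \<in> K" using derived_incl[OF subset_refl K] d by auto
  then have cG: "c \<in> carrier G" using KG by auto
  have "subgroup {\<one>, c} G" using derived_is_subgroup[OF KG] d by simp
  from subgroup.m_closed[OF this, of c c] have "c \<otimes> c = \<one> \<or> c \<otimes> c = c" by simp
  then show c2: "c \<otimes> c = \<one>" using cG c by auto
  show cm: "x \<otimes> y = y \<otimes> x \<or> x \<otimes> y = c \<otimes> (y \<otimes> x)" if xy: "x \<in> K" "y \<in> K" for x y
  proof -
    have G: "x \<in> carrier G" "y \<in> carrier G" using xy KG by auto
    have "x \<otimes> y \<otimes> inv x \<otimes> inv y \<in> derived G K"
      unfolding derived_def using xy by (intro generate.incl) blast
    then have e: "x \<otimes> y \<otimes> inv x \<otimes> inv y = \<one> \<or> x \<otimes> y \<otimes> inv x \<otimes> inv y = c" using d by simp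
    have "x \<otimes> y \<otimes> inv x \<otimes> inv y = (x \<otimes> y) \<otimes> inv (y \<otimes> x)"
      using G by (simp add: inv_mult_group m_assoc)
    then have xy': "x \<otimes> y = (x \<otimes> y \<otimes> inv x \<otimes> inv y) \<otimes> (y \<otimes> x)"
      using m_assoc[of "x \<otimes> y" "inv (y \<otimes> x)" "y \<otimes> x"] G by simp
    from e show ?thesis
    proof
      assume "x \<otimes> y \<otimes> inv x \<otimes> inv y = \<one>"
      then have "x \<otimes> y = \<one> \<otimes> (y \<otimes> x)" using xy' by (simp only:)
      then show ?thesis using G by simp
    next
      assume "x \<otimes> y \<otimes> inv x \<otimes> inv y = c"
      from xy'[unfolded this] show ?thesis by (rule disjI2)
    qed
  qed
  show "x \<otimes> c = c \<otimes> x" if x: "x \<in> K" for x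
  proof (rule ccontr)
    assume "x \<otimes> c \<noteq> c \<otimes> x"
    then have "x \<otimes> c = c \<otimes> (c \<otimes> x)" using cm[OF x cK] by blast
    also have "\<dots> = (c \<otimes> c) \<otimes> x" using x KG cG by (simp add: m_assoc subsetD)
    also have "\<dots> = x" using x KG c2 by (simp add: subsetD)
    finally show False using x KG cG c by (simp add: subsetD)
  qed
  show "\<exists>x\<in>K. \<exists>y\<in>K. x \<otimes> y \<noteq> y \<otimes> x"
  proof (rule ccontr)
    assume "\<not> ?thesis"
    then have "x \<otimes> y = y \<otimes> x" if "x \<in> K" "y \<in> K" for x y using that by blast
    then have "x \<otimes> y \<otimes> inv x \<otimes> inv y = \<one>" if "x \<in> K" "y \<in> K" for x y
    proof -
      have G: "x \<in> carrier G" "y \<in> carrier G" using that KG by auto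
      have "x \<otimes> y \<otimes> inv x \<otimes> inv y = y \<otimes> x \<otimes> inv x \<otimes> inv y" using that \<open>\<And>x y. x \<in> K \<Longrightarrow> y \<in> K \<Longrightarrow> x \<otimes> y = y \<otimes> x\<close> by metis
      also have "\<dots> = \<one>" using G by (simp add: m_assoc)
      finally show ?thesis .
    qed
    then have "derived_set G K \<subseteq> {\<one>}" by blast
    then have "derived G K \<subseteq> {\<one>}"
      unfolding derived_def using triv_subgroup by (rule generate_subgroup_incl)
    then show False using d c by auto
  qed
qed

section \<open>Generators of the factors and of the central product\<close>

text \<open>The derived subgroup is nontrivial, so \<open>a\<close> and \<open>b\<close> do not
  commute and \<open>a b = c b a\<close>. Comparison with the relation
  \<open>a b = b a^(1+2^n)\<close> identifies \<open>a^(2^n)\<close> with \<open>c\<close>. The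
  exponent sum of \<open>B\<close> gives the independence of \<open>b\<close>.\<close>

lemma M2_generators:
  assumes K: "subgroup K G" and iso: "G\<lparr>carrier := K\<rparr> \<cong> M2 (Suc n) (Suc m)"
    and d: "derived G K = {\<one>, c}" "c \<noteq> \<one>"
  obtains a b where "a \<in> K" "b \<in> K" "K \<subseteq> generate G {a, b}"
    "a [^] (2 ^ n :: nat) = c" "b [^] (2 ^ Suc m :: nat) = \<one>"
    "\<And>(i :: nat) (j :: nat). a [^] i \<otimes> b [^] j \<in> {\<one>, c} \<Longrightarrow> 2 ^ Suc m dvd j"
proof -
  define R :: "(gen word \<times> gen word) set" where "R = {(wpow A (2 ^ Suc n), []), (wpow B (2 ^ Suc m), []),
      ([(B, False), (A, True), (B, True)], wpow A (1 + 2 ^ n))}"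
  have iso': "G\<lparr>carrier := K\<rparr> \<cong> presented_group R"
    using iso by (simp add: M2_def R_def)
  note D = derived_order2[OF K d]
  obtain f a b where ab: "a \<in> K" "b \<in> K" "K \<subseteq> generate G {a, b}"
    and f: "\<And>u v. f (u @ v) = f u \<otimes> f v" "\<And>u v. f u = f v \<longleftrightarrow> pres_eq R u v" "f [] = \<one>"
      "f [(A, True)] = a" "f [(B, True)] = b" "f [(B, False)] = inv b"
      "\<And>i. f (wpow A i) = a [^] i" "\<And>i. f (wpow B i) = b [^] i"
    by (rule presented_by_two[OF K iso']) (rule that)
  have G: "a \<in> carrier G" "b \<in> carrier G" "c \<in> carrier G" using ab(1,2) D(1) subgroup.subset[OF K] by auto
  have rel: "f u = f v" if "(u, v) \<in> R" for u v using that f(2) pres_eq.rel by blast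
  have b_pow: "b [^] (2 ^ Suc m :: nat) = \<one>"
    using rel[of "wpow B (2 ^ Suc m)" "[]"] f(3,8) by (simp add: R_def)
  have "f ([(B, False)] @ [(A, True)] @ [(B, True)]) = a [^] (1 + 2 ^ n :: nat)"
    using rel[of "[(B, False), (A, True), (B, True)]" "wpow A (1 + 2 ^ n)"] f(7)[of "1 + 2 ^ n"] by (simp add: R_def)
  then have "inv b \<otimes> (a \<otimes> b) = a [^] (1 + 2 ^ n :: nat)"
    unfolding f(1) by (simp only: f(4,5,6))
  then have "a \<otimes> b = b \<otimes> a [^] (1 + 2 ^ n :: nat)"
    using G by (metis inv_solve_left m_closed nat_pow_closed)
  then have 1: "a \<otimes> b = b \<otimes> (a \<otimes> a [^] (2 ^ n :: nat))"
    using G nat_pow_mult[of a 1 "2 ^ n"] by simp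
  have "a \<otimes> b \<noteq> b \<otimes> a"
    using D(5) generate_two_commute[OF G(1,2)] ab(3) by blast
  then have "a \<otimes> b = c \<otimes> (b \<otimes> a)" using D(3)[OF ab(1,2)] by blast
  also have "\<dots> = b \<otimes> (a \<otimes> c)"
    using D(4)[OF ab(1)] D(4)[OF ab(2)] G by (metis m_assoc)
  finally have a_pow: "a [^] (2 ^ n :: nat) = c" using 1 G by simp
  have "2 ^ Suc m dvd j" if "a [^] i \<otimes> b [^] j \<in> {\<one>, c}" for i j :: nat
  proof -
    have R_dvd: "2 ^ Suc m dvd exponent_sum B u - exponent_sum B v" if "(u, v) \<in> R" for u v
      using that by (auto simp: R_def exponent_sum_wpow simp del: power_Suc)
    have dvd: "2 ^ Suc m dvd exponent_sum B u - exponent_sum B v" if "f u = f v" for u v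
      using that f(2) pres_eq_exponent_sum[OF _ R_dvd] by blast
    \<comment> \<open>Both \<one> and \<open>c\<close> are values of words in \<open>A\<close>
      alone, which have exponent sum 0 in \<open>B\<close>.\<close>
    have "f (wpow A i @ wpow B j) = f [] \<or> f (wpow A i @ wpow B j) = f (wpow A (2 ^ n))"
      using that unfolding f(1) f(3) f(7) f(8) a_pow by blast
    then have "(2 :: int) ^ Suc m dvd int j"
      by (auto dest!: dvd simp: exponent_sum_append exponent_sum_wpow simp del: power_Suc)
    then show ?thesis by (metis of_nat_dvd_iff of_nat_numeral of_nat_power)
  qed
  then show ?thesis by (rule that[OF ab a_pow b_pow])
qed

text \<open>The relation gives \<open>x y = y x^-1\<close> and noncommutativity gives
  \<open>x y = c y x\<close>, so \<open>x^-1 = c x\<close> and \<open>x^2 = c\<close>.\<close>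

lemma D8_generators:
  assumes K: "subgroup K G" and iso: "G\<lparr>carrier := K\<rparr> \<cong> D8"
    and d: "derived G K = {\<one>, c}" "c \<noteq> \<one>"
  obtains x y where "x \<in> K" "y \<in> K" "K \<subseteq> generate G {x, y}" "x \<otimes> x = c" "y \<otimes> y = \<one>" "x \<otimes> y \<noteq> y \<otimes> x"
proof -
  define R :: "(gen word \<times> gen word) set" where "R = {(wpow A 4, []), (wpow B 2, []),
      ([(B, False), (A, True), (B, True)], [(A, False)])}"
  have iso': "G\<lparr>carrier := K\<rparr> \<cong> presented_group R"
    using iso by (simp add: D8_def R_def)
  note D = derived_order2[OF K d]
  obtain f x y where xy: "x \<in> K" "y \<in> K" "K \<subseteq> generate G {x, y}"
    and f: "\<And>u v. f (u @ v) = f u \<otimes> f v" "\<And>u v. f u = f v \<longleftrightarrow> pres_eq R u v" "f [] = \<one>"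
      "f [(A, True)] = x" "f [(B, True)] = y" "f [(A, False)] = inv x" "f [(B, False)] = inv y"
      "\<And>i. f (wpow B i) = y [^] i"
    by (rule presented_by_two[OF K iso']) (rule that)
  have G: "x \<in> carrier G" "y \<in> carrier G" "c \<in> carrier G" using xy(1,2) D(1) subgroup.subset[OF K] by auto
  have rel: "f u = f v" if "(u, v) \<in> R" for u v using that f(2) pres_eq.rel by blast
  have y2: "y \<otimes> y = \<one>"
    using rel[of "wpow B 2" "[]"] f(3) f(8)[of 2] G by (simp add: R_def numeral_2_eq_2)
  have "f ([(B, False)] @ [(A, True)] @ [(B, True)]) = inv x"
    using rel[of "[(B, False), (A, True), (B, True)]" "[(A, False)]"] f(6) by (simp add: R_def)
  then have "inv y \<otimes> (x \<otimes> y) = inv x"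
    unfolding f(1) by (simp only: f(4,5,7))
  then have 1: "x \<otimes> y = y \<otimes> inv x"
    using G by (metis inv_solve_left m_closed inv_closed)
  have nc: "x \<otimes> y \<noteq> y \<otimes> x"
    using D(5) generate_two_commute[OF G(1,2)] xy(3) by blast
  then have "x \<otimes> y = c \<otimes> (y \<otimes> x)" using D(3)[OF xy(1,2)] by blast
  also have "\<dots> = y \<otimes> (c \<otimes> x)"
    using D(4)[OF xy(2)] G by (metis m_assoc)
  finally have "inv x = c \<otimes> x" using 1 G by simp
  then have "c \<otimes> (x \<otimes> x) = \<one>" using G by (metis l_inv m_assoc)
  then have "c \<otimes> (x \<otimes> x) = c \<otimes> c" using D(2) by simp
  then have "x \<otimes> x = c" using G by simp
  from that[OF xy this y2 nc] show ?thesis .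
qed

text \<open>Different factors commute, so commutation up to \<open>c\<close> holds between elements
  of the factors. It passes to the whole group, whose derived subgroup is therefore
  \<open>{\<one>, c}\<close> again.\<close>

lemma central_product_structure:
  assumes cp: "is_central_product G (M2 (Suc n) (Suc m) # replicate (k - 1) D8)"
    and nmk: "n \<ge> 1" "m \<ge> 1" "k \<ge> 1"
  obtains a b c w where "m2_d8_product G a b c w n m k" "derived G (carrier G) = {\<one>, c}"
proof -
  let ?Hs = "M2 (Suc n) (Suc m) # replicate (k - 1) D8"
  have len: "length ?Hs = k" using nmk by simp
  obtain K c where c: "c \<in> carrier G" "c \<noteq> \<one>"
    and K0: "\<And>i. i < k \<Longrightarrow> subgroup (K i) G \<and> G\<lparr>carrier := K i\<rparr> \<cong> ?Hs ! i \<and> derived G (K i) = {\<one>, c}"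
    and gen: "carrier G = generate G (\<Union>i<k. K i)"
    and comm0: "\<And>i j x y. i < k \<Longrightarrow> j < k \<Longrightarrow> i \<noteq> j \<Longrightarrow> x \<in> K i \<Longrightarrow> y \<in> K j \<Longrightarrow> x \<otimes> y = y \<otimes> x"
    using cp unfolding is_central_product_def len by metis
  have K: "subgroup (K i) G" "derived G (K i) = {\<one>, c}" if "i < k" for i
    using K0 that by auto
  note D = derived_order2[OF K(1) K(2) c(2)]
  have K_G: "K i \<subseteq> carrier G" if "i < k" for i using subgroup.subset[OF K(1)[OF that]] .
  have U: "(\<Union>i<k. K i) \<subseteq> carrier G" using K_G by auto
  have k0: "0 < k" using nmk by simp
  have c2: "c \<otimes> c = \<one>" using D(2)[OF k0 k0] .
  have c_central: "g \<otimes> c = c \<otimes> g" if "g \<in> carrier G" for g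
    using that unfolding gen
    by (rule generate_commute[OF U c(1), rotated]) (use D(4) in auto)
  have cm1: "x \<otimes> y = y \<otimes> x \<or> x \<otimes> y = c \<otimes> (y \<otimes> x)" if "x \<in> (\<Union>i<k. K i)" "y \<in> (\<Union>i<k. K i)" for x y
  proof -
    obtain i j where ij: "i < k" "j < k" "x \<in> K i" "y \<in> K j" using \<open>x \<in> _\<close> \<open>y \<in> _\<close> by blast
    show ?thesis
    proof (cases "i = j")
      case True
      then show ?thesis using D(3)[OF ij(1) ij(1), of x y] ij by simp
    next
      case False
      then show ?thesis using comm0[OF ij(1,2) False ij(3,4)] by simp
    qed
  qed
  have incl: "carrier G \<subseteq> {h \<in> carrier G. h \<otimes> g = g \<otimes> h \<or> h \<otimes> g = c \<otimes> (g \<otimes> h)}"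
    if g: "g \<in> carrier G" "\<And>x. x \<in> (\<Union>i<k. K i) \<Longrightarrow> x \<otimes> g = g \<otimes> x \<or> x \<otimes> g = c \<otimes> (g \<otimes> x)" for g
    using generate_subgroup_incl[OF _ subgroup_comm_mod[OF c(1) c2 c_central g(1)], of "\<Union>i<k. K i"] U g(2)
    unfolding gen[symmetric] by blast
  have swap: "h \<otimes> g = g \<otimes> h \<or> h \<otimes> g = c \<otimes> (g \<otimes> h)"
    if "g \<otimes> h = h \<otimes> g \<or> g \<otimes> h = c \<otimes> (h \<otimes> g)" "g \<in> carrier G" "h \<in> carrier G" for g h
    using that(1)
  proof
    assume "g \<otimes> h = c \<otimes> (h \<otimes> g)"
    then have "c \<otimes> (g \<otimes> h) = (c \<otimes> c) \<otimes> (h \<otimes> g)" using that c(1) by (simp add: m_assoc)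
    then show ?thesis using that c2 by simp
  qed simp
  \<comment> \<open>One argument runs over the whole group while the other stays in a factor;
    \<open>swap\<close> then exchanges the roles to release the second argument.\<close>
  have cm2: "g \<otimes> x = x \<otimes> g \<or> g \<otimes> x = c \<otimes> (x \<otimes> g)" if "g \<in> carrier G" "x \<in> (\<Union>i<k. K i)" for g x
    using incl[of x] cm1 that U by blast
  have comm_mod: "g \<otimes> h = h \<otimes> g \<or> g \<otimes> h = c \<otimes> (h \<otimes> g)" if "g \<in> carrier G" "h \<in> carrier G" for g h
  proof -
    have "x \<otimes> h = h \<otimes> x \<or> x \<otimes> h = c \<otimes> (h \<otimes> x)" if "x \<in> (\<Union>i<k. K i)" for x
      using swap cm2 that \<open>h \<in> carrier G\<close> U by blast
    then show ?thesis using incl[OF \<open>h \<in> carrier G\<close>] \<open>g \<in> carrier G\<close> by blast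
  qed
  have iso0: "G\<lparr>carrier := K 0\<rparr> \<cong> M2 (Suc n) (Suc m)" using K0[OF k0] by simp
  obtain a b where ab: "a \<in> K 0" "b \<in> K 0" "K 0 \<subseteq> generate G {a, b}"
    "a [^] (2 ^ n :: nat) = c" "b [^] (2 ^ Suc m :: nat) = \<one>"
    "\<And>(i :: nat) (j :: nat). a [^] i \<otimes> b [^] j \<in> {\<one>, c} \<Longrightarrow> 2 ^ Suc m dvd j"
    by (rule M2_generators[OF K(1)[OF k0] iso0 K(2)[OF k0] c(2)]) (rule that)
  have "\<exists>q. fst q \<in> K l \<and> snd q \<in> K l \<and> K l \<subseteq> generate G {fst q, snd q} \<and> fst q \<otimes> fst q = c \<and>
      snd q \<otimes> snd q = \<one> \<and> fst q \<otimes> snd q \<noteq> snd q \<otimes> fst q" if l: "l \<in> {1..<k}" for l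
  proof -
    have lk: "l < k" using l by simp
    have "?Hs ! l = D8" using l by (cases l) auto
    then have "G\<lparr>carrier := K l\<rparr> \<cong> D8" using K0[OF lk] by simp
    then obtain x y where "x \<in> K l" "y \<in> K l" "K l \<subseteq> generate G {x, y}" "x \<otimes> x = c" "y \<otimes> y = \<one>"
      "x \<otimes> y \<noteq> y \<otimes> x"
      by (rule D8_generators[OF K(1)[OF lk] _ K(2)[OF lk] c(2)])
    then show ?thesis by (intro exI[of _ "(x, y)"]) simp
  qed
  then obtain q where q: "\<And>l. l \<in> {1..<k} \<Longrightarrow> fst (q l) \<in> K l \<and> snd (q l) \<in> K l \<and>
      K l \<subseteq> generate G {fst (q l), snd (q l)} \<and> fst (q l) \<otimes> fst (q l) = c \<and>
      snd (q l) \<otimes> snd (q l) = \<one> \<and> fst (q l) \<otimes> snd (q l) \<noteq> snd (q l) \<otimes> fst (q l)"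
    by metis
  define w where "w s = (if snd s then snd (q (fst s)) else fst (q (fst s)))" for s :: "nat \<times> bool"
  have wK: "w s \<in> K (fst s)" if "s \<in> {1..<k} \<times> UNIV" for s
    using that q by (auto simp: w_def)
  have fs: "fst s < k" "fst s \<noteq> 0" if "s \<in> {1..<k} \<times> UNIV" for s
    using that by auto
  let ?gens = "{a, b} \<union> w ` ({1..<k} \<times> UNIV)"
  have gens_G: "?gens \<subseteq> carrier G"
    using ab(1,2) K_G[OF k0] wK K_G fs by blast
  have "K l \<subseteq> generate G ?gens" if l: "l < k" for l
  proof (cases "l = 0")
    case True
    then show ?thesis using ab(3) mono_generate[of "{a, b}" ?gens] by blast
  next
    case False
    then have l1: "l \<in> {1..<k}" using l by simp
    then have "w (l, False) \<in> ?gens" "w (l, True) \<in> ?gens" by blast+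
    then have "{fst (q l), snd (q l)} \<subseteq> ?gens" by (simp add: w_def)
    then show ?thesis using q[OF l1] mono_generate by blast
  qed
  then have "(\<Union>i<k. K i) \<subseteq> generate G ?gens" by blast
  then have gen': "carrier G = generate G ?gens"
    using generate_subgroup_incl[OF _ generate_is_subgroup[OF gens_G]] generate_incl[OF gens_G] gen by blast
  have "m2_d8_product G a b c w n m k"
  proof unfold_locales
    show "a \<in> carrier G" "b \<in> carrier G" using ab(1,2) K_G[OF k0] by auto
    show "w s \<in> carrier G" if "s \<in> {1..<k} \<times> UNIV" for s
      using wK[OF that] K_G[OF fs(1)[OF that]] by blast
    show "w s \<otimes> w s \<in> {\<one>, c}" if "s \<in> {1..<k} \<times> UNIV" for s
      using that q by (auto simp: w_def)
    show "a \<otimes> w s = w s \<otimes> a" "b \<otimes> w s = w s \<otimes> b" if "s \<in> {1..<k} \<times> UNIV" for s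
      using comm0[OF k0 fs(1)[OF that] _ _ wK[OF that]] ab(1,2) fs(2)[OF that] by auto
    show "w s \<otimes> w t = w t \<otimes> w s \<longleftrightarrow> t \<noteq> partner s"
      if s: "s \<in> {1..<k} \<times> UNIV" and t: "t \<in> {1..<k} \<times> UNIV" for s t
    proof (cases "fst s = fst t")
      case True
      have "fst s \<in> {1..<k}" using s by auto
      from q[OF this] show ?thesis
        using True by (cases "snd s"; cases "snd t") (auto simp: w_def partner_def prod_eq_iff)
    next
      case False
      then show ?thesis
        using comm0[OF fs(1)[OF s] fs(1)[OF t] False wK[OF s] wK[OF t]] by (auto simp: partner_def)
    qed
    show "w (1, False) \<otimes> w (1, False) = c" "w (1, True) \<otimes> w (1, True) = \<one>" if "2 \<le> k"
      using that q[of 1] by (auto simp: w_def)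
  qed (fact c c2 c_central comm_mod ab(4-6) gen' nmk)+
  moreover have "derived G (carrier G) = {\<one>, c}"
  proof (intro equalityI)
    have C: "subgroup {\<one>, c} G" using derived_is_subgroup[OF K_G[OF k0]] K(2)[OF k0] by simp
    have "g \<otimes> h \<otimes> inv g \<otimes> inv h \<in> {\<one>, c}" if gh: "g \<in> carrier G" "h \<in> carrier G" for g h
      using comm_mod[OF gh]
    proof
      assume "g \<otimes> h = h \<otimes> g"
      then show ?thesis using gh by (simp add: m_assoc)
    next
      assume "g \<otimes> h = c \<otimes> (h \<otimes> g)"
      then show ?thesis using gh c(1) by (simp add: m_assoc)
    qed
    then have "derived_set G (carrier G) \<subseteq> {\<one>, c}" by blast
    then show "derived G (carrier G) \<subseteq> {\<one>, c}"
      unfolding derived_def using C by (rule generate_subgroup_incl)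
    show "{\<one>, c} \<subseteq> derived G (carrier G)"
      using mono_derived[OF K_G[OF k0]] K(2)[OF k0] by simp
  qed
  ultimately show ?thesis by (rule that)
qed

end

theorem theorem4p9:
  fixes G :: "('g, 'x) monoid_scheme"
    and n m k :: nat
    and c :: 'g
  assumes "CHAR('f::{field, finite}) = 2"
    and "group G"
    and "n \<ge> m" and "m \<ge> 1" and "k \<ge> 1"
    and "is_central_product G (M2 (n + 1) (m + 1) # replicate (k - 1) D8)"
    and "c \<in> carrier G" and "derived G (carrier G) = generate G {c}"
  shows "(card (Omega1 G) = 2 ^ (2 * k) \<and> card (Omega G c) = 2 ^ (2 * k)) \<and>
    card (V_star G :: ('g \<Rightarrow> 'f) set) =
      (if n = 1 \<and> k \<ge> 2
       then 2 * card (UNIV :: 'f set) ^ ((order G + card (Omega1 G)) div 2 - 1)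
       else 4 * card (UNIV :: 'f set) ^ ((order G + card (Omega1 G)) div 2 - 1))"
proof -
  interpret group G by (rule assms(2))
  have F: "char2 TYPE('f)" using assms(1) by unfold_locales
  obtain a b c' w where P: "m2_d8_product G a b c' w n m k" and d: "derived G (carrier G) = {\<one>\<^bsub>G\<^esub>, c'}"
    by (rule central_product_structure[of n m k]) (use assms(3-6) in \<open>auto intro: that\<close>)
  interpret m2_d8_product G a b c' w n m k by (rule P)
  \<comment> \<open>The given generator of the derived subgroup is nontrivial, since \<one>
    generates the trivial group, so it is the \<open>c'\<close> of the structure.\<close>
  have "c \<in> {\<one>\<^bsub>G\<^esub>, c'}" using d assms(8) generate.incl[of c "{c}" G] by auto
  moreover have "c \<noteq> \<one>\<^bsub>G\<^esub>" using d assms(8) generate_one c_neq by auto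
  ultimately have cc: "c = c'" by simp
  have sq: "g [^]\<^bsub>G\<^esub> (2::nat) = g \<otimes>\<^bsub>G\<^esub> g" if "g \<in> carrier G" for g
    using that by (simp add: numeral_2_eq_2)
  have O: "Omega G e = {g \<in> carrier G. g \<otimes>\<^bsub>G\<^esub> g = e}" for e
    using sq by (auto simp: Omega_def)
  interpret E: central_ext G "TYPE('f)" Q p c' by (rule central_ext_Q[OF F])
  show ?thesis
    using unitary_count[OF F] by (simp add: Omega1_def O cc E.V_star_eq_US order_def)
qed

end
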